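(* Let $K$ be a finite extension of $\mathbb{Q}_p$ with valuation $v$ and residue field of size $N_K$. Let $E$ be an elliptic curve over $K$ in minimal Weierstrass form with discriminant $\Delta_E$, let $P\in E(K)$ be a point with singular reduction, and let $W_n=\Psi_n(P)$ be the associated elliptic divisibility sequence. Then, as $n\to\infty$ through positive integers with $[n]P\ne\mathcal{O}$, $$v(W_n)=\left(-\frac{\lambda_v(P)}{\log N_K}+\frac{v(\Delta_E)}{12}\right)n^2+O(\log n),$$ where the implied constant may depend on $K$, $E$ and $P$.
   Context: $v$ is the normalized discrete valuation of $K$ (a uniformizer has valuation $1$), and $|x|_v=N_K^{-v(x)}$. The Néron local height $\lambda_v:E(K)\setminus\{\mathcal{O}\}\to\mathbb{R}$, with Silverman's normalization, is the unique function that is continuous and bounded on the complement of any $v$-adic neighbourhood of $\mathcal{O}$, for which $\lim_{Q\to\mathcal{O}}\left(\lambda_v(Q)-\frac12\log|x(Q)|_v\right)$ exists, and such that $\lambda_v([2]Q)=4\lambda_v(Q)-\log|(2y+a_1x+a_3)(Q)|_v+\frac14\log|\Delta_E|_v$ for all $Q\in E(K)$ with $[2]Q\neq\mathcal{O}$. Division polynomials: for $y^2+a_1xy+a_3y=x^3+a_2x^2+a_4x+a_6$, with $b_2,b_4,b_6,b_8$ the usual quantities, $\Psi_n$ ($n\ge1$) are the usual division polynomials, normalized by $\Psi_1=1$, $\Psi_2=2y+a_1x+a_3$, $\Psi_3=3x^4+b_2x^3+3b_4x^2+3b_6x+b_8$, $\Psi_4=\Psi_2\cdot(2x^6+b_2x^5+5b_4x^4+10b_6x^3+10b_8x^2+(b_2b_8-b_4b_6)x+(b_4b_8-b_6^2))$,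 $\Psi_{2m+1}=\Psi_{m+2}\Psi_m^3-\Psi_{m-1}\Psi_{m+1}^3$ $(m\ge2)$, $\Psi_{2m}\Psi_2=\Psi_{m-1}^2\Psi_m\Psi_{m+2}-\Psi_{m-2}\Psi_m\Psi_{m+1}^2$ $(m\ge3)$; if $\Psi_2(P)=0$ then $\Psi_{2m}(P)=0$ for all $m$. *)

theory Defs
  imports
    "HOL-Analysis.Analysis"
    "HOL-Library.Landau_Symbols"
    "HOL-Computational_Algebra.Polynomial"
    "HOL-Computational_Algebra.Primes"
begin

section \<open>Discrete valuations\<close>

text \<open>A valuation is a function into \<^typ>\<open>int\<close> whose value at \<open>0\<close> is irrelevant;
  \<open>val_ge v M x\<close> expresses \<open>v x \<ge> M\<close> under the convention that \<open>0\<close> has valuation \<open>\<infinity>\<close>.\<close>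

definition val_ge :: "('a::zero \<Rightarrow> int) \<Rightarrow> int \<Rightarrow> 'a \<Rightarrow> bool" where
  "val_ge v M x \<longleftrightarrow> x = 0 \<or> v x \<ge> M"

definition normalized_valuation :: "('a::field \<Rightarrow> int) \<Rightarrow> bool" where
  "normalized_valuation v \<longleftrightarrow>
     (\<forall>x y. x \<noteq> 0 \<longrightarrow> y \<noteq> 0 \<longrightarrow> v (x * y) = v x + v y) \<and>
     (\<forall>M x y. val_ge v M x \<longrightarrow> val_ge v M y \<longrightarrow> val_ge v M (x + y)) \<and>
     (\<exists>\<pi>. \<pi> \<noteq> 0 \<and> v \<pi> = 1)"

definition valuation_ring :: "('a::field \<Rightarrow> int) \<Rightarrow> 'a set" where
  "valuation_ring v = {x. val_ge v 0 x}"

definition maximal_ideal :: "('a::field \<Rightarrow> int) \<Rightarrow> 'a set" where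
  "maximal_ideal v = {x. val_ge v 1 x}"

definition residue_field :: "('a::field \<Rightarrow> int) \<Rightarrow> 'a set set" where
  "residue_field v =
     valuation_ring v // {(x, y) \<in> valuation_ring v \<times> valuation_ring v. x - y \<in> maximal_ideal v}"

definition residue_card :: "('a::field \<Rightarrow> int) \<Rightarrow> nat" where
  "residue_card v = card (residue_field v)"

definition vabs :: "('a::field \<Rightarrow> int) \<Rightarrow> 'a \<Rightarrow> real" where
  "vabs v x = (if x = 0 then 0 else real (residue_card v) powr (- real_of_int (v x)))"


section \<open>Finite extensions of the field of p-adic numbers\<close>

definition padic_val_rat :: "nat \<Rightarrow> rat \<Rightarrow> int" where
  "padic_val_rat p r =
     int (multiplicity (int p) (fst (quotient_of r))) - int (multiplicity (int p) (snd (quotient_of r)))"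

text \<open>The field of type \<open>'q\<close> with valuation \<open>w\<close> is the completion of the rationals with respect
  to the p-adic valuation; this determines it up to unique isomorphism.\<close>

definition is_Qp :: "nat \<Rightarrow> ('q::field_char_0 \<Rightarrow> int) \<Rightarrow> bool" where
  "is_Qp p w \<longleftrightarrow>
     normalized_valuation w \<and>
     (\<forall>r. r \<noteq> 0 \<longrightarrow> w (of_rat r) = padic_val_rat p r) \<and>
     (\<forall>x M. \<exists>r. val_ge w M (x - of_rat r)) \<and>
     (\<forall>s :: nat \<Rightarrow> 'q.
        (\<forall>M. \<exists>k. \<forall>m\<ge>k. \<forall>n\<ge>k. val_ge w M (s m - s n)) \<longrightarrow>
        (\<exists>l. \<forall>M. \<exists>k. \<forall>n\<ge>k. val_ge w M (s n - l)))"

text \<open>The vector space axioms force \<open>\<iota>\<close> to be a homomorphism of fields.\<close>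

definition finite_extension :: "('q::field \<Rightarrow> 'k::field) \<Rightarrow> bool" where
  "finite_extension \<iota> \<longleftrightarrow> (\<exists>B. finite_dimensional_vector_space (\<lambda>c x. \<iota> c * x) B)"

text \<open>The factor \<open>e\<close> is the ramification index.\<close>

definition extends_valuation :: "('q::field \<Rightarrow> int) \<Rightarrow> ('q \<Rightarrow> 'k::field) \<Rightarrow> ('k \<Rightarrow> int) \<Rightarrow> bool" where
  "extends_valuation w \<iota> v \<longleftrightarrow> (\<exists>e>0. \<forall>c. c \<noteq> 0 \<longrightarrow> v (\<iota> c) = e * w c)"


section \<open>Weierstrass equations\<close>

text \<open>The equation \<open>y\<^sup>2 + a1 x y + a3 y = x\<^sup>3 + a2 x\<^sup>2 + a4 x + a6\<close>.\<close>

record 'k weierstrass =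
  a1 :: 'k
  a2 :: 'k
  a3 :: 'k
  a4 :: 'k
  a6 :: 'k

definition b2 :: "'k::field weierstrass \<Rightarrow> 'k" where
  "b2 E = (a1 E)^2 + 4 * a2 E"

definition b4 :: "'k::field weierstrass \<Rightarrow> 'k" where
  "b4 E = 2 * a4 E + a1 E * a3 E"

definition b6 :: "'k::field weierstrass \<Rightarrow> 'k" where
  "b6 E = (a3 E)^2 + 4 * a6 E"

definition b8 :: "'k::field weierstrass \<Rightarrow> 'k" where
  "b8 E = (a1 E)^2 * a6 E + 4 * a2 E * a6 E - a1 E * a3 E * a4 E + a2 E * (a3 E)^2 - (a4 E)^2"

definition disc :: "'k::field weierstrass \<Rightarrow> 'k" where
  "disc E = - ((b2 E)^2 * b8 E) - 8 * (b4 E)^3 - 27 * (b6 E)^2 + 9 * b2 E * b4 E * b6 E"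

definition elliptic_curve :: "'k::field weierstrass \<Rightarrow> bool" where
  "elliptic_curve E \<longleftrightarrow> disc E \<noteq> 0"

text \<open>The equation obtained by substituting \<open>x = u\<^sup>2 x' + r\<close>, \<open>y = u\<^sup>3 y' + s u\<^sup>2 x' + t\<close>.\<close>

definition change_vars :: "'k::field \<Rightarrow> 'k \<Rightarrow> 'k \<Rightarrow> 'k \<Rightarrow> 'k weierstrass \<Rightarrow> 'k weierstrass" where
  "change_vars u r s t E =
    \<lparr> a1 = (a1 E + 2 * s) / u,
      a2 = (a2 E - s * a1 E + 3 * r - s^2) / u^2,
      a3 = (a3 E + r * a1 E + 2 * t) / u^3,
      a4 = (a4 E - s * a3 E + 2 * r * a2 E - (t + r * s) * a1 E + 3 * r^2 - 2 * s * t) / u^4,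
      a6 = (a6 E + r * a4 E + r^2 * a2 E + r^3 - t * a3 E - t^2 - r * t * a1 E) / u^6 \<rparr>"

definition integral_weierstrass :: "('k::field \<Rightarrow> int) \<Rightarrow> 'k weierstrass \<Rightarrow> bool" where
  "integral_weierstrass v E \<longleftrightarrow> {a1 E, a2 E, a3 E, a4 E, a6 E} \<subseteq> valuation_ring v"

definition minimal_weierstrass :: "('k::field \<Rightarrow> int) \<Rightarrow> 'k weierstrass \<Rightarrow> bool" where
  "minimal_weierstrass v E \<longleftrightarrow>
     integral_weierstrass v E \<and>
     (\<forall>u r s t. u \<noteq> 0 \<longrightarrow> integral_weierstrass v (change_vars u r s t E) \<longrightarrow>
        v (disc E) \<le> v (disc (change_vars u r s t E)))"


section \<open>Points and the group law\<close>

datatype 'k point = Infinity | Affine 'k 'k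

fun on_curve :: "'k::field weierstrass \<Rightarrow> 'k point \<Rightarrow> bool" where
  "on_curve E Infinity \<longleftrightarrow> True"
| "on_curve E (Affine x y) \<longleftrightarrow>
     y^2 + a1 E * x * y + a3 E * y = x^3 + a2 E * x^2 + a4 E * x + a6 E"

definition points :: "'k::field weierstrass \<Rightarrow> 'k point set" where
  "points E = {P. on_curve E P}"

fun ec_add :: "'k::field weierstrass \<Rightarrow> 'k point \<Rightarrow> 'k point \<Rightarrow> 'k point" where
  "ec_add E Infinity Q = Q"
| "ec_add E P Infinity = P"
| "ec_add E (Affine x1 y1) (Affine x2 y2) =
     (if x1 = x2 \<and> y1 + y2 + a1 E * x2 + a3 E = 0 then Infinity
      else
        let l = (if x1 = x2
                 then (3 * x1^2 + 2 * a2 E * x1 + a4 E - a1 E * y1) / (2 * y1 + a1 E * x1 + a3 E)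
                 else (y2 - y1) / (x2 - x1));
            x3 = l^2 + a1 E * l - a2 E - x1 - x2;
            y3 = - (l + a1 E) * x3 - (y1 - l * x1) - a3 E
        in Affine x3 y3)"

fun ec_mult :: "'k::field weierstrass \<Rightarrow> nat \<Rightarrow> 'k point \<Rightarrow> 'k point" where
  "ec_mult E 0 P = Infinity"
| "ec_mult E (Suc n) P = ec_add E P (ec_mult E n P)"


section \<open>Singular reduction\<close>

text \<open>\<open>homogeneous P X Y Z\<close> states that \<open>P = [X : Y : Z]\<close>.\<close>

fun homogeneous :: "'k::field point \<Rightarrow> 'k \<Rightarrow> 'k \<Rightarrow> 'k \<Rightarrow> bool" where
  "homogeneous Infinity X Y Z \<longleftrightarrow> X = 0 \<and> Y \<noteq> 0 \<and> Z = 0"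
| "homogeneous (Affine x y) X Y Z \<longleftrightarrow> Z \<noteq> 0 \<and> X = x * Z \<and> Y = y * Z"

text \<open>With respect to primitive homogeneous coordinates of \<open>P\<close>, the three partial derivatives of
  \<open>Y\<^sup>2 Z + a1 X Y Z + a3 Y Z\<^sup>2 - X\<^sup>3 - a2 X\<^sup>2 Z - a4 X Z\<^sup>2 - a6 Z\<^sup>3\<close> vanish in the residue field.
  All primitive coordinates differ by units, so the choice does not matter.\<close>

definition singular_reduction :: "('k::field \<Rightarrow> int) \<Rightarrow> 'k weierstrass \<Rightarrow> 'k point \<Rightarrow> bool" where
  "singular_reduction v E P \<longleftrightarrow>
     (\<exists>X Y Z. homogeneous P X Y Z \<and>
        {X, Y, Z} \<subseteq> valuation_ring v \<and> \<not> {X, Y, Z} \<subseteq> maximal_ideal v \<and>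
        a1 E * Y * Z - 3 * X^2 - 2 * a2 E * X * Z - a4 E * Z^2 \<in> maximal_ideal v \<and>
        2 * Y * Z + a1 E * X * Z + a3 E * Z^2 \<in> maximal_ideal v \<and>
        Y^2 + a1 E * X * Y + 2 * a3 E * Y * Z - a2 E * X^2 - 2 * a4 E * X * Z - 3 * a6 E * Z^2
          \<in> maximal_ideal v)"


section \<open>The v-adic topology on the points and the local height\<close>

text \<open>A neighbourhood basis at each point, for the topology induced from the projective plane:
  the chart \<open>Z \<noteq> 0\<close> with coordinates \<open>(x, y)\<close> is used at affine points, and the chart \<open>Y \<noteq> 0\<close>
  with coordinates \<open>(X/Y, Z/Y) = (x/y, 1/y)\<close> at infinity.\<close>

fun point_nbhd :: "('k::field \<Rightarrow> int) \<Rightarrow> 'k weierstrass \<Rightarrow> int \<Rightarrow> 'k point \<Rightarrow> 'k point set" where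
  "point_nbhd v E M (Affine x y) =
     {Affine x' y' | x' y'. on_curve E (Affine x' y') \<and> val_ge v M (x' - x) \<and> val_ge v M (y' - y)}"
| "point_nbhd v E M Infinity =
     insert Infinity
       {Affine x y | x y. on_curve E (Affine x y) \<and> y \<noteq> 0 \<and> val_ge v M (x / y) \<and> val_ge v M (1 / y)}"

definition points_topology :: "('k::field \<Rightarrow> int) \<Rightarrow> 'k weierstrass \<Rightarrow> 'k point topology" where
  "points_topology v E =
     topology (\<lambda>U. U \<subseteq> points E \<and> (\<forall>P\<in>U. \<exists>M. point_nbhd v E M P \<subseteq> U))"

lemma point_nbhd_antimono: "M \<le> N \<Longrightarrow> point_nbhd v E N P \<subseteq> point_nbhd v E M P"
  by (cases P) (auto simp: val_ge_def)

lemma openin_points_topology: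
  "openin (points_topology v E) U \<longleftrightarrow>
     U \<subseteq> points E \<and> (\<forall>P\<in>U. \<exists>M. point_nbhd v E M P \<subseteq> U)"
proof -
  let ?L = "\<lambda>U. U \<subseteq> points E \<and> (\<forall>P\<in>U. \<exists>M. point_nbhd v E M P \<subseteq> U)"
  have "?L (S \<inter> T)" if S: "?L S" and T: "?L T" for S T
  proof (intro conjI ballI)
    show "S \<inter> T \<subseteq> points E" using S by blast
    fix P assume "P \<in> S \<inter> T"
    then obtain M N where "point_nbhd v E M P \<subseteq> S" "point_nbhd v E N P \<subseteq> T"
      using S T by blast
    then have "point_nbhd v E (max M N) P \<subseteq> S \<inter> T"
      using point_nbhd_antimono[of M "max M N" v E P] point_nbhd_antimono[of N "max M N" v E P]
      by auto
    then show "\<exists>M. point_nbhd v E M P \<subseteq> S \<inter> T" ..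
  qed
  moreover have "?L (\<Union>\<K>)" if "\<forall>K\<in>\<K>. ?L K" for \<K>
    using that by (meson Sup_upper Union_iff Sup_least subset_trans)
  ultimately have "istopology ?L"
    unfolding istopology_def by blast
  then show ?thesis
    unfolding points_topology_def by (simp add: topology_inverse')
qed

lemma topspace_points_topology: "topspace (points_topology v E) = points E"
proof
  show "topspace (points_topology v E) \<subseteq> points E"
    using openin_points_topology openin_topspace by blast
  have "point_nbhd v E 0 P \<subseteq> points E" for P
    by (cases P) (auto simp: points_def)
  then have "openin (points_topology v E) (points E)"
    unfolding openin_points_topology by blast
  then show "points E \<subseteq> topspace (points_topology v E)"
    by (rule openin_subset)
qed

fun xcoord :: "'k::field point \<Rightarrow> 'k" where
  "xcoord (Affine x y) = x"
| "xcoord Infinity = 0"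

text \<open>The value of \<open>lam\<close> at infinity is irrelevant.\<close>

definition neron_local_height ::
  "('k::field \<Rightarrow> int) \<Rightarrow> 'k weierstrass \<Rightarrow> ('k point \<Rightarrow> real) \<Rightarrow> bool" where
  "neron_local_height v E lam \<longleftrightarrow>
     (\<forall>U. openin (points_topology v E) U \<longrightarrow> Infinity \<in> U \<longrightarrow>
        continuous_map (subtopology (points_topology v E) (points E - U)) euclideanreal lam \<and>
        bounded (lam ` (points E - U))) \<and>
     (\<exists>L. ((\<lambda>Q. lam Q - 1/2 * ln (vabs v (xcoord Q))) \<longlongrightarrow> L)
            (atin (points_topology v E) Infinity)) \<and>
     (\<forall>x y. Affine x y \<in> points E \<longrightarrow> ec_mult E 2 (Affine x y) \<noteq> Infinity \<longrightarrow>
        lam (ec_mult E 2 (Affine x y)) =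
          4 * lam (Affine x y) - ln (vabs v (2 * y + a1 E * x + a3 E)) + 1/4 * ln (vabs v (disc E)))"


section \<open>Division polynomials\<close>

text \<open>Polynomials in \<open>x\<close> and \<open>y\<close> are represented as polynomials in \<open>y\<close> over \<open>k[x]\<close>.
  In the last case the division by \<open>\<Psi>\<^sub>2\<close> is exact, see \<open>divpoly_even\<close> below.\<close>

definition Psi2 :: "'k::field weierstrass \<Rightarrow> 'k poly poly" where
  "Psi2 E = [:[:a3 E, a1 E:], [:2:]:]"

function divpoly :: "'k::field weierstrass \<Rightarrow> nat \<Rightarrow> 'k poly poly" where
  "divpoly E n =
     (if n = 0 then 0
      else if n = 1 then 1
      else if n = 2 then Psi2 E
      else if n = 3 then [:[:b8 E, 3 * b6 E, 3 * b4 E, b2 E, 3:]:]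
      else if n = 4 then
        Psi2 E * [:[:b4 E * b8 E - (b6 E)^2, b2 E * b8 E - b4 E * b6 E,
                     10 * b8 E, 10 * b6 E, 5 * b4 E, b2 E, 2:]:]
      else if odd n then
        (let m = n div 2 in
           divpoly E (m + 2) * divpoly E m ^ 3 - divpoly E (m - 1) * divpoly E (m + 1) ^ 3)
      else
        (let m = n div 2 in
           (divpoly E (m - 1) ^ 2 * divpoly E m * divpoly E (m + 2)
            - divpoly E (m - 2) * divpoly E m * divpoly E (m + 1) ^ 2) div Psi2 E))"
  by pat_completeness auto
termination
  by (relation "Wellfounded.measure snd") (auto elim!: oddE evenE)

declare divpoly.simps [simp del]

lemma divpoly_odd:
  assumes "m \<ge> 2"
  shows "divpoly E (2 * m + 1) =
    divpoly E (m + 2) * divpoly E m ^ 3 - divpoly E (m - 1) * divpoly E (m + 1) ^ 3"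
  using assms by (subst divpoly.simps) (simp add: Let_def)

lemma Psi2_dvd_even_aux:
  assumes IH: "\<And>k. k < 2 * m \<Longrightarrow> even k \<Longrightarrow> Psi2 E dvd divpoly E k" and m: "m \<ge> 3"
  shows "Psi2 E ^ 2 dvd divpoly E (m - 1) ^ 2 * divpoly E m * divpoly E (m + 2)
            - divpoly E (m - 2) * divpoly E m * divpoly E (m + 1) ^ 2"
proof (cases "even m")
  case True
  then have "Psi2 E dvd divpoly E m" "Psi2 E dvd divpoly E (m + 2)" "Psi2 E dvd divpoly E (m - 2)"
    using m by (auto intro!: IH)
  then have "Psi2 E * Psi2 E dvd divpoly E m * divpoly E (m + 2)"
    "Psi2 E * Psi2 E dvd divpoly E (m - 2) * divpoly E m"
    by (auto intro: mult_dvd_mono)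
  then have "Psi2 E ^ 2 dvd divpoly E (m - 1) ^ 2 * (divpoly E m * divpoly E (m + 2))"
    "Psi2 E ^ 2 dvd (divpoly E (m - 2) * divpoly E m) * divpoly E (m + 1) ^ 2"
    by (simp_all add: power2_eq_square[of "Psi2 E"] dvd_mult dvd_mult2)
  then show ?thesis
    unfolding mult.assoc[of "divpoly E (m - 1) ^ 2"] by (rule dvd_diff)
next
  case False
  then have "Psi2 E dvd divpoly E (m - 1)" "Psi2 E dvd divpoly E (m + 1)"
    using m by (auto intro!: IH)
  then have "Psi2 E ^ 2 dvd divpoly E (m - 1) ^ 2" "Psi2 E ^ 2 dvd divpoly E (m + 1) ^ 2"
    by (auto intro: dvd_power_same)
  then show ?thesis
    by (auto intro!: dvd_diff dvd_mult dvd_mult2)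
qed

lemma divpoly_even_unfold:
  assumes "m \<ge> 3"
  shows "divpoly E (2 * m) =
    (divpoly E (m - 1) ^ 2 * divpoly E m * divpoly E (m + 2)
      - divpoly E (m - 2) * divpoly E m * divpoly E (m + 1) ^ 2) div Psi2 E"
  using assms by (subst divpoly.simps) (simp add: Let_def)

lemma Psi2_neq_0: "Psi2 (E :: 'k::field_char_0 weierstrass) \<noteq> 0"
  by (simp add: Psi2_def)

lemma Psi2_dvd_divpoly:
  fixes E :: "'k::field_char_0 weierstrass"
  shows "even n \<Longrightarrow> Psi2 E dvd divpoly E n"
proof (induction n rule: less_induct)
  case (less n)
  then obtain m where n: "n = 2 * m" by (elim evenE)
  show ?case
  proof (cases "m \<ge> 3")
    case True
    obtain q where q: "divpoly E (m - 1) ^ 2 * divpoly E m * divpoly E (m + 2)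
        - divpoly E (m - 2) * divpoly E m * divpoly E (m + 1) ^ 2 = Psi2 E ^ 2 * q"
      using Psi2_dvd_even_aux[of m E] less.IH n True by (auto elim: dvdE)
    have "divpoly E n = Psi2 E * q"
      unfolding n divpoly_even_unfold[OF True] q
      by (simp add: power2_eq_square mult.assoc Psi2_neq_0)
    then show ?thesis by simp
  next
    case False
    then have "m = 0 \<or> m = 1 \<or> m = 2" by auto
    moreover have "divpoly E 0 = 0" "divpoly E 2 = Psi2 E"
      by (subst divpoly.simps, simp)+
    moreover have "Psi2 E dvd divpoly E 4"
      by (subst divpoly.simps) (simp del: mult_pCons_right)
    ultimately show ?thesis unfolding n by auto
  qed
qed

lemma divpoly_even:
  fixes E :: "'k::field_char_0 weierstrass"
  assumes "m \<ge> 3"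
  shows "divpoly E (2 * m) * Psi2 E =
    divpoly E (m - 1) ^ 2 * divpoly E m * divpoly E (m + 2)
      - divpoly E (m - 2) * divpoly E m * divpoly E (m + 1) ^ 2"
  unfolding divpoly_even_unfold[OF assms]
  using Psi2_dvd_even_aux[of m E] Psi2_dvd_divpoly assms
  by (metis dvd_div_mult_self dvd_mult_left power2_eq_square)

text \<open>The value \<open>\<Psi>\<^sub>n(P)\<close>; the value at infinity is a dummy.\<close>

fun eds :: "'k::field weierstrass \<Rightarrow> 'k point \<Rightarrow> nat \<Rightarrow> 'k" where
  "eds E (Affine x y) n = poly (poly (divpoly E n) [:y:]) x"
| "eds E Infinity n = 0"

end

theory Submission
  imports Defs
begin

text \<open>
  Write \<open>x\<^sub>n\<close> for the \<open>x\<close>-coordinate of \<open>[n]Q\<close> and \<open>W\<^sub>n = \<Psi>\<^sub>n(Q)\<close>, and suppose first that no \<open>W\<^sub>n\<close>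
  vanishes. The relation \<open>W\<^sub>m\<^sub>+\<^sub>n W\<^sub>m\<^sub>-\<^sub>n = W\<^sub>m\<^sup>2 W\<^sub>n\<^sup>2 (x\<^sub>n - x\<^sub>m)\<close> and the symmetric summation polynomial with
  roots \<open>x\<^sub>m\<^sub>+\<^sub>n, x\<^sub>m\<^sub>-\<^sub>n\<close> show that \<open>G(n) = 2 v(W\<^sub>n) + min(0, v(x\<^sub>n))\<close> satisfies
  \<open>G(m+n) + G(m-n) \<ge> 2 G(m) + 2 G(n)\<close> and \<open>4 G(n) \<le> G(2n) \<le> 4 G(n) + v(\<Delta>)\<close>. Replacing \<open>(m, n)\<close> by
  \<open>(m+n, m-n)\<close> turns the second statement into the converse of the first up to a constant, so that
  \<open>G(n) = 2 c n\<^sup>2 + O(1)\<close> with a constant depending on the curve only; the duplication formula for the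
  Neron height along \<open>n = 2\<^sup>k\<close> identifies \<open>c\<close> with \<open>- \<lambda>(Q) / log N + v(\<Delta>) / 12\<close>.

  Since the error is uniform in \<open>Q\<close>, continuity of \<open>\<lambda>\<close> and density of such \<open>Q\<close> (Hensel's lemma, and
  uncountability of \<open>v\<close>-adic discs) carry the estimate over to every \<open>P\<close>. What remains is
  \<open>- v(x\<^sub>n) = O(log n)\<close>: if \<open>1/x\<^sub>n\<close> is close to \<open>0\<close>, then \<open>1/x\<^sub>k\<^sub>n \<equiv> k\<^sup>2/x\<^sub>n\<close> modulo \<open>x\<^sub>n\<^sup>-\<^sup>2\<close>, so that
  the order of the pole of \<open>x\<close> at \<open>[kn]Q\<close> grows by \<open>2 v(k)\<close> only.
\<close>

section \<open>Valued fields\<close>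

text \<open>The bilinear relations are derived from the recursion itself, through a rational
  recurrence for the x-coordinates that divides by earlier terms. It breaks down once some
  \<open>W n\<close> vanishes, as happens at torsion points; so the algebra lives at points where no
  \<open>W n\<close> vanishes, and \<open>P\<close> is a limit of such points. For fixed n,
  \<open>v (W n)\<close> and the pole order of x_n are locally constant where \<open>W n\<close> is
  nonzero, and the height varies continuously, so an estimate survives the limit provided that its
  error does not depend on the point. This is the reason for working with G instead of
  \<open>v (W n)\<close>: G(n) is the smaller of the valuations of W_n^2 and W_n^2 x_n, a projective
  pair representing x_n, and its failure to be quadratic only measures cancellation in the addition
  formulas. Under doubling this is bounded by v(Delta), since Delta is an integral combination of
  the two polynomials in the duplication formula. The unspecified bound on the height correction
  serves to identify the leading coefficient along powers of two and then drops out.\<close>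

locale valued_field =
  fixes v :: "'a::field \<Rightarrow> int"
  assumes normalized: "normalized_valuation v"
begin

lemma v_mult: "x \<noteq> 0 \<Longrightarrow> y \<noteq> 0 \<Longrightarrow> v (x * y) = v x + v y"
  using normalized unfolding normalized_valuation_def by blast

lemma val_ge_add: "val_ge v M x \<Longrightarrow> val_ge v M y \<Longrightarrow> val_ge v M (x + y)"
  using normalized unfolding normalized_valuation_def by blast

lemma uniformizer: obtains \<pi> where "\<pi> \<noteq> 0" "v \<pi> = 1"
  using normalized unfolding normalized_valuation_def by blast

lemma v_one [simp]: "v 1 = 0"
  using v_mult[of 1 1] by simp

lemma v_minus [simp]: "v (- x) = v x"
proof (cases "x = 0")
  case False
  have "v (- 1) = 0" using v_mult[of "- 1" "- 1"] by simp
  then show ?thesis using v_mult[of "- 1" x] False by simp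
qed simp

lemma v_power: "x \<noteq> 0 \<Longrightarrow> v (x ^ n) = int n * v x"
  by (induction n) (auto simp: v_mult algebra_simps)

lemma v_inverse: "x \<noteq> 0 \<Longrightarrow> v (inverse x) = - v x"
  using v_mult[of x "inverse x"] by simp

lemma v_divide: "x \<noteq> 0 \<Longrightarrow> y \<noteq> 0 \<Longrightarrow> v (x / y) = v x - v y"
  by (simp add: divide_inverse v_mult v_inverse)

lemma val_ge_0 [simp]: "val_ge v M 0"
  by (simp add: val_ge_def)

lemma val_ge_v: "val_ge v (v x) x"
  by (simp add: val_ge_def)

lemma val_ge_mono: "val_ge v M x \<Longrightarrow> N \<le> M \<Longrightarrow> val_ge v N x"
  by (auto simp: val_ge_def)

lemma val_ge_minus [simp]: "val_ge v M (- x) \<longleftrightarrow> val_ge v M x"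
  by (simp add: val_ge_def)

lemma val_ge_diff: "val_ge v M x \<Longrightarrow> val_ge v M y \<Longrightarrow> val_ge v M (x - y)"
  using val_ge_add[of M x "- y"] by simp

lemma val_ge_diff_commute: "val_ge v M (x - y) \<longleftrightarrow> val_ge v M (y - x)"
  using val_ge_minus[of M "x - y"] by simp

lemma val_ge_diff_trans: "val_ge v M (x - y) \<Longrightarrow> val_ge v M (y - z) \<Longrightarrow> val_ge v M (x - z)"
  using val_ge_add[of M "x - y" "y - z"] by simp

lemma val_ge_mult: "val_ge v M x \<Longrightarrow> val_ge v N y \<Longrightarrow> val_ge v (M + N) (x * y)"
  by (cases "x = 0 \<or> y = 0") (auto simp: val_ge_def v_mult)

lemma val_ge_mult_left: "val_ge v 0 x \<Longrightarrow> val_ge v N y \<Longrightarrow> val_ge v N (x * y)"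
  using val_ge_mult[of 0 x N y] by simp

lemma val_ge_mult_right: "val_ge v N x \<Longrightarrow> val_ge v 0 y \<Longrightarrow> val_ge v N (x * y)"
  using val_ge_mult[of N x 0 y] by simp

lemma val_ge_one [simp]: "val_ge v 0 1"
  by (simp add: val_ge_def)

lemma val_ge_power: "val_ge v M x \<Longrightarrow> val_ge v (int n * M) (x ^ n)"
  by (induction n) (auto dest: val_ge_mult simp: algebra_simps)

lemma val_ge_power_0: "val_ge v 0 x \<Longrightarrow> val_ge v 0 (x ^ n)"
  using val_ge_power[of 0] by simp

lemma val_ge_of_nat [simp]: "val_ge v 0 (of_nat n)"
  by (induction n) (auto intro: val_ge_add)

lemma val_ge_of_int [simp]: "val_ge v 0 (of_int n)"
  by (cases n) (auto intro: val_ge_diff simp del: of_nat_Suc)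

lemma val_ge_numeral [simp]: "val_ge v 0 (numeral n)"
  using val_ge_of_nat[of "numeral n"] by simp

lemma val_ge_sum: "(\<And>i. i \<in> I \<Longrightarrow> val_ge v M (f i)) \<Longrightarrow> val_ge v M (\<Sum>i\<in>I. f i)"
  by (induction I rule: infinite_finite_induct) (auto intro: val_ge_add)

lemmas val_ge_ring = val_ge_add val_ge_diff val_ge_mult_left val_ge_power_0

lemma val_ge_divide: "x \<noteq> 0 \<Longrightarrow> val_ge v M y \<Longrightarrow> val_ge v (M - v x) (y / x)"
  by (cases "y = 0") (auto simp: val_ge_def v_divide)

lemma v_add_eq:
  assumes "x \<noteq> 0" "val_ge v M y" "v x < M"
  shows "x + y \<noteq> 0" "v (x + y) = v x"
proof -
  have "x + y \<noteq> 0 \<and> v (x + y) \<le> v x"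
  proof (rule ccontr)
    assume "\<not> ?thesis"
    then have "val_ge v (v x + 1) (x + y)" by (auto simp: val_ge_def)
    moreover have "val_ge v (v x + 1) y" using assms by (auto intro: val_ge_mono)
    ultimately have "val_ge v (v x + 1) (x + y - y)" by (rule val_ge_diff)
    then show False using assms by (simp add: val_ge_def)
  qed
  moreover have "val_ge v (v x) (x + y)"
    by (rule val_ge_add) (use assms in \<open>auto intro: val_ge_mono val_ge_v\<close>)
  ultimately show "x + y \<noteq> 0" "v (x + y) = v x" by (auto simp: val_ge_def)
qed

lemma v_eq_of_close:
  assumes "x \<noteq> 0" "val_ge v M (y - x)" "v x < M"
  shows "y \<noteq> 0" "v y = v x"
  using v_add_eq[OF assms] by simp_all

lemma eq_0_if_val_ge: "(\<And>M. val_ge v M x) \<Longrightarrow> x = 0"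
  using val_ge_def[of v "v x + 1" x] by force

section \<open>Convergence in the valuation topology\<close>

definition tends :: "(nat \<Rightarrow> 'a) \<Rightarrow> 'a \<Rightarrow> bool" where
  "tends s l \<longleftrightarrow> (\<forall>M. \<exists>k. \<forall>n\<ge>k. val_ge v M (s n - l))"

definition cauchy :: "(nat \<Rightarrow> 'a) \<Rightarrow> bool" where
  "cauchy s \<longleftrightarrow> (\<forall>M. \<exists>k. \<forall>m\<ge>k. \<forall>n\<ge>k. val_ge v M (s m - s n))"

lemma tends_unique:
  assumes "tends s l" "tends s l'"
  shows "l = l'"
proof -
  have "val_ge v M (l - l')" for M
  proof -
    obtain k k' where "\<forall>n\<ge>k. val_ge v M (s n - l)" "\<forall>n\<ge>k'. val_ge v M (s n - l')"
      using assms unfolding tends_def by blast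
    then have "val_ge v M (s (max k k') - l)" "val_ge v M (s (max k k') - l')" by auto
    then show ?thesis using val_ge_diff_trans val_ge_diff_commute by blast
  qed
  then show ?thesis using eq_0_if_val_ge[of "l - l'"] by simp
qed

lemma tends_val_ge:
  assumes "tends s l" "\<And>n. n \<ge> k \<Longrightarrow> val_ge v M (s n - x)"
  shows "val_ge v M (l - x)"
proof -
  obtain k' where "\<forall>n\<ge>k'. val_ge v M (s n - l)" using assms(1) unfolding tends_def by blast
  then have "val_ge v M (s (max k k') - l)" "val_ge v M (s (max k k') - x)" using assms(2) by auto
  then show ?thesis using val_ge_diff_trans val_ge_diff_commute by blast
qed

lemma tends_const: "tends (\<lambda>n. c) c"
  by (simp add: tends_def)

lemma tends_add:
  assumes "tends s l" "tends s' l'"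
  shows "tends (\<lambda>n. s n + s' n) (l + l')"
  unfolding tends_def
proof
  fix M
  obtain k k' where "\<forall>n\<ge>k. val_ge v M (s n - l)" "\<forall>n\<ge>k'. val_ge v M (s' n - l')"
    using assms unfolding tends_def by blast
  then have "val_ge v M (s n + s' n - (l + l'))" if "n \<ge> max k k'" for n
    using val_ge_add[of M "s n - l" "s' n - l'"] that by (simp add: algebra_simps)
  then show "\<exists>k. \<forall>n\<ge>k. val_ge v M (s n + s' n - (l + l'))" by blast
qed

lemma tends_mult_const:
  assumes "tends s l"
  shows "tends (\<lambda>n. s n * c) (l * c)"
  unfolding tends_def
proof
  fix M
  obtain k where "\<forall>n\<ge>k. val_ge v (M - v c) (s n - l)" using assms unfolding tends_def by blast
  then have "val_ge v M (s n * c - l * c)" if "n \<ge> k" for n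
    using val_ge_mult[of "M - v c" "s n - l" "v c" c] that val_ge_v by (simp add: algebra_simps)
  then show "\<exists>k. \<forall>n\<ge>k. val_ge v M (s n * c - l * c)" by blast
qed

lemma tends_sum:
  "(\<And>i. i \<in> I \<Longrightarrow> tends (s i) (l i)) \<Longrightarrow> tends (\<lambda>n. \<Sum>i\<in>I. s i n) (\<Sum>i\<in>I. l i)"
  by (induction I rule: infinite_finite_induct) (auto intro: tends_const tends_add)

lemma val_ge_telescope:
  assumes "\<And>n. val_ge v (C + int n) (s (Suc n) - s n)" "m \<ge> n"
  shows "val_ge v (C + int n) (s m - s n)"
  using assms(2)
proof (induction m rule: dec_induct)
  case (step m)
  have "val_ge v (C + int n) (s (Suc m) - s m)"
    using assms(1)[of m] by (rule val_ge_mono) (use step in simp)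
  then show ?case using step val_ge_diff_trans by blast
qed simp

lemma cauchy_if_step:
  assumes "\<And>n. val_ge v (C + int n) (s (Suc n) - s n)"
  shows "cauchy s"
  unfolding cauchy_def
proof
  fix M
  have "val_ge v M (s m - s n)" if "m \<ge> nat (M - C)" "n \<ge> nat (M - C)" for m n
  proof -
    have "val_ge v M (s i - s (nat (M - C)))" if "i \<ge> nat (M - C)" for i
      using val_ge_telescope[of C s, OF assms that] by (rule val_ge_mono) simp
    then show ?thesis using that val_ge_diff_trans val_ge_diff_commute by blast
  qed
  then show "\<exists>k. \<forall>m\<ge>k. \<forall>n\<ge>k. val_ge v M (s m - s n)" by blast
qed

lemma tends_iff_eventually: "tends s l \<longleftrightarrow> (\<forall>M. eventually (\<lambda>n. val_ge v M (s n - l)) sequentially)"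
  by (simp add: tends_def eventually_sequentially)

lemma tends_shift: "tends s l \<Longrightarrow> tends (\<lambda>n. s (Suc n)) l"
  unfolding tends_def by (meson le_SucI)

lemma tends_integral:
  assumes "tends s l"
  obtains M where "eventually (\<lambda>n. val_ge v M (s n)) sequentially" "val_ge v M l"
proof
  have "eventually (\<lambda>n. val_ge v (v l) (s n - l)) sequentially"
    using assms by (simp add: tends_iff_eventually)
  then show "eventually (\<lambda>n. val_ge v (v l) (s n)) sequentially"
  proof eventually_elim
    case (elim n)
    then show ?case using val_ge_add[OF elim val_ge_v] by simp
  qed
qed (rule val_ge_v)

lemma tends_diff:
  assumes "tends s l" "tends s' l'"
  shows "tends (\<lambda>n. s n - s' n) (l - l')"
proof -
  have "tends (\<lambda>n. s' n * (- 1)) (l' * (- 1))" using assms(2) by (rule tends_mult_const)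
  then show ?thesis using tends_add[OF assms(1), of "\<lambda>n. s' n * (- 1)" "l' * (- 1)"] by simp
qed

lemma tends_mult:
  assumes "tends s l" "tends s' l'"
  shows "tends (\<lambda>n. s n * s' n) (l * l')"
  unfolding tends_iff_eventually
proof
  fix M
  obtain B where B: "eventually (\<lambda>n. val_ge v B (s n)) sequentially"
    using tends_integral[OF assms(1)] by blast
  have "eventually (\<lambda>n. val_ge v (M - B) (s' n - l')) sequentially"
    "eventually (\<lambda>n. val_ge v M (s n * l' - l * l')) sequentially"
    using assms tends_mult_const[OF assms(1), of l'] by (simp_all add: tends_iff_eventually)
  with B show "eventually (\<lambda>n. val_ge v M (s n * s' n - l * l')) sequentially"
  proof eventually_elim
    case (elim n)
    have "val_ge v (B + (M - B)) (s n * (s' n - l'))" using elim by (intro val_ge_mult)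
    then have "val_ge v M (s n * (s' n - l') + (s n * l' - l * l'))"
      using elim by (intro val_ge_add) simp_all
    then show ?case by (simp add: algebra_simps)
  qed
qed

lemma tends_power: "tends s l \<Longrightarrow> tends (\<lambda>n. s n ^ k) (l ^ k)"
  by (induction k) (auto intro: tends_const tends_mult)

lemma tends_eventually_v:
  assumes "tends s l" "l \<noteq> 0"
  shows "eventually (\<lambda>n. s n \<noteq> 0 \<and> v (s n) = v l) sequentially"
proof -
  have "eventually (\<lambda>n. val_ge v (v l + 1) (s n - l)) sequentially"
    using assms(1) by (simp add: tends_iff_eventually)
  then show ?thesis
  proof eventually_elim
    case (elim n)
    then show ?case using v_eq_of_close[OF assms(2) elim] by simp
  qed
qed

lemma tends_inverse:
  assumes "tends s l" "l \<noteq> 0"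
  shows "tends (\<lambda>n. inverse (s n)) (inverse l)"
  unfolding tends_iff_eventually
proof
  fix M
  have "eventually (\<lambda>n. val_ge v (M + 2 * v l) (s n - l)) sequentially"
    using assms(1) by (simp add: tends_iff_eventually)
  with tends_eventually_v[OF assms]
  show "eventually (\<lambda>n. val_ge v M (inverse (s n) - inverse l)) sequentially"
  proof eventually_elim
    case (elim n)
    have "val_ge v (M + 2 * v l - v (s n * l)) ((l - s n) / (s n * l))"
      using elim assms(2) by (intro val_ge_divide) (simp_all add: val_ge_diff_commute)
    moreover have "(l - s n) / (s n * l) = inverse (s n) - inverse l"
      using elim assms(2) by (simp add: field_simps)
    ultimately show ?case using elim assms(2) by (simp add: v_mult)
  qed
qed

lemma tends_poly: "tends s l \<Longrightarrow> tends (\<lambda>n. poly p (s n)) (poly p l)"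
  by (induction p) (auto intro: tends_const tends_add tends_mult)

lemma tends_poly_poly:
  "tends s l \<Longrightarrow> tends s' l' \<Longrightarrow> tends (\<lambda>n. poly (poly p [:s' n:]) (s n)) (poly (poly p [:l':]) l)"
  by (induction p) (auto intro: tends_const tends_add tends_mult tends_poly)

lemma vabs_nonzero: "x \<noteq> 0 \<Longrightarrow> vabs v x = real (residue_card v) powr (- real_of_int (v x))"
  by (simp add: vabs_def)

text \<open>\<open>card\<close> is 0 on infinite sets, so log N is a meaningful positive number only
  after finiteness is known. Mapping each class to a nearby element of \<open>R\<close> gives
  finiteness; the classes of 0 and 1 give the lower bound 2. The elements of \<open>R\<close> need
  not be integral.\<close>

lemma finite_residue_field:
  assumes "finite R" "\<And>x. val_ge v 0 x \<Longrightarrow> \<exists>r\<in>R. val_ge v 1 (x - r)"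
  shows "finite (residue_field v)" and "residue_card v \<ge> 2"
proof -
  define rel where "rel = {(x, y) \<in> valuation_ring v \<times> valuation_ring v. x - y \<in> maximal_ideal v}"
  have "equiv (valuation_ring v) rel"
  proof (rule equivI)
    show "refl_on (valuation_ring v) rel"
      unfolding rel_def maximal_ideal_def by (auto intro!: refl_onI)
    show "sym rel" unfolding rel_def maximal_ideal_def sym_def using val_ge_diff_commute by auto
    show "trans rel" unfolding rel_def maximal_ideal_def trans_def using val_ge_diff_trans by blast
    show "rel \<subseteq> valuation_ring v \<times> valuation_ring v" unfolding rel_def by auto
  qed
  note eq = this
  have res: "residue_field v = valuation_ring v // rel"
    by (simp add: residue_field_def rel_def)
  have "residue_field v \<subseteq> (\<lambda>r. {x \<in> valuation_ring v. val_ge v 1 (x - r)}) ` R"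
  proof
    fix c assume "c \<in> residue_field v"
    then obtain y where y: "y \<in> valuation_ring v" "c = rel `` {y}"
      unfolding res by (auto elim: quotientE)
    obtain r where r: "r \<in> R" "val_ge v 1 (y - r)"
      using assms(2) y by (auto simp: valuation_ring_def)
    have "c = {x \<in> valuation_ring v. val_ge v 1 (x - r)}"
      proof -
      have "val_ge v 1 (y - x) \<longleftrightarrow> val_ge v 1 (x - r)" for x
        using r(2) val_ge_diff_trans[of 1 x y r] val_ge_diff_trans[of 1 y r x]
          val_ge_diff_commute[of 1 y x] val_ge_diff_commute[of 1 x r] by blast
      then show ?thesis using y by (auto simp: rel_def maximal_ideal_def)
    qed
    then show "c \<in> (\<lambda>r. {x \<in> valuation_ring v. val_ge v 1 (x - r)}) ` R" using r by blast
  qed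
  then show fin: "finite (residue_field v)"
    using assms(1) finite_surj by blast
  have 01: "0 \<in> valuation_ring v" "1 \<in> valuation_ring v" by (simp_all add: valuation_ring_def)
  then have "{rel `` {0}, rel `` {1}} \<subseteq> residue_field v"
    unfolding res by (auto intro: quotientI)
  then have "card {rel `` {0}, rel `` {1}} \<le> residue_card v"
    unfolding residue_card_def using fin by (rule card_mono[rotated])
  moreover have "(0, 1) \<notin> rel" by (simp add: rel_def maximal_ideal_def val_ge_def)
  then have "rel `` {0} \<noteq> rel `` {1}"
    using eq 01 eq_equiv_class by metis
  ultimately show "residue_card v \<ge> 2" by simp
qed

end

locale complete_valued_field = valued_field +
  assumes complete: "cauchy s \<Longrightarrow> \<exists>l. tends s l"
begin

text \<open>The root is the fixed point of \<open>T\<close>, the equation solved for its linear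
  term. On the ball where z has valuation at least \<open>M - v c\<close>, which exceeds
  \<open>v c\<close>, each application of \<open>T\<close> gains at least one unit of valuation.
  Allowing \<open>a = 0\<close> covers both uses: a quadratic in y and a cubic in x.\<close>

lemma hensel_cubic:
  assumes int: "val_ge v 0 a" "val_ge v 0 b" and c: "c \<noteq> 0"
    and d: "val_ge v M d" "M > 2 * v c" "v c \<ge> 0"
  obtains z where "a * z^3 + b * z^2 + c * z + d = 0" "val_ge v (M - v c) z"
proof -
  define \<rho> where "\<rho> = M - v c"
  have \<rho>: "\<rho> > v c" "\<rho> > 0" using d by (auto simp: \<rho>_def)
  define T where "T z = - (d + b * z^2 + a * z^3) / c" for z
  have T: "val_ge v \<rho> (T z)" if z: "val_ge v \<rho> z" for z
  proof -
    have "val_ge v M (z^2)" "val_ge v M (z^3)"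
      using val_ge_power[OF z, of 2] val_ge_power[OF z, of 3] \<rho> d
      by (auto intro: val_ge_mono simp: \<rho>_def)
    then have "val_ge v M (- (d + b * z^2 + a * z^3))"
      using int d unfolding val_ge_minus by (intro val_ge_add val_ge_mult_left)
    then show ?thesis unfolding T_def \<rho>_def using c by (rule val_ge_divide[rotated])
  qed
  have contr: "val_ge v (k + 1) (T z - T z')"
    if z: "val_ge v \<rho> z" "val_ge v \<rho> z'" "val_ge v k (z - z')" for z z' k
  proof -
    have int': "val_ge v 0 z" "val_ge v 0 z'" using z \<rho> by (auto intro: val_ge_mono)
    have "val_ge v \<rho> (b * (z + z') + a * (z * z + z * z' + z' * z'))"
      using int int' z by (intro val_ge_add val_ge_mult_left)
    then have "val_ge v (k + \<rho>) ((z - z') * (b * (z + z') + a * (z * z + z * z' + z' * z')))"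
      using z(3) by (intro val_ge_mult)
    then have "val_ge v (k + \<rho> - v c) (- ((z - z') * (b * (z + z') + a * (z * z + z * z' + z' * z'))) / c)"
      using c by (intro val_ge_divide) simp_all
    moreover have "T z - T z' = - ((z - z') * (b * (z + z') + a * (z * z + z * z' + z' * z'))) / c"
      unfolding T_def diff_divide_distrib[symmetric] by (simp add: power2_eq_square power3_eq_cube algebra_simps)
    ultimately show ?thesis using \<rho> by (auto intro: val_ge_mono)
  qed
  define s where "s n = (T ^^ n) 0" for n
  have s_Suc: "s (Suc n) = T (s n)" for n by (simp add: s_def)
  have s: "val_ge v \<rho> (s n)" for n by (induction n) (auto simp: s_def T)
  have step: "val_ge v (\<rho> + int n) (s (Suc n) - s n)" for n
  proof (induction n)
    case 0
    then show ?case using s[of 1] by (simp add: s_def)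
  next
    case (Suc n)
    then show ?case using contr[OF s s Suc] by (simp add: s_Suc algebra_simps)
  qed
  obtain l where l: "tends s l" using complete cauchy_if_step[of \<rho> s, OF step] by blast
  have l\<rho>: "val_ge v \<rho> l" using tends_val_ge[OF l, of 0 \<rho> 0] s by simp
  have "tends (\<lambda>n. T (s n)) (T l)"
    unfolding tends_iff_eventually
  proof
    fix M
    have "eventually (\<lambda>n. val_ge v M (s n - l)) sequentially" using l by (simp add: tends_iff_eventually)
    then show "eventually (\<lambda>n. val_ge v M (T (s n) - T l)) sequentially"
    proof eventually_elim
      case (elim n)
      show ?case using contr[OF s l\<rho> elim] by (rule val_ge_mono) simp
    qed
  qed
  moreover have "tends (\<lambda>n. T (s n)) l" using tends_shift[OF l] by (simp add: s_Suc)
  ultimately have "T l = l" by (rule tends_unique)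
  then have "- (d + b * l^2 + a * l^3) = l * c" using c by (simp add: T_def field_simps)
  then have "a * l^3 + b * l^2 + c * l + d = 0" by algebra
  then show thesis using that l\<rho> by (simp add: \<rho>_def)
qed

text \<open>Cantor's diagonal argument: step n moves the approximation by \<pi>^(k + n) exactly when
  it is too close to the n-th element of \<open>S\<close>, and all later moves are too small to undo
  this.\<close>

lemma avoid_countable:
  assumes "countable S"
  obtains b where "b \<notin> S" "val_ge v M (b - a)"
proof (cases "S = {}")
  case True
  then show thesis using that[of a] by simp
next
  case False
  define r where "r = from_nat_into S"
  have S: "S = range r" using False assms by (simp add: r_def range_from_nat_into)
  obtain \<pi> where \<pi>: "\<pi> \<noteq> 0" "v \<pi> = 1" by (rule uniformizer)
  define k where "k = nat M"
  define s where "s = rec_nat a (\<lambda>n t. if val_ge v (int (k + n) + 1) (t - r n) then t + \<pi> ^ (k + n) else t)"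
  have s0: "s 0 = a" by (simp add: s_def)
  have s_Suc: "s (Suc n) = (if val_ge v (int (k + n) + 1) (s n - r n) then s n + \<pi> ^ (k + n) else s n)" for n
    by (simp add: s_def)
  have step: "val_ge v (int k + int n) (s (Suc n) - s n)" for n
    using val_ge_power[of 1 \<pi> "k + n"] val_ge_v[of \<pi>] \<pi> by (simp add: s_Suc)
  have avoid: "\<not> val_ge v (int (k + n) + 1) (s (Suc n) - r n)" for n
  proof (cases "val_ge v (int (k + n) + 1) (s n - r n)")
    case True
    show ?thesis
    proof
      assume "val_ge v (int (k + n) + 1) (s (Suc n) - r n)"
      then have "val_ge v (int (k + n) + 1) (s (Suc n) - r n - (s n - r n))" using True by (rule val_ge_diff)
      then have "val_ge v (int (k + n) + 1) (\<pi> ^ (k + n))" using True by (simp add: s_Suc)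
      then show False using \<pi> by (simp add: val_ge_def v_power)
    qed
  qed (simp add: s_Suc)
  obtain l where l: "tends s l" using complete cauchy_if_step[of "int k" s, OF step] by blast
  have close: "val_ge v (int k + int n) (l - s n)" for n
    using tends_val_ge[OF l] val_ge_telescope[of "int k" s, OF step] by blast
  have "l \<noteq> r n" for n
  proof
    assume "l = r n"
    then have "val_ge v (int k + int (Suc n)) (s (Suc n) - r n)"
      using close[of "Suc n"] val_ge_diff_commute by metis
    then show False using avoid[of n] by (simp add: algebra_simps)
  qed
  then have "l \<notin> S" by (auto simp: S)
  moreover have "val_ge v M (l - a)" using close[of 0] s0 by (auto intro: val_ge_mono simp: k_def)
  ultimately show thesis by (rule that)
qed

end

section \<open>Finite extensions of the p-adic numbers\<close>

locale padic_extension = valued_field v + base: valued_field w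
  for v :: "'k::field_char_0 \<Rightarrow> int" and w :: "'q::field_char_0 \<Rightarrow> int" +
  fixes p :: nat and \<iota> :: "'q \<Rightarrow> 'k" and e :: int and B :: "'k set"
  assumes p: "prime p" and Qp: "is_Qp p w"
    and fin_ext: "finite_dimensional_vector_space (\<lambda>c x. \<iota> c * x) B"
    and e: "e > 0" and v_iota: "c \<noteq> 0 \<Longrightarrow> v (\<iota> c) = e * w c"
begin

sublocale vs: finite_dimensional_vector_space "\<lambda>c x. \<iota> c * x" B
  by (rule fin_ext)

lemma iota_add: "\<iota> (a + b) = \<iota> a + \<iota> b"
  using vs.scale_left_distrib[of a b 1] by simp

lemma iota_0 [simp]: "\<iota> 0 = 0"
  using iota_add[of 0 0] by simp

lemma iota_1 [simp]: "\<iota> 1 = 1"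
  using vs.scale_one[of 1] by simp

lemma iota_mult: "\<iota> (a * b) = \<iota> a * \<iota> b"
  using vs.scale_scale[of a b 1] by simp

lemma iota_minus: "\<iota> (- a) = - \<iota> a"
  using iota_add[of a "- a"] by (simp add: eq_neg_iff_add_eq_0 add.commute)

lemma iota_diff: "\<iota> (a - b) = \<iota> a - \<iota> b"
  using iota_add[of a "- b"] by (simp add: iota_minus)

lemma iota_eq_0 [simp]: "\<iota> a = 0 \<longleftrightarrow> a = 0"
  using iota_mult[of a "inverse a"] by (cases "a = 0") auto

lemma iota_of_nat: "\<iota> (of_nat n) = of_nat n"
  by (induction n) (auto simp: iota_add)

lemma val_ge_iota: "val_ge v (e * N) (\<iota> c) \<longleftrightarrow> val_ge w N c"
  using e by (cases "c = 0") (auto simp: val_ge_def v_iota)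

lemma e_mult_ge: "N \<ge> 0 \<Longrightarrow> N \<le> e * N"
  using e by (simp add: mult_le_cancel_right1)

lemma iota_complete:
  assumes "cauchy (\<lambda>n. \<iota> (a n))"
  shows "\<exists>l. tends (\<lambda>n. \<iota> (a n)) (\<iota> l)"
proof -
  have "base.cauchy a"
    unfolding base.cauchy_def
  proof
    fix N
    obtain k where "\<forall>m\<ge>k. \<forall>n\<ge>k. val_ge v (e * N) (\<iota> (a m - a n))"
      using assms unfolding cauchy_def iota_diff by blast
    then show "\<exists>k. \<forall>m\<ge>k. \<forall>n\<ge>k. val_ge w N (a m - a n)" by (auto simp: val_ge_iota)
  qed
  then obtain l where l: "\<forall>M. \<exists>k. \<forall>n\<ge>k. val_ge w M (a n - l)"
    using Qp unfolding is_Qp_def base.cauchy_def by blast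
  have "tends (\<lambda>n. \<iota> (a n)) (\<iota> l)"
    unfolding tends_def iota_diff[symmetric]
  proof
    fix M
    obtain k where "\<forall>n\<ge>k. val_ge w \<bar>M\<bar> (a n - l)" using l by blast
    then have "\<forall>n\<ge>k. val_ge v (e * \<bar>M\<bar>) (\<iota> (a n - l))" by (simp add: val_ge_iota)
    moreover have "M \<le> e * \<bar>M\<bar>" using e_mult_ge[of "\<bar>M\<bar>"] by simp
    ultimately show "\<exists>k. \<forall>n\<ge>k. val_ge v M (\<iota> (a n - l))" using val_ge_mono by blast
  qed
  then show ?thesis ..
qed

text \<open>Equivalence of norms on a finite-dimensional space, by induction on the independent set.
  If \<open>b\<close> could be approximated arbitrarily well from the span of \<open>S\<close>, the
  induction hypothesis would make the coefficients Cauchy, and their limits would give a linear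
  dependence. So b + span S stays away from 0, and dividing by the coefficient of \<open>b\<close>
  bounds that coefficient.\<close>

lemma coefficient_bound:
  assumes "finite S" "vs.independent S"
  shows "\<exists>C. \<forall>a M. val_ge v M (\<Sum>b\<in>S. \<iota> (a b) * b) \<longrightarrow> (\<forall>b\<in>S. val_ge v (M - C) (\<iota> (a b)))"
  using assms
proof (induction S rule: finite_induct)
  case (insert b S)
  have ind: "vs.independent S" using insert.prems vs.independent_mono by blast
  obtain C where C: "\<And>a M c. val_ge v M (\<Sum>b\<in>S. \<iota> (a b) * b) \<Longrightarrow> c \<in> S \<Longrightarrow> val_ge v (M - C) (\<iota> (a c))"
    using insert.IH[OF ind] by blast
  have "\<exists>K. \<forall>a. \<not> val_ge v K (b + (\<Sum>c\<in>S. \<iota> (a c) * c))"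
  proof (rule ccontr)
    assume "\<not> ?thesis"
    then have "\<forall>n. \<exists>a. val_ge v (int n) (b + (\<Sum>c\<in>S. \<iota> (a c) * c))" by blast
    then obtain A where A: "\<And>n. val_ge v (int n) (b + (\<Sum>c\<in>S. \<iota> (A n c) * c))" by metis
    define s where "s n = (\<Sum>c\<in>S. \<iota> (A n c) * c)" for n
    have "\<exists>l. tends (\<lambda>n. \<iota> (A n c)) (\<iota> l)" if "c \<in> S" for c
    proof (rule iota_complete, unfold cauchy_def, intro allI)
      fix M
      have "val_ge v M (\<iota> (A m c) - \<iota> (A n c))" if mn: "m \<ge> nat (M + C)" "n \<ge> nat (M + C)" for m n
      proof -
        have "val_ge v (M + C) (b + s m)" "val_ge v (M + C) (b + s n)"
          using A[of m] A[of n] mn by (auto simp: s_def intro: val_ge_mono)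
        then have "val_ge v (M + C) (s m - s n)"
          using val_ge_diff[of "M + C" "b + s m" "b + s n"] by simp
        moreover have "s m - s n = (\<Sum>c\<in>S. \<iota> (A m c - A n c) * c)"
          by (simp add: s_def sum_subtractf iota_diff algebra_simps)
        ultimately have "val_ge v (M + C - C) (\<iota> (A m c - A n c))"
          using C[of "M + C" "\<lambda>c. A m c - A n c"] \<open>c \<in> S\<close> by simp
        then show ?thesis by (simp add: iota_diff)
      qed
      then show "\<exists>k. \<forall>m\<ge>k. \<forall>n\<ge>k. val_ge v M (\<iota> (A m c) - \<iota> (A n c))" by blast
    qed
    then obtain l where l: "\<And>c. c \<in> S \<Longrightarrow> tends (\<lambda>n. \<iota> (A n c)) (\<iota> (l c))" by metis
    then have "tends s (\<Sum>c\<in>S. \<iota> (l c) * c)"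
      unfolding s_def by (intro tends_sum tends_mult_const)
    moreover have "tends s (- b)"
      unfolding tends_def
    proof
      fix M
      have "val_ge v M (s n - - b)" if "n \<ge> nat M" for n
        using A[of n] that by (auto simp: s_def add.commute intro: val_ge_mono)
      then show "\<exists>k. \<forall>n\<ge>k. val_ge v M (s n - - b)" by blast
    qed
    ultimately have eq: "(\<Sum>c\<in>S. \<iota> (l c) * c) = - b" by (rule tends_unique)
    have "(\<Sum>c\<in>insert b S. \<iota> ((l(b := 1)) c) * c) = b + (\<Sum>c\<in>S. \<iota> ((l(b := 1)) c) * c)"
      using insert.hyps by simp
    also have "(\<Sum>c\<in>S. \<iota> ((l(b := 1)) c) * c) = (\<Sum>c\<in>S. \<iota> (l c) * c)"
      using insert.hyps by (intro sum.cong) auto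
    finally have "(\<Sum>c\<in>insert b S. \<iota> ((l(b := 1)) c) * c) = 0" using eq by simp
    moreover have "(l(b := 1)) b \<noteq> 0" by simp
    ultimately have "vs.dependent (insert b S)"
      using vs.dependent_finite[of "insert b S"] insert.hyps by blast
    then show False using insert.prems by blast
  qed
  then obtain K where K: "\<And>a. \<not> val_ge v K (b + (\<Sum>c\<in>S. \<iota> (a c) * c))" by blast
  have b: "b \<noteq> 0" using insert.prems vs.dependent_zero by blast
  \<comment> \<open>\<open>K\<close> is the loss for the coefficient of \<open>b\<close>. For the
    others the term with \<open>b\<close> is subtracted first, which leaves valuation at least min M
    (M - K + v b), and the induction hypothesis then loses a further \<open>C\<close>.\<close>
  define C' where "C' = max K (max C (C + K - v b))"
  have "val_ge v (M - C') (\<iota> (a c))"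
    if a: "val_ge v M (\<Sum>c\<in>insert b S. \<iota> (a c) * c)" and c: "c \<in> insert b S" for a M c
  proof -
    define s where "s = (\<Sum>c\<in>S. \<iota> (a c) * c)"
    have sum: "val_ge v M (\<iota> (a b) * b + s)" using a insert.hyps by (simp add: s_def)
    have ab: "val_ge v (M - K) (\<iota> (a b))"
    proof (cases "a b = 0")
      case False
      define t where "t = (\<Sum>c\<in>S. \<iota> (a c / a b) * c)"
      have "\<iota> (a b) * t = s"
        using False by (simp add: t_def s_def sum_distrib_left mult.assoc[symmetric] iota_mult[symmetric])
      then have "\<iota> (a b) * b + s = \<iota> (a b) * (b + t)" by (simp add: algebra_simps)
      moreover have "b + t \<noteq> 0" "v (b + t) < K" using K[of "\<lambda>c. a c / a b"]
        by (auto simp: t_def val_ge_def)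
      ultimately show ?thesis using sum False by (auto simp: val_ge_def v_mult)
    qed simp
    show ?thesis
    proof (cases "c = b")
      case True
      then show ?thesis using ab by (auto intro: val_ge_mono simp: C'_def)
    next
      case False
      have "val_ge v (M - K + v b) (\<iota> (a b) * b)" using ab val_ge_v by (rule val_ge_mult)
      then have "val_ge v (min M (M - K + v b)) (\<iota> (a b) * b + s - \<iota> (a b) * b)"
        using sum by (intro val_ge_diff) (auto intro: val_ge_mono)
      then have "val_ge v (min M (M - K + v b) - C) (\<iota> (a c))"
        using C[of _ a c] c False by (simp add: s_def)
      then show ?thesis by (rule val_ge_mono) (auto simp: C'_def)
    qed
  qed
  then show ?case by blast
qed simp

lemma B_span: "\<exists>a. x = (\<Sum>b\<in>B. \<iota> (a b) * b)"
proof -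
  have "x \<in> range (\<lambda>a. \<Sum>b\<in>B. \<iota> (a b) * b)"
    unfolding vs.span_finite[OF vs.finite_Basis, symmetric] vs.span_Basis by simp
  then show ?thesis by (rule rangeE) blast
qed

lemma B_bound:
  obtains C where "\<And>a M b. val_ge v M (\<Sum>b\<in>B. \<iota> (a b) * b) \<Longrightarrow> b \<in> B \<Longrightarrow> val_ge v (M - C) (\<iota> (a b))"
  using coefficient_bound[OF vs.finite_Basis vs.independent_Basis] by blast

theorem cauchy_converges:
  assumes "cauchy s"
  shows "\<exists>l. tends s l"
proof -
  obtain C where C: "\<And>a M b. val_ge v M (\<Sum>b\<in>B. \<iota> (a b) * b) \<Longrightarrow> b \<in> B \<Longrightarrow> val_ge v (M - C) (\<iota> (a b))"
    using B_bound by blast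
  have "\<forall>n. \<exists>a. s n = (\<Sum>b\<in>B. \<iota> (a b) * b)" using B_span by blast
  from choice[OF this] obtain a where a: "\<And>n. s n = (\<Sum>b\<in>B. \<iota> (a n b) * b)" by blast
  have "\<exists>l. tends (\<lambda>n. \<iota> (a n b)) (\<iota> l)" if "b \<in> B" for b
  proof (rule iota_complete, unfold cauchy_def, intro allI)
    fix M
    obtain k where k: "\<forall>m\<ge>k. \<forall>n\<ge>k. val_ge v (M + C) (s m - s n)"
      using assms unfolding cauchy_def by blast
    have "val_ge v M (\<iota> (a m b) - \<iota> (a n b))" if "m \<ge> k" "n \<ge> k" for m n
    proof -
      have "s m - s n = (\<Sum>b\<in>B. \<iota> (a m b - a n b) * b)"
        by (simp add: a sum_subtractf iota_diff algebra_simps)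
      moreover have "val_ge v (M + C) (s m - s n)" using k that by blast
      ultimately have "val_ge v (M + C) (\<Sum>b\<in>B. \<iota> (a m b - a n b) * b)" by simp
      then have "val_ge v (M + C - C) (\<iota> (a m b - a n b))"
        using C[of "M + C" "\<lambda>b. a m b - a n b"] \<open>b \<in> B\<close> by simp
      then show ?thesis by (simp add: iota_diff)
    qed
    then show "\<exists>k. \<forall>m\<ge>k. \<forall>n\<ge>k. val_ge v M (\<iota> (a m b) - \<iota> (a n b))" by blast
  qed
  then obtain l where "\<And>b. b \<in> B \<Longrightarrow> tends (\<lambda>n. \<iota> (a n b)) (\<iota> (l b))" by metis
  then have "tends s (\<Sum>b\<in>B. \<iota> (l b) * b)"
    unfolding a[abs_def] by (intro tends_sum tends_mult_const)
  then show ?thesis ..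
qed

lemma w_of_nat: "n > 0 \<Longrightarrow> w (of_nat n) = int (multiplicity p n)"
proof -
  assume n: "n > 0"
  have "w (of_rat (of_nat n)) = padic_val_rat p (of_nat n)"
  proof -
    have "\<forall>r. r \<noteq> 0 \<longrightarrow> w (of_rat r) = padic_val_rat p r" using Qp unfolding is_Qp_def by blast
    then show ?thesis using n by (metis of_nat_eq_0_iff less_irrefl)
  qed
  also have "padic_val_rat p (of_nat n) = int (multiplicity (int p) (int n))"
  proof -
    have "quotient_of (rat_of_nat n) = (int n, 1)"
      using quotient_of_int[of "int n"] by simp
    then show ?thesis by (simp add: padic_val_rat_def)
  qed
  also have "multiplicity (int p) (int n) = multiplicity p n"
  proof (rule multiplicity_eqI)
    show "int p ^ multiplicity p n dvd int n"
      using multiplicity_dvd[of p n] by (metis int_dvd_int_iff of_nat_power)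
    have "\<not> p ^ Suc (multiplicity p n) dvd n"
      using p n by (subst power_dvd_iff_le_multiplicity) auto
    then show "\<not> int p ^ Suc (multiplicity p n) dvd int n"
      by (metis int_dvd_int_iff of_nat_power)
  qed
  finally show ?thesis by simp
qed

lemma v_of_nat: "n > 0 \<Longrightarrow> v (of_nat n) = e * int (multiplicity p n)"
  using v_iota[of "of_nat n"] w_of_nat[of n] by (simp add: iota_of_nat)

text \<open>A rational close to an integral element has denominator prime to p, and Bezout's
  identity inverts this denominator modulo p^n; \<open>u\<close> is the inverse and \<open>j\<close>
  the reduced product with the numerator.\<close>

lemma w_approx:
  assumes "val_ge w 0 a"
  shows "\<exists>j < p ^ n. val_ge w (int n) (a - of_nat j)"
proof -
  obtain r where r: "val_ge w (int n) (a - of_rat r)" using Qp unfolding is_Qp_def by blast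
  then have "val_ge w 0 (a - of_rat r)" by (rule base.val_ge_mono) simp
  then have r0: "val_ge w 0 (of_rat r)" using base.val_ge_diff[OF assms] by fastforce
  obtain x y where xy: "quotient_of r = (x, y)" by (cases "quotient_of r")
  have y: "y > 0" and cop: "coprime x y" and rxy: "r = of_int x / of_int y"
    using xy quotient_of_denom_pos quotient_of_coprime quotient_of_div by auto
  have "\<not> int p dvd y"
  proof
    assume dvd: "int p dvd y"
    then have "\<not> int p dvd x"
      using cop p by (metis coprime_common_divisor not_prime_unit prime_nat_int_transfer)
    then have "multiplicity (int p) x = 0" "r \<noteq> 0" using y by (auto intro: not_dvd_imp_multiplicity_0 simp: rxy)
    moreover have "multiplicity (int p) y > 0"
      by (rule multiplicity_gt_zero_iff[THEN iffD2]) (use dvd y p in auto)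
    ultimately have "w (of_rat r) < 0"
      using Qp xy by (simp add: is_Qp_def padic_val_rat_def)
    then show False using r0 \<open>r \<noteq> 0\<close> by (simp add: val_ge_def)
  qed
  then have cop': "coprime y (int p ^ n)"
    using prime_imp_coprime[of "int p" y] p by (simp add: coprime_commute)
  define q where "q = int p ^ n"
  obtain u t where ut: "u * y + t * q = 1"
    using bezout_int[of y q] cop' by (auto simp: q_def)
  have q: "q > 0" using p prime_gt_0_nat by (simp add: q_def)
  define j where "j = nat ((x * u) mod q)"
  have j: "int j = x * u - q * ((x * u) div q)"
    using q by (simp add: j_def minus_mult_div_eq_mod)
  have "int j < q" using q by (simp add: j_def)
  then have "int j < int (p ^ n)" by (simp add: q_def)
  then have jless: "j < p ^ n" by (simp only: of_nat_less_iff)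
  define k where "k = x * t + y * ((x * u) div q)"
  have "x - y * int j = x * (u * y + t * q) - y * int j" by (simp add: ut)
  also have "\<dots> = q * k" by (simp add: j k_def algebra_simps)
  finally have qk: "x - y * int j = q * k" .
  have wp: "w (of_nat p) = 1" using w_of_nat[of p] p by (simp add: prime_gt_0_nat)
  have "w (of_nat (nat y)) = int (multiplicity p (nat y))" using y by (intro w_of_nat) simp
  moreover have "\<not> p dvd nat y" using \<open>\<not> int p dvd y\<close> y by (simp add: int_dvd_int_iff[symmetric])
  ultimately have wy: "w (of_int y) = 0" using y by (simp add: not_dvd_imp_multiplicity_0)
  have "of_rat r - of_nat j = (of_int (x - y * int j) / of_int y :: 'q)"
    using y by (simp add: rxy of_rat_divide field_simps)
  also have "\<dots> = of_nat p ^ n * of_int k / of_int y" unfolding qk by (simp add: q_def)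
  also have "val_ge w (int n) \<dots>"
  proof -
    have "val_ge w (int n * 1) (of_nat p ^ n)"
      using base.val_ge_v[of "of_nat p"] by (intro base.val_ge_power) (simp add: wp)
    then have "val_ge w (int n) (of_nat p ^ n * of_int k)" by (intro base.val_ge_mult_right) auto
    then show ?thesis using base.val_ge_divide[of "of_int y" "int n"] y wy by simp
  qed
  finally have "val_ge w (int n) (a - of_nat j)" using r base.val_ge_diff_trans by blast
  then show ?thesis using jless by blast
qed

lemma w_approx_scaled:
  assumes "val_ge w (- int m) a"
  shows "\<exists>j < p ^ (m + n). val_ge w (int n) (a - of_nat j / of_nat p ^ m)"
proof -
  have wp: "w (of_nat p ^ m) = int m"
    using w_of_nat[of p] p by (simp add: prime_gt_0_nat base.v_power)
  have p0: "(of_nat p :: 'q) ^ m \<noteq> 0" using p by (simp add: prime_gt_0_nat)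
  have "val_ge w (- int m + int m) (a * of_nat p ^ m)"
    using assms base.val_ge_v[of "of_nat p ^ m"] wp by (intro base.val_ge_mult) simp_all
  then obtain j where j: "j < p ^ (m + n)" "val_ge w (int (m + n)) (a * of_nat p ^ m - of_nat j)"
    using w_approx by force
  have "val_ge w (int (m + n) - w (of_nat p ^ m)) ((a * of_nat p ^ m - of_nat j) / of_nat p ^ m)"
    using j p0 by (intro base.val_ge_divide) auto
  moreover have "(a * of_nat p ^ m - of_nat j) / of_nat p ^ m = a - of_nat j / of_nat p ^ m"
    using p0 by (simp add: field_simps)
  ultimately show ?thesis using j wp by auto
qed

text \<open>Coordinates of integral elements have bounded denominators, so finitely many rationals
  approximate each of them. \<open>m\<close> bounds the exponent of p in the denominators, and
  \<open>n\<close> is large enough that an error of that order still has valuation at least 1 after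
  multiplication by any basis element.\<close>

theorem residue_cover:
  obtains R where "finite R" "\<And>x. val_ge v 0 x \<Longrightarrow> \<exists>r\<in>R. val_ge v 1 (x - r)"
proof -
  obtain C where C: "\<And>a M b. val_ge v M (\<Sum>b\<in>B. \<iota> (a b) * b) \<Longrightarrow> b \<in> B \<Longrightarrow> val_ge v (M - C) (\<iota> (a b))"
    using B_bound by blast
  define m where "m = nat \<bar>C\<bar>"
  define n where "n = nat (Max (insert 0 ((\<lambda>b. 1 - v b) ` B)))"
  have n: "1 - v b \<le> int n" if "b \<in> B" for b
    using that vs.finite_Basis by (simp add: n_def Max_ge_iff le_nat_iff)
  define D where "D = (\<lambda>j. of_nat j / of_nat p ^ m :: 'q) ` {..<p ^ (m + n)}"
  define R where "R = (\<lambda>a. \<Sum>b\<in>B. \<iota> (a b) * b) ` (B \<rightarrow>\<^sub>E D)"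
  have "finite R"
    unfolding R_def D_def using vs.finite_Basis by (intro finite_imageI finite_PiE) auto
  moreover have "\<exists>r\<in>R. val_ge v 1 (x - r)" if x: "val_ge v 0 x" for x
  proof -
    obtain a where a: "x = (\<Sum>b\<in>B. \<iota> (a b) * b)" using B_span by blast
    have "\<exists>d\<in>D. val_ge w (int n) (a b - d)" if b: "b \<in> B" for b
    proof -
      have "val_ge v (- C) (\<iota> (a b))" using C[of 0 a b] x a b by simp
      moreover have "e * (- int m) \<le> - C" using e_mult_ge[of "int m"] by (simp add: m_def)
      ultimately have "val_ge w (- int m) (a b)" using val_ge_mono val_ge_iota by blast
      then show ?thesis using w_approx_scaled[of m "a b" n] by (auto simp: D_def)
    qed
    then obtain d where d: "\<And>b. b \<in> B \<Longrightarrow> d b \<in> D \<and> val_ge w (int n) (a b - d b)" by metis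
    define r where "r = (\<Sum>b\<in>B. \<iota> (restrict d B b) * b)"
    have "r \<in> R" unfolding r_def R_def using d by (intro imageI) auto
    moreover have "x - r = (\<Sum>b\<in>B. \<iota> (a b - d b) * b)"
      by (simp add: a r_def sum_subtractf iota_diff algebra_simps)
    moreover have "val_ge v 1 (\<Sum>b\<in>B. \<iota> (a b - d b) * b)"
    proof (rule val_ge_sum)
      fix b assume b: "b \<in> B"
      have "val_ge v (e * int n) (\<iota> (a b - d b))" using d b by (simp add: val_ge_iota)
      then have "val_ge v (e * int n + v b) (\<iota> (a b - d b) * b)" using val_ge_v by (rule val_ge_mult)
      then show "val_ge v 1 (\<iota> (a b - d b) * b)"
        by (rule val_ge_mono) (use n[OF b] e_mult_ge[of "int n"] in linarith)
    qed
    ultimately show ?thesis by metis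
  qed
  ultimately show thesis using that by blast
qed

sublocale complete_valued_field v
  by unfold_locales (rule cauchy_converges)

lemma residue_card_ge_2: "residue_card v \<ge> 2"
  using residue_cover finite_residue_field(2) by metis

end

section \<open>The algebra of division sequences\<close>

text \<open>Semaev's third summation polynomial, with b2, b4, b6, b8 in the roles of the four
  coefficients: it expresses that points with x-coordinates t, u, w can be chosen to have sum zero.
  In these invariants its coefficients are integers, so residue characteristics 2 and 3 need no
  separate treatment.\<close>

definition sum_poly :: "'a::field \<Rightarrow> 'a \<Rightarrow> 'a \<Rightarrow> 'a \<Rightarrow> 'a \<Rightarrow> 'a \<Rightarrow> 'a \<Rightarrow> 'a" where
  "sum_poly c2 c4 c6 c8 t u w =
     (u - w)^2 * t^2 - (2 * u * w * (u + w) + c2 * u * w + c4 * (u + w) + c6) * t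
       + (u * w)^2 - c4 * u * w - c6 * (u + w) - c8"

lemma sum_poly_commute:
  "sum_poly c2 c4 c6 c8 t u w = sum_poly c2 c4 c6 c8 t w u"
  "sum_poly c2 c4 c6 c8 t u w = sum_poly c2 c4 c6 c8 u t w"
  unfolding sum_poly_def by algebra+

text \<open>The new coefficients are the b-invariants after moving the origin of the x-axis to
  \<open>x\<close>. The algebra is done with the point at x = 0, the estimates with the original
  integral equation; this is the passage between them.\<close>

lemma sum_poly_translate:
  fixes x :: "'a::field_char_0"
  shows "sum_poly c2 c4 c6 c8 (x + t) (x + u) (x + w) =
    sum_poly (c2 + 12 * x) (c4 + c2 * x + 6 * x^2) (c6 + 2 * c4 * x + c2 * x^2 + 4 * x^3)
      (c8 + 3 * c6 * x + 3 * c4 * x^2 + c2 * x^3 + 3 * x^4) t u w"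
  unfolding sum_poly_def by algebra

text \<open>For P at x = 0 and Q at x = u, the hypotheses say that r and s are the x-coordinates of
  Q - P and Q + P, while \<open>X2\<close> is that of 2P. These points differ by 2P, hence the
  relation. It is symmetric in r and s, and the factor 4 u^4 c6^2 clears all denominators.\<close>

lemma sum_poly_double_zero:
  fixes u :: "'a::field_char_0"
  assumes c8: "4 * c8 = c2 * c6 - c4^2"
    and s: "u^2 * (r + s) = c4 * u + c6" and p: "u^2 * (r * s) = - (c6 * u + c8)"
    and "u \<noteq> 0" "c6 \<noteq> 0" and X2: "X2 * c6 = - c8"
  shows "sum_poly c2 c4 c6 c8 s r X2 = 0"
proof -
  define S where "S = r + s"
  define P where "P = r * s"
  have "sum_poly c2 c4 c6 c8 s r X2 = sum_poly c2 c4 c6 c8 X2 r s"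
    by (metis sum_poly_commute)
  also have "\<dots> = (S^2 - 4 * P) * X2^2 - (2 * P * S + c2 * P + c4 * S + c6) * X2
       + P^2 - c4 * P - c6 * S - c8"
    unfolding sum_poly_def S_def P_def by algebra
  finally have *: "sum_poly c2 c4 c6 c8 s r X2 = \<dots>" .
  have S: "u^2 * S = c4 * u + c6" and P: "u^2 * P = - (c6 * u + c8)"
    using s p by (simp_all add: S_def P_def)
  have "4 * u^4 * c6^2 * sum_poly c2 c4 c6 c8 s r X2 =
     4 * ((u^2*S)^2 - 4 * u^2 * (u^2 * P)) * (X2*c6)^2 - 4 * (2 * (u^2*P) * (u^2*S) + c2 * u^2*(u^2*P) + c4 * u^2* (u^2*S) + c6*u^4) * (X2 * c6) * c6
       + 4*((u^2*P)^2 - c4 * u^2 * (u^2*P) - c6 * u^2 * (u^2*S) - c8 * u^4) * c6^2"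
    unfolding * by algebra
  also have "\<dots> = 0"
    unfolding S P X2 using c8 by algebra
  finally show ?thesis using assms(4,5) by simp
qed

lemma small_or_parity:
  fixes n :: nat
  assumes "1 \<le> n"
  obtains "n = 1" | "n = 2" | "n = 3" | "n = 4" | k where "n = 2 * k + 5" | k where "n = 2 * k + 6"
proof (cases "n \<le> 4")
  case True
  then have "n = 1 \<or> n = 2 \<or> n = 3 \<or> n = 4" using assms by (auto simp: le_Suc_eq numeral_eq_Suc)
  then show thesis using that(1-4) by blast
next
  case False
  define m where "m = n - 5"
  have m: "n = m + 5" using False by (simp add: m_def)
  show thesis
  proof (cases "even m")
    case True
    then obtain k where "m = 2 * k" by (rule evenE)
    then show thesis using that(5)[of k] m by simp
  next
    case False
    then obtain k where "m = 2 * k + 1" by (rule oddE)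
    then show thesis using that(6)[of k] m by simp
  qed
qed

text \<open>The recursion of the division polynomials at a point moved to x = 0, where the cubic in
  x that equals (2y + a1 x + a3)^2 reduces to its constant term \<open>c6\<close>, and Psi_3 to
  \<open>c8\<close>.\<close>

locale division_sequence =
  fixes c2 c4 c6 c8 :: "'a::field_char_0" and W :: "nat \<Rightarrow> 'a"
  assumes c8: "4 * c8 = c2 * c6 - c4^2"
    and W_1: "W 1 = 1" and W_2: "(W 2)^2 = c6" and W_3: "W 3 = c8"
    and W_4: "W 4 = W 2 * (c4 * c8 - c6^2)"
    and W_odd: "m \<ge> 2 \<Longrightarrow> W (2 * m + 1) = W (m + 2) * W m ^ 3 - W (m - 1) * W (m + 1) ^ 3"
    and W_even: "m \<ge> 3 \<Longrightarrow> W (2 * m) * W 2 =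
      W (m - 1) ^ 2 * W m * W (m + 2) - W (m - 2) * W m * W (m + 1) ^ 2"
begin

text \<open>The x-coordinate of [n]P when P lies at x = 0. The recurrence is the formula for x(Q +
  P) + x(Q - P), which is rational in x(Q) alone, so no y-coordinate is needed. \<open>X 0\<close>
  is a dummy, since [0]P is at infinity.\<close>

fun X :: "nat \<Rightarrow> 'a" where
  "X 0 = 0"
| "X (Suc 0) = 0"
| "X (Suc (Suc 0)) = - c8 / c6"
| "X (Suc (Suc (Suc n))) = (c4 * X (Suc (Suc n)) + c6) / (X (Suc (Suc n)))^2 - X (Suc n)"

text \<open>The sequence forced by the bilinear relation with second index 1. It is compared with
  \<open>W\<close> only after the full relation is known for \<open>V\<close>.\<close>

fun V :: "nat \<Rightarrow> 'a" where
  "V 0 = 0"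
| "V (Suc 0) = 1"
| "V (Suc (Suc 0)) = W 2"
| "V (Suc (Suc (Suc n))) = - X (Suc (Suc n)) * (V (Suc (Suc n)))^2 / V (Suc n)"

lemma X_rec:
  assumes "X (n + 2) \<noteq> 0"
  shows "(X (n + 2))^2 * (X (n + 3) + X (n + 1)) = c4 * X (n + 2) + c6"
  using assms by (simp add: numeral_eq_Suc)

text \<open>The recurrence prescribes only the sum of the two neighbours. Their product propagates
  because the biquadratic relation between consecutive terms is symmetric: \<open>X (n + 2)\<close>
  is a root of the quadratic attached to \<open>X (n + 3)\<close>, and by the sum
  \<open>X (n + 4)\<close> is the other root.\<close>

lemma X_prod:
  assumes "c6 \<noteq> 0" "\<And>i. i \<le> n \<Longrightarrow> X (i + 2) \<noteq> 0"
  shows "(X (n + 2))^2 * (X (n + 3) * X (n + 1)) = - (c6 * X (n + 2) + c8)"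
  using assms(2)
proof (induction n)
  case 0
  show ?case using assms(1) by (simp add: numeral_eq_Suc)
next
  case (Suc n)
  have IH: "(X (n + 2))^2 * (X (n + 3) * X (n + 1)) = - (c6 * X (n + 2) + c8)"
    using Suc by simp
  have 1: "(X (n + 2))^2 * (X (n + 3) + X (n + 1)) = c4 * X (n + 2) + c6"
    using X_rec Suc.prems[of n] by simp
  have 2: "(X (n + 3))^2 * (X (n + 4) + X (n + 2)) = c4 * X (n + 3) + c6"
    using X_rec[of "Suc n"] Suc.prems[of "Suc n"] by (simp add: numeral_eq_Suc)
  have "(X (n + 3))^2 * (X (n + 4) * X (n + 2)) = - (c6 * X (n + 3) + c8)"
    using IH 1 2 by algebra
  then show ?case by (simp add: numeral_eq_Suc)
qed

lemma X_biquadratic: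
  assumes "c6 \<noteq> 0" "\<And>i. i \<le> n \<Longrightarrow> X (i + 2) \<noteq> 0"
  shows "(X (n + 2))^2 * ((t - X (n + 3)) * (t - X (n + 1))) =
    (X (n + 2) * t)^2 - (c4 * X (n + 2) + c6) * t - (c6 * X (n + 2) + c8)"
proof -
  have "(X (n + 2))^2 * (X (n + 3) * X (n + 1)) = - (c6 * X (n + 2) + c8)"
    using assms by (rule X_prod)
  moreover have "(X (n + 2))^2 * (X (n + 3) + X (n + 1)) = c4 * X (n + 2) + c6"
    using assms(2) by (intro X_rec) simp
  ultimately show ?thesis by algebra
qed

declare X.simps [simp del] V.simps [simp del]

lemma X_1: "X 1 = 0" and X_2: "X 2 = - c8 / c6" and V_1: "V 1 = 1" and V_2: "V 2 = W 2"
  by (simp_all add: numeral_eq_Suc X.simps V.simps)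

lemma V_Suc: "V (n + 3) = - X (n + 2) * (V (n + 2))^2 / V (n + 1)"
  by (simp add: numeral_eq_Suc V.simps)

context
  fixes L assumes nz: "\<And>i. 1 \<le> i \<Longrightarrow> i < L \<Longrightarrow> V i \<noteq> 0"
begin

lemma V_step:
  assumes "n + 2 \<le> L"
  shows "V (n + 3) * V (n + 1) = - X (n + 2) * (V (n + 2))^2"
  using nz[of "n + 1"] assms by (simp add: V_Suc)

lemma X_nonzero: "n + 3 < L \<Longrightarrow> X (n + 2) \<noteq> 0"
  using nz[of "n + 3"] by (auto simp: V_Suc)

lemma c6_nonzero: "2 < L \<Longrightarrow> c6 \<noteq> 0"
  using nz[of 2] W_2 by (auto simp: V_2)

text \<open>Indices are written with the difference \<open>d\<close> to avoid subtraction. The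
  induction goes in steps of two: the relations for (k + 1, d + 2), (k + 1, d) and (k, d + 2)
  combine to that for (k + 2, d). Only terms below \<open>L\<close> have to be nonzero, so the
  relation is available up to the first possible zero.\<close>

lemma V_rel:
  assumes "n \<ge> 1" "d \<ge> 1" "2 * n + d \<le> L"
  shows "V (2 * n + d) * V d = (V (n + d))^2 * (V n)^2 * (X n - X (n + d))"
  using assms
proof (induction n arbitrary: d rule: less_induct)
  case (less n d)
  obtain e where e: "d = Suc e" using less.prems by (cases d) auto
  consider "n = 1" | "n = 2" | k where "n = k + 2" "k \<ge> 1"
    using less.prems(1) that(3)[of "n - 2"] by (cases "n \<le> 2") (auto simp: le_Suc_eq numeral_eq_Suc)
  then show ?case
  proof cases
    case 1
    then show ?thesis using V_step[of e] less.prems X_1 V_1 by (simp add: e numeral_eq_Suc)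
  next
    case 2
    have L: "e + 5 \<le> L" using less.prems 2 e by simp
    have c6: "c6 \<noteq> 0" using c6_nonzero L by simp
    have 3: "V (e + 5) * V (e + 3) = - X (e + 4) * (V (e + 4))^2"
      using V_step[of "e + 2"] L by (simp add: numeral_eq_Suc)
    have 4: "V (e + 4) * V (e + 2) = - X (e + 3) * (V (e + 3))^2"
      using V_step[of "e + 1"] L by (simp add: numeral_eq_Suc)
    have 5: "V (e + 3) * V (e + 1) = - X (e + 2) * (V (e + 2))^2"
      using V_step[of e] L by (simp add: numeral_eq_Suc)
    have 6: "(X (e + 3))^2 * (X (e + 4) * X (e + 2)) = - (c6 * X (e + 3) + c8)"
      using X_prod[of "e + 1"] c6 X_nonzero L by (simp add: numeral_eq_Suc)
    have "(V (e + 3))^2 * (V (e + 5) * V (e + 1)) = (V (e + 5) * V (e + 3)) * (V (e + 3) * V (e + 1))"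
      by algebra
    also have "\<dots> = X (e + 4) * X (e + 2) * (V (e + 4) * V (e + 2))^2"
      unfolding 3 5 by algebra
    also have "\<dots> = (V (e + 3))^2 * ((V (e + 3))^2 * (X (e + 3))^2 * (X (e + 4) * X (e + 2)))"
      unfolding 4 by algebra
    finally have "(V (e + 3))^2 * (V (e + 5) * V (e + 1)) =
      (V (e + 3))^2 * ((V (e + 3))^2 * (X (e + 3))^2 * (X (e + 4) * X (e + 2)))" .
    then have "V (e + 5) * V (e + 1) = (V (e + 3))^2 * (X (e + 3))^2 * (X (e + 4) * X (e + 2))"
      using nz[of "e + 3"] L by simp
    also have "\<dots> = (V (e + 3))^2 * (W 2)^2 * (- c8 / c6 - X (e + 3))"
      unfolding mult.assoc 6 W_2 using c6 by (simp add: field_simps)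
    finally show ?thesis using X_2 V_2 by (simp add: 2 e numeral_eq_Suc)
  next
    case k: (3 k)
    obtain j where j: "k = Suc j" using k(2) by (cases k) auto
    have L: "2 * k + d + 4 \<le> L" using less.prems k by simp
    have c6: "c6 \<noteq> 0" using c6_nonzero L by simp
    have R1: "V (2 * k + d + 4) * V (d + 2) = (V (k + d + 3))^2 * (V (k + 1))^2 * (X (k + 1) - X (k + d + 3))"
      using less.IH[of "k + 1" "d + 2"] k L by (simp add: algebra_simps numeral_eq_Suc)
    have R2: "V (2 * k + d + 2) * V d = (V (k + d + 1))^2 * (V (k + 1))^2 * (X (k + 1) - X (k + d + 1))"
      using less.IH[of "k + 1" d] k L \<open>d \<ge> 1\<close> by (simp add: algebra_simps numeral_eq_Suc)
    have R3: "V (2 * k + d + 2) * V (d + 2) = (V (k + d + 2))^2 * (V k)^2 * (X k - X (k + d + 2))"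
      using less.IH[of k "d + 2"] k L by (simp add: algebra_simps numeral_eq_Suc)
    have S1: "V (k + d + 3) * V (k + d + 1) = - X (k + d + 2) * (V (k + d + 2))^2"
      using V_step[of "k + d"] L by (simp add: numeral_eq_Suc)
    have S2: "V (k + 2) * V k = - X (k + 1) * (V (k + 1))^2"
      using V_step[of j] L by (simp add: j numeral_eq_Suc)
    \<comment> \<open>The two right-hand sides agree: both are the symmetric polynomial in
      \<open>X (k + 1)\<close>, \<open>X (k + d + 2)\<close> and 0, factored once over the
      neighbours of \<open>X (k + d + 2)\<close> and once over those of
      \<open>X (k + 1)\<close>.\<close>
    have G1: "(X (k + d + 2))^2 * ((X (k + 1) - X (k + d + 3)) * (X (k + 1) - X (k + d + 1))) =
      (X (k + d + 2) * X (k + 1))^2 - (c4 * X (k + d + 2) + c6) * X (k + 1) - (c6 * X (k + d + 2) + c8)"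
      using X_biquadratic[of "k + d"] c6 X_nonzero L k(2) by (simp add: numeral_eq_Suc)
    have G2: "(X (k + 1))^2 * ((X (k + d + 2) - X (k + 2)) * (X (k + d + 2) - X k)) =
      (X (k + d + 2) * X (k + 1))^2 - (c4 * X (k + d + 2) + c6) * X (k + 1) - (c6 * X (k + d + 2) + c8)"
      using X_biquadratic[of j "X (k + d + 2)"] c6 X_nonzero L k(2)
      by (simp add: j numeral_eq_Suc algebra_simps)
    have "V (2 * k + d + 2) \<noteq> 0" "V (d + 2) \<noteq> 0" "V k \<noteq> 0" "V (k + d + 2) \<noteq> 0" "V d \<noteq> 0"
      using nz L k(2) \<open>d \<ge> 1\<close> by auto
    moreover have "(V (2 * k + d + 2) * V (d + 2)) * (V k)^2 *
        (V (2 * k + d + 4) * V d) =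
      (V (2 * k + d + 2) * V (d + 2)) * (V k)^2 *
        ((V (k + d + 2))^2 * (V (k + 2))^2 * (X (k + 2) - X (k + d + 2)))"
    proof -
      have "(V (2 * k + d + 2) * V (d + 2)) * (V k)^2 * (V (2 * k + d + 4) * V d) =
        (V k)^2 * (V (2 * k + d + 4) * V (d + 2)) * (V (2 * k + d + 2) * V d)"
        by algebra
      also have "\<dots> = (V k)^2 * (V (k + d + 3) * V (k + d + 1))^2 * (V (k + 1))^4
         * ((X (k + 1) - X (k + d + 3)) * (X (k + 1) - X (k + d + 1)))"
        unfolding R1 R2 by algebra
      also have "\<dots> = (V k)^2 * (V (k + d + 2))^4 * (V (k + 1))^4 *
          ((X (k + d + 2))^2 * ((X (k + 1) - X (k + d + 3)) * (X (k + 1) - X (k + d + 1))))"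
        unfolding S1 by algebra
      also have "\<dots> = (V k)^2 * (V (k + d + 2))^4 * (V (k + 1))^4 *
          ((X (k + 1))^2 * ((X (k + d + 2) - X (k + 2)) * (X (k + d + 2) - X k)))"
        unfolding G1 G2 ..
      also have "\<dots> = (V k)^2 * (V (k + d + 2))^4 * (V (k + 2) * V k)^2 *
          ((X (k + d + 2) - X (k + 2)) * (X (k + d + 2) - X k))"
        unfolding S2 by algebra
      also have "\<dots> = (V (2 * k + d + 2) * V (d + 2)) * (V k)^2 *
        ((V (k + d + 2))^2 * (V (k + 2))^2 * (X (k + 2) - X (k + d + 2)))"
        unfolding R3 by algebra
      finally show ?thesis .
    qed
    ultimately have "V (2 * k + d + 4) * V d = (V (k + d + 2))^2 * (V (k + 2))^2 * (X (k + 2) - X (k + d + 2))"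
      by simp
    then show ?thesis by (simp add: k algebra_simps numeral_eq_Suc)
  qed
qed

end

text \<open>Eliminating the x-coordinates from \<open>V_rel\<close> with d = 1 and d = 2 yields
  exactly the odd and even recursions. \<open>W L\<close> itself may vanish, which is what the study
  of the first zero requires.\<close>

lemma V_eq_W:
  assumes "\<And>i. 1 \<le> i \<Longrightarrow> i < L \<Longrightarrow> W i \<noteq> 0" "1 \<le> L"
  shows "V L = W L"
  using assms
proof (induction L rule: less_induct)
  case (less L)
  have VW: "V i = W i" if "1 \<le> i" "i < L" for i using less that by auto
  have nz: "V i \<noteq> 0" if "1 \<le> i" "i < L" for i using VW less that by auto
  consider "L = 1" | "L = 2" | "L = 3" | "L = 4" | k where "L = 2 * k + 5" | k where "L = 2 * k + 6"
    using less.prems(2) by (rule small_or_parity)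
  then show ?case
  proof cases
    case 1 then show ?thesis using W_1 V_1 by simp
  next
    case 2 then show ?thesis using V_2 by simp
  next
    case 3
    then have "c6 \<noteq> 0" using c6_nonzero[of L] nz by auto
    then show ?thesis using W_2 W_3 V_Suc[of 0] X_2 V_2 V_1 by (simp add: 3 numeral_eq_Suc)
  next
    case 4
    then have c6: "c6 \<noteq> 0" using c6_nonzero[of L] nz by auto
    have c8: "c8 \<noteq> 0" using less.prems(1)[of 3] 4 W_3 by simp
    have W2: "W 2 \<noteq> 0" using c6 W_2 by auto
    have X3: "X 3 = (c6^2 - c4 * c8) * c6 / c8^2"
      using c6 c8 by (simp add: numeral_eq_Suc X.simps field_simps)
    have "V 3 = c8" using VW[of 3] 4 W_3 by simp
    then have "V 4 = - X 3 * c8^2 / W 2" using V_Suc[of 1] V_2 by (simp add: numeral_eq_Suc)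
    also have "\<dots> = - (c6^2 - c4 * c8) * (c6 / W 2)" unfolding X3 using c8 W2 by (simp add: field_simps)
    also have "c6 / W 2 = W 2" using W2 by (simp add: W_2[symmetric] power2_eq_square)
    also have "- (c6^2 - c4 * c8) * W 2 = W 2 * (c4 * c8 - c6^2)" by algebra
    finally show ?thesis using 4 W_4 by simp
  next
    case (5 k)
    have A: "V (2 * k + 5) * V 1 = (V (k + 3))^2 * (V (k + 2))^2 * (X (k + 2) - X (k + 3))"
      using V_rel[of L "k + 2" 1] nz 5 by (simp add: numeral_eq_Suc)
    have B: "V (k + 3) * V (k + 1) = - X (k + 2) * (V (k + 2))^2"
      using V_step[of L k] nz 5 by simp
    have C: "V (k + 4) * V (k + 2) = - X (k + 3) * (V (k + 3))^2"
      using V_step[of L "k + 1"] nz 5 by (simp add: numeral_eq_Suc)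
    have "V (2 * k + 5) * V 1 = V (k + 4) * V (k + 2)^3 - V (k + 1) * V (k + 3)^3"
      proof -
      have "V (2 * k + 5) * V 1 = (V (k + 2))^2 * (V (k + 4) * V (k + 2)) - (V (k + 3))^2 * (V (k + 3) * V (k + 1))"
        unfolding A B C by algebra
      then show ?thesis by algebra
    qed
    then have "V L = W (k + 4) * W (k + 2)^3 - W (k + 1) * W (k + 3)^3"
      using VW 5 V_1 by simp
    then show ?thesis using W_odd[of "k + 2"] 5 by (simp add: numeral_eq_Suc)
  next
    case (6 k)
    have A: "V (2 * k + 6) * V 2 = (V (k + 4))^2 * (V (k + 2))^2 * (X (k + 2) - X (k + 4))"
      using V_rel[of L "k + 2" 2] nz 6 by (simp add: numeral_eq_Suc)
    have B: "V (k + 3) * V (k + 1) = - X (k + 2) * (V (k + 2))^2"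
      using V_step[of L k] nz 6 by simp
    have C: "V (k + 5) * V (k + 3) = - X (k + 4) * (V (k + 4))^2"
      using V_step[of L "k + 2"] nz 6 by (simp add: numeral_eq_Suc)
    have "V (2 * k + 6) * V 2 = V (k + 2)^2 * V (k + 3) * V (k + 5) - V (k + 1) * V (k + 3) * V (k + 4)^2"
      proof -
      have "V (2 * k + 6) * V 2 = (V (k + 2))^2 * (V (k + 5) * V (k + 3)) - (V (k + 4))^2 * (V (k + 3) * V (k + 1))"
        unfolding A B C by algebra
      then show ?thesis by algebra
    qed
    then have "V L * W 2 = W (k + 2)^2 * W (k + 3) * W (k + 5) - W (k + 1) * W (k + 3) * W (k + 4)^2"
      using VW 6 by simp
    also have "\<dots> = W L * W 2" using W_even[of "k + 3"] 6 by (simp add: numeral_eq_Suc)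
    finally show ?thesis using nz[of 2] VW[of 2] 6 by simp
  qed
qed

end

section \<open>Addition and duplication formulas for sequences without zeros\<close>

locale nondegenerate_division_sequence = division_sequence +
  assumes W_nonzero: "n \<ge> 1 \<Longrightarrow> W n \<noteq> 0"
begin

lemma V_is_W: "n \<ge> 1 \<Longrightarrow> V n = W n"
  using V_eq_W W_nonzero by blast

lemma W_rel:
  assumes "n \<ge> 1" "d \<ge> 1"
  shows "W (2 * n + d) * W d = (W (n + d))^2 * (W n)^2 * (X n - X (n + d))"
  using V_rel[of "2 * n + d" n d] V_is_W W_nonzero assms by simp

lemma W_step: "W (n + 3) * W (n + 1) = - X (n + 2) * (W (n + 2))^2"
  using V_step[of "n + 4" n] V_is_W W_nonzero by simp

lemma c6_neq_0: "c6 \<noteq> 0"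
  using W_2 W_nonzero[of 2] by auto

lemma X_neq_0: "X (n + 2) \<noteq> 0"
  using X_nonzero[of "n + 4" n] V_is_W W_nonzero by simp

lemma X_neq: "n \<ge> 1 \<Longrightarrow> d \<ge> 1 \<Longrightarrow> X (n + d) \<noteq> X n"
  using W_rel[of n d] W_nonzero[of "2 * n + d"] W_nonzero[of d] by auto

lemma X_inj: "m \<ge> 1 \<Longrightarrow> n \<ge> 1 \<Longrightarrow> X m = X n \<longleftrightarrow> m = n"
  using X_neq[of n "m - n"] X_neq[of m "n - m"]
  by (cases m n rule: linorder_cases) (auto simp: Suc_le_eq)

lemma X_sum: "(X (n + 2))^2 * (X (n + 3) + X (n + 1)) = c4 * X (n + 2) + c6"
  using X_rec X_neq_0 by blast

lemma X_product: "(X (n + 2))^2 * (X (n + 3) * X (n + 1)) = - (c6 * X (n + 2) + c8)"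
  using X_prod X_neq_0 c6_neq_0 by blast

text \<open>The sequence is extended to an odd function on the integers, which makes the bilinear
  relation valid without any case distinction on the order of the indices.\<close>

definition Wi :: "int \<Rightarrow> 'a" where
  "Wi i = (if i = 0 then 0 else if i > 0 then W (nat i) else - W (nat (- i)))"

definition Xi :: "int \<Rightarrow> 'a" where
  "Xi i = X (nat \<bar>i\<bar>)"

lemma Wi_minus: "Wi (- i) = - Wi i"
  by (simp add: Wi_def)

lemma Xi_minus: "Xi (- i) = Xi i"
  by (simp add: Xi_def)

lemma Wi_nonzero: "i \<noteq> 0 \<Longrightarrow> Wi i \<noteq> 0"
  using W_nonzero by (simp add: Wi_def)

lemma Wi_rel:
  assumes "m \<noteq> 0" "n \<noteq> 0"
  shows "Wi (m + n) * Wi (m - n) = (Wi m)^2 * (Wi n)^2 * (Xi n - Xi m)"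
proof -
  define P where "P m n \<longleftrightarrow> Wi (m + n) * Wi (m - n) = (Wi m)^2 * (Wi n)^2 * (Xi n - Xi m)" for m n
  have swap: "P n m" if "P m n" for m n
  proof -
    have "Wi (n - m) = - Wi (m - n)" using Wi_minus[of "m - n"] by simp
    then show ?thesis using that unfolding P_def add.commute[of n m] by algebra
  qed
  have neg: "P m (- n)" if "P m n" for m n
    using that unfolding P_def by (simp add: Wi_minus Xi_minus mult.commute)
  have less: "P m n" if "0 < n" "n < m" for m n
  proof -
    have "nat (m + n) = 2 * nat n + nat (m - n)" "nat m = nat n + nat (m - n)" using that by auto
    then show ?thesis unfolding P_def using that W_rel[of "nat n" "nat (m - n)"]
      by (simp add: Wi_def Xi_def)
  qed
  have pos: "P m n" if "0 < n" "0 < m" for m n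
  proof (cases m n rule: linorder_cases)
    case equal
    then show ?thesis by (simp add: P_def Wi_def)
  qed (use less swap that in auto)
  have "P \<bar>m\<bar> \<bar>n\<bar>" using pos assms by simp
  then have "P \<bar>m\<bar> n" using neg[of "\<bar>m\<bar>" "\<bar>n\<bar>"] by (cases "n \<ge> 0") auto
  then have "P n \<bar>m\<bar>" by (rule swap)
  then have "P n m" using neg[of n "\<bar>m\<bar>"] by (cases "m \<ge> 0") auto
  then show ?thesis using swap P_def by blast
qed

text \<open>Multiplied by the fourth powers of the three values of \<open>Wi\<close>, either side
  becomes the product of \<open>Wi\<close> over the four indices m \<plusminus> k \<plusminus> n,
  which is symmetric in k and n.\<close>

lemma Xi_symmetric:
  assumes "m \<noteq> 0" "n \<noteq> 0" "k \<noteq> 0" "m + k \<noteq> 0" "m - k \<noteq> 0" "m + n \<noteq> 0" "m - n \<noteq> 0"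
  shows "(Xi m - Xi k)^2 * ((Xi n - Xi (m + k)) * (Xi n - Xi (m - k))) =
         (Xi m - Xi n)^2 * ((Xi k - Xi (m + n)) * (Xi k - Xi (m - n)))"
proof -
  have *: "(Wi m)^4 * (Wi k)^4 * (Wi n)^4 *
      ((Xi m - Xi k)^2 * ((Xi n - Xi (m + k)) * (Xi n - Xi (m - k)))) =
    Wi (m + k + n) * Wi (m + k - n) * (Wi (m - k + n) * Wi (m - k - n))"
    if "n \<noteq> 0" "k \<noteq> 0" "m + k \<noteq> 0" "m - k \<noteq> 0" for n k
  proof -
    have "(Wi m)^4 * (Wi k)^4 * (Wi n)^4 *
      ((Xi m - Xi k)^2 * ((Xi n - Xi (m + k)) * (Xi n - Xi (m - k)))) =
      ((Wi m)^2 * (Wi k)^2 * (Xi k - Xi m))^2 * (Wi n)^4 * ((Xi n - Xi (m + k)) * (Xi n - Xi (m - k)))"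
      by algebra
    also have "\<dots> = ((Wi (m + k))^2 * (Wi n)^2 * (Xi n - Xi (m + k))) *
        ((Wi (m - k))^2 * (Wi n)^2 * (Xi n - Xi (m - k)))"
      unfolding Wi_rel[OF assms(1) that(2), symmetric] by algebra
    also have "\<dots> = Wi (m + k + n) * Wi (m + k - n) * (Wi (m - k + n) * Wi (m - k - n))"
      using Wi_rel that by simp
    finally show ?thesis .
  qed
  have "(Wi m)^4 * (Wi k)^4 * (Wi n)^4 *
      ((Xi m - Xi k)^2 * ((Xi n - Xi (m + k)) * (Xi n - Xi (m - k)))) =
    (Wi m)^4 * (Wi n)^4 * (Wi k)^4 *
      ((Xi m - Xi n)^2 * ((Xi k - Xi (m + n)) * (Xi k - Xi (m - n))))"
    using *[of n k] *[of k n] assms by (simp add: algebra_simps)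
  then show ?thesis using Wi_nonzero assms by (simp add: mult.assoc mult.left_commute)
qed

abbreviation F :: "'a \<Rightarrow> 'a \<Rightarrow> 'a \<Rightarrow> 'a" where
  "F \<equiv> sum_poly c2 c4 c6 c8"

lemma F_roots_1:
  assumes "m > 1"
  shows "F t (X m) (X 1) = (X m - X 1)^2 * ((t - X (m + 1)) * (t - X (m - 1)))"
proof -
  obtain k where k: "m = k + 2" using assms by (metis add.commute less_eqE Suc_1 Suc_leI)
  have "F t (X m) (X 1) = (X (k + 2) * t)^2 - (c4 * X (k + 2) + c6) * t - (c6 * X (k + 2) + c8)"
    unfolding k X_1 sum_poly_def by (simp add: algebra_simps power2_eq_square)
  also have "\<dots> = (X (k + 2))^2 * ((t - X (k + 3)) * (t - X (k + 1)))"
    using X_sum[of k] X_product[of k] by algebra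
  finally show ?thesis unfolding X_1 by (simp add: k numeral_eq_Suc)
qed

lemma F_root_2: "F (X (n + 3)) (X (n + 1)) (X 2) = 0"
  by (rule sum_poly_double_zero[where u = "X (n + 2)"])
    (use c8 X_sum[of n] X_product[of n] X_neq_0[of n] c6_neq_0 X_2 in \<open>simp_all add: add.commute mult.commute\<close>)

text \<open>Two roots of the quadratic in t are already known, and they are distinct because all
  x-coordinates of a sequence without zeros are; so they determine it.\<close>

lemma F_roots_2:
  assumes "m > 2"
  shows "F t (X m) (X 2) = (X m - X 2)^2 * ((t - X (m + 2)) * (t - X (m - 2)))"
proof -
  obtain k where k: "m = k + 3" using assms by (metis add.commute less_eqE Suc_leI eval_nat_numeral(3))
  define B where "B = 2 * X m * X 2 * (X m + X 2) + c2 * X m * X 2 + c4 * (X m + X 2) + c6"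
  define C where "C = (X m * X 2)^2 - c4 * X m * X 2 - c6 * (X m + X 2) - c8"
  have F: "F t (X m) (X 2) = (X m - X 2)^2 * t^2 - B * t + C" for t
    unfolding sum_poly_def B_def C_def by algebra
  have r1: "F (X (m + 2)) (X m) (X 2) = 0"
    using F_root_2[of "k + 2"] by (simp add: k numeral_eq_Suc)
  have r2: "F (X (m - 2)) (X m) (X 2) = 0"
    using F_root_2[of k] sum_poly_commute(2)[of c2 c4 c6 c8 "X (m - 2)"]
    by (simp add: k numeral_eq_Suc)
  have "X (m + 2) \<noteq> X (m - 2)" using assms by (simp add: X_inj)
  moreover have "(X (m + 2) - X (m - 2)) * ((X m - X 2)^2 * (X (m + 2) + X (m - 2)) - B) = 0"
    using r1 r2 unfolding F by algebra
  ultimately have B: "B = (X m - X 2)^2 * (X (m + 2) + X (m - 2))" by simp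
  have "C = (X m - X 2)^2 * (X (m + 2) * X (m - 2))"
    using r1 unfolding F B by algebra
  then show ?thesis unfolding F B by algebra
qed

lemma X_Xi: "X n = Xi (int n)"
  by (simp add: Xi_def)

text \<open>The leading coefficient in t is known, so for n \<ge> 3 two values determine the
  quadratic. At t = X 1 = 0 and t = X 2 the symmetry of \<open>F\<close> exchanges t with X n, which
  reduces to the cases n = 1, 2, and \<open>Xi_symmetric\<close> rewrites the outcome.\<close>

lemma F_roots:
  assumes "n \<ge> 1" "m > n"
  shows "F t (X m) (X n) = (X m - X n)^2 * ((t - X (m + n)) * (t - X (m - n)))"
proof -
  consider "n = 1" | "n = 2" | "n \<ge> 3" using assms by linarith
  then show ?thesis
  proof cases
    case 3
    have eq: "F (X k) (X m) (X n) = (X m - X n)^2 * ((X k - X (m + n)) * (X k - X (m - n)))"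
      if k: "k = 1 \<or> k = 2" for k
    proof -
      have "F (X k) (X m) (X n) = F (X n) (X m) (X k)" by (metis sum_poly_commute)
      also have "\<dots> = (X m - X k)^2 * ((X n - X (m + k)) * (X n - X (m - k)))"
        using F_roots_1 F_roots_2 k 3 assms by auto
      also have "\<dots> = (X m - X n)^2 * ((X k - X (m + n)) * (X k - X (m - n)))"
        using Xi_symmetric[of "int m" "int n" "int k"] k 3 assms
        by (auto simp: X_Xi of_nat_diff)
      finally show ?thesis .
    qed
    define B where "B = 2 * X m * X n * (X m + X n) + c2 * X m * X n + c4 * (X m + X n) + c6"
    define C where "C = (X m * X n)^2 - c4 * X m * X n - c6 * (X m + X n) - c8"
    have F: "F t (X m) (X n) = (X m - X n)^2 * t^2 - B * t + C" for t
      unfolding sum_poly_def B_def C_def by algebra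
    have C: "C = (X m - X n)^2 * (X (m + n) * X (m - n))"
      using eq[of 1] unfolding F X_1 by simp
    have quadratic: "s * b = s * (a * (p + q))"
      if "a * s^2 - b * s + a * (p * q) = a * ((s - p) * (s - q))" for a b s p q :: 'a
      using that by algebra
    have "X 2 * B = X 2 * ((X m - X n)^2 * (X (m + n) + X (m - n)))"
      by (rule quadratic) (use eq[of 2] F C in simp)
    then have B: "B = (X m - X n)^2 * (X (m + n) + X (m - n))"
      using X_neq_0[of 0] by (simp add: numeral_eq_Suc)
    show ?thesis unfolding F B C by algebra
  qed (use F_roots_1 F_roots_2 assms in auto)
qed

text \<open>For m = 2n one of the roots m - n is n itself. By symmetry \<open>X (2 * n)\<close> is
  then a zero of F(t, u, u) with u = \<open>X n\<close>, which is linear in t: this is the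
  duplication formula.\<close>

lemma X_double:
  assumes "n \<ge> 1"
  shows "(4 * X n ^ 3 + c2 * X n ^ 2 + 2 * c4 * X n + c6) * X (2 * n) =
    X n ^ 4 - c4 * X n ^ 2 - 2 * c6 * X n - c8"
proof -
  have "F (X n) (X (2 * n)) (X n) = 0"
    using F_roots[of n "2 * n" "X n"] assms by (simp add: mult_2)
  then have "F (X (2 * n)) (X n) (X n) = 0"
    by (metis sum_poly_commute)
  moreover have "F t u u = u ^ 4 - c4 * u ^ 2 - 2 * c6 * u - c8
      - (4 * u ^ 3 + c2 * u ^ 2 + 2 * c4 * u + c6) * t" for t u
    unfolding sum_poly_def by (simp add: algebra_simps eval_nat_numeral)
  ultimately show ?thesis by simp
qed

text \<open>The relation with second index 2 contains X(n - 1) - X(n + 1). Squaring turns this into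
  the discriminant of the quadratic with these two roots, and \<open>c6\<close> =
  \<open>W 2\<close>^2 cancels.\<close>

lemma W_double:
  assumes "n \<ge> 1"
  shows "W (2 * n) ^ 2 = W n ^ 8 * (4 * X n ^ 3 + c2 * X n ^ 2 + 2 * c4 * X n + c6)"
proof (cases "n = 1")
  case True
  then show ?thesis using X_1 W_1 W_2 by simp
next
  case False
  then obtain k where k: "n = k + 2" using assms by (metis add.commute less_eqE le_neq_implies_less Suc_leI one_add_one plus_1_eq_Suc)
  have "W (2 * k + 4) * W 2 = (W (k + 3))^2 * (W (k + 1))^2 * (X (k + 1) - X (k + 3))"
    using W_rel[of "k + 1" 2] by (simp add: numeral_eq_Suc)
  also have "\<dots> = (W (k + 3) * W (k + 1))^2 * (X (k + 1) - X (k + 3))"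
    by algebra
  also have "\<dots> = (W (k + 2))^4 * (X (k + 2))^2 * (X (k + 1) - X (k + 3))"
    unfolding W_step by algebra
  finally have *: "W (2 * k + 4) * W 2 = \<dots>" .
  have "c6 * W (2 * k + 4) ^ 2 = (W (2 * k + 4) * W 2)^2"
    by (simp add: power_mult_distrib W_2)
  also have "\<dots> = W (k + 2) ^ 8 * (((X (k + 2))^2 * (X (k + 3) + X (k + 1)))^2
      - 4 * (X (k + 2))^2 * ((X (k + 2))^2 * (X (k + 3) * X (k + 1))))"
    unfolding * by algebra
  also have "\<dots> = c6 * (W (k + 2) ^ 8 * (4 * X (k + 2) ^ 3 + c2 * X (k + 2) ^ 2 + 2 * c4 * X (k + 2) + c6))"
    unfolding X_sum X_product using c8 by algebra
  finally show ?thesis using c6_neq_0 by (simp add: k numeral_eq_Suc)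
qed

end

section \<open>Growth of valuations\<close>

text \<open>A variant of Tate's limit argument. For \<open>h\<close>, the deviation of
  \<open>G\<close> from the quadratic, the parallelogram estimate carries boundedness along 2^k over
  to 2^k n, with a bound \<open>K\<close> that depends on n and A. Doubling multiplies |h| - C by at
  least 4, so a bounded orbit must have |h| \<le> C from the start; thus neither \<open>K\<close>
  nor \<open>A\<close> survives.\<close>

lemma quasi_quadratic_bound:
  fixes G :: "nat \<Rightarrow> real"
  assumes par: "\<And>m n. n \<ge> 1 \<Longrightarrow> m > n \<Longrightarrow> \<bar>G (m + n) + G (m - n) - 2 * G m - 2 * G n\<bar> \<le> C"
    and dbl: "\<And>n. n \<ge> 1 \<Longrightarrow> \<bar>G (2 * n) - 4 * G n\<bar> \<le> C"
    and pow2: "\<And>k. \<bar>G (2 ^ k) - c * (2 ^ k)^2\<bar> \<le> A"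
    and n: "n \<ge> 1"
  shows "\<bar>G n - c * (real n)^2\<bar> \<le> C"
proof -
  define h where "h n = G n - c * (real n)^2" for n
  have h_par: "\<bar>h (m + n) + h (m - n) - 2 * h m - 2 * h n\<bar> \<le> C" if "n \<ge> 1" "m > n" for m n
  proof -
    have "h (m + n) + h (m - n) - 2 * h m - 2 * h n = G (m + n) + G (m - n) - 2 * G m - 2 * G n"
      using that by (simp add: h_def of_nat_diff power2_eq_square algebra_simps)
    then show ?thesis using par that by simp
  qed
  have h_dbl: "\<bar>h (2 * n) - 4 * h n\<bar> \<le> C" if "n \<ge> 1" for n
    using dbl[OF that] by (simp add: h_def power2_eq_square algebra_simps)
  have h_pow2: "\<bar>h (2 ^ k)\<bar> \<le> A" for k
    using pow2[of k] by (simp add: h_def)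
  have "\<exists>K. \<forall>k. \<bar>h (2 ^ k * n)\<bar> \<le> K" if "n \<ge> 1" for n
    using that
  proof (induction n rule: less_induct)
    case (less n)
    consider "n = 1" | "n = 2" | j where "n = j + 1" "j \<ge> 2"
      using less.prems that(3)[of "n - 1"] by (cases "n \<le> 2") (auto simp: le_Suc_eq numeral_eq_Suc)
    then show ?case
    proof cases
      case 1
      then show ?thesis using h_pow2 by auto
    next
      case 2
      have "\<bar>h (2 ^ k * n)\<bar> \<le> A" for k using h_pow2[of "Suc k"] by (simp add: 2 mult.commute)
      then show ?thesis by blast
    next
      case (3 j)
      obtain K1 where K1: "\<And>k. \<bar>h (2 ^ k * (j - 1))\<bar> \<le> K1"
        using less.IH[of "j - 1"] 3 by fastforce
      obtain K2 where K2: "\<And>k. \<bar>h (2 ^ k * j)\<bar> \<le> K2"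
        using less.IH[of j] 3 by fastforce
      have "\<bar>h (2 ^ k * n)\<bar> \<le> C + K1 + 2 * K2 + 2 * A" for k
      proof -
        have "2 ^ k * j + 2 ^ k = 2 ^ k * n" "2 ^ k * j - 2 ^ k = 2 ^ k * (j - 1)"
          using 3 by (simp_all add: algebra_simps)
        moreover have "(2::nat) ^ k * 1 < 2 ^ k * j" using 3 by (intro mult_strict_left_mono) auto
        ultimately have "\<bar>h (2 ^ k * n) + h (2 ^ k * (j - 1)) - 2 * h (2 ^ k * j) - 2 * h (2 ^ k)\<bar> \<le> C"
          using h_par[of "2 ^ k" "2 ^ k * j"] by simp
        then show ?thesis using K1[of k] K2[of k] h_pow2[of k] by linarith
      qed
      then show ?thesis by blast
    qed
  qed
  then obtain K where K: "\<And>k. \<bar>h (2 ^ k * n)\<bar> \<le> K" using n by blast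
  have C: "C \<ge> 0" using dbl[of 1] by linarith
  have grow: "4 ^ k * (\<bar>h n\<bar> - C) \<le> \<bar>h (2 ^ k * n)\<bar> - C" for k
  proof (induction k)
    case (Suc k)
    have "2 ^ k * n \<ge> 1" using n by simp
    then have "\<bar>h (2 * (2 ^ k * n)) - 4 * h (2 ^ k * n)\<bar> \<le> C" by (rule h_dbl)
    then have "4 * (\<bar>h (2 ^ k * n)\<bar> - C) \<le> \<bar>h (2 ^ Suc k * n)\<bar> - C"
      using C by (simp add: mult.assoc)
    then show ?case using Suc by simp
  qed simp
  have "\<bar>h n\<bar> \<le> C"
  proof (rule ccontr)
    assume "\<not> ?thesis"
    then have pos: "\<bar>h n\<bar> - C > 0" by simp
    obtain k where k: "K / (\<bar>h n\<bar> - C) < 4 ^ k" using real_arch_pow[of 4] by auto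
    then have "K < 4 ^ k * (\<bar>h n\<bar> - C)" using pos by (simp add: field_simps)
    then show False using grow[of k] K[of k] C by linarith
  qed
  then show ?thesis by (simp add: h_def)
qed

section \<open>Gauss valuations and the quasi-quadratic function G\<close>

context valued_field
begin

definition vmin :: "'a \<Rightarrow> int" where
  "vmin x = (if x = 0 then 0 else min 0 (v x))"

lemma vmin_le_0: "vmin x \<le> 0"
  by (simp add: vmin_def)

lemma val_ge_vmin: "val_ge v (vmin x) x"
  by (simp add: vmin_def val_ge_def)

lemma vmin_eq_0_iff: "vmin x = 0 \<longleftrightarrow> val_ge v 0 x"
  by (auto simp: vmin_def val_ge_def)

lemma vmin_close:
  assumes "val_ge v 0 (y - x)"
  shows "vmin y = vmin x"
proof (cases "val_ge v 0 x")
  case True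
  then have "val_ge v 0 y" using val_ge_add[OF assms True] by simp
  then show ?thesis using True vmin_eq_0_iff by metis
next
  case False
  then have "x \<noteq> 0" "v x < 0" by (auto simp: val_ge_def)
  then show ?thesis using v_eq_of_close[OF _ assms] by (simp add: vmin_def)
qed

lemma val_ge_pow_vmin:
  assumes "i \<le> k"
  shows "val_ge v (int k * vmin x) (x ^ i)"
proof -
  have "val_ge v (int i * vmin x) (x ^ i)" using val_ge_vmin by (rule val_ge_power)
  then show ?thesis by (rule val_ge_mono) (use assms vmin_le_0 in \<open>simp add: mult_right_mono_neg\<close>)
qed

text \<open>Gauss's lemma for d (t - r) (t - s): the left side of the conclusion is the least
  valuation of its coefficients.\<close>

lemma gauss_quadratic:
  assumes "d \<noteq> 0" "val_ge v \<mu> d" "val_ge v \<mu> (d * (r + s))" "val_ge v \<mu> (d * (r * s))"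
  shows "v d + vmin r + vmin s \<ge> \<mu>"
proof -
  have one: "v d + vmin r + vmin s \<ge> \<mu>"
    if "val_ge v \<mu> (d * (r + s))" "val_ge v 0 s" "\<not> val_ge v 0 r" for r s
  proof -
    have r: "r \<noteq> 0" "v r < 0" using that by (auto simp: val_ge_def)
    then have "r + s \<noteq> 0" "v (r + s) = v r" using v_add_eq that(2) by blast+
    then have "v d + v r \<ge> \<mu>" using that(1) assms(1) by (auto simp: val_ge_def v_mult)
    moreover have "vmin s = 0" using that by (simp add: vmin_eq_0_iff)
    ultimately show ?thesis using r by (simp add: vmin_def)
  qed
  consider "val_ge v 0 r" "val_ge v 0 s" | "\<not> val_ge v 0 r" "val_ge v 0 s"
    | "val_ge v 0 r" "\<not> val_ge v 0 s" | "\<not> val_ge v 0 r" "\<not> val_ge v 0 s" by blast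
  then show ?thesis
  proof cases
    case 1
    then have "vmin r = 0" "vmin s = 0" by (simp_all add: vmin_eq_0_iff)
    then show ?thesis using assms by (simp add: val_ge_def)
  next
    case 2
    then show ?thesis using one assms by blast
  next
    case 3
    then show ?thesis using one[of s r] assms by (simp add: add.commute)
  next
    case 4
    then have "r \<noteq> 0" "s \<noteq> 0" "v r < 0" "v s < 0" by (auto simp: val_ge_def)
    then show ?thesis using assms(1,4) by (simp add: val_ge_def v_mult vmin_def)
  qed
qed

lemma val_ge_of_sum_prod:
  assumes "val_ge v \<mu> (r + s)" "val_ge v (2 * \<mu>) (r * s)"
  shows "val_ge v \<mu> r"
proof (rule ccontr)
  assume "\<not> ?thesis"
  then have r: "r \<noteq> 0" "v r < \<mu>" by (auto simp: val_ge_def)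
  have "val_ge v \<mu> (s - (- r))" using assms(1) by (simp add: add.commute)
  then have "s \<noteq> 0" "v s = v (- r)"
    using v_eq_of_close[of "- r" \<mu> s] r by auto
  then show False using r assms(2) by (simp add: val_ge_def v_mult)
qed

end

text \<open>A Bezout identity between denominator and numerator of the duplication formula; it
  bounds how much can cancel in that fraction. Both sides are multiplied by 4 because
  \<open>c8\<close> is tied to the other coefficients only through 4 c8.\<close>

lemma discriminant_resultant:
  fixes t :: "'a::field_char_0"
  assumes "4 * c8 = c2 * c6 - c4^2"
  shows "- (c2^2 * c8) - 8 * c4^3 - 27 * c6^2 + 9 * c2 * c4 * c6 =
      (12 * t ^ 3 - c2 * t ^ 2 - 10 * c4 * t + (c2 * c4 - 27 * c6)) *
      (4 * t ^ 3 + c2 * t ^ 2 + 2 * c4 * t + c6)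
    - (48 * t ^ 2 + 8 * c2 * t + (32 * c4 - c2 ^ 2)) * (t ^ 4 - c4 * t ^ 2 - 2 * c6 * t - c8)"
proof -
  have "4 * (- (c2^2 * c8) - 8 * c4^3 - 27 * c6^2 + 9 * c2 * c4 * c6) =
    4 * ((12 * t ^ 3 - c2 * t ^ 2 - 10 * c4 * t + (c2 * c4 - 27 * c6)) *
      (4 * t ^ 3 + c2 * t ^ 2 + 2 * c4 * t + c6)
    - (48 * t ^ 2 + 8 * c2 * t + (32 * c4 - c2 ^ 2)) * (t ^ 4 - c4 * t ^ 2 - 2 * c6 * t - c8))"
    using assms by algebra
  then show ?thesis unfolding mult_cancel_left by simp
qed

text \<open>All that the valuation estimates use about a point without vanishing \<open>W n\<close>.
  The x-coordinates are those of the original equation: its b-invariants are integral, while those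
  translated by the coordinate of the point need not be.\<close>

locale height_sequence = valued_field v
  for v :: "'a::field_char_0 \<Rightarrow> int" +
  fixes c2 c4 c6 c8 D :: 'a and W x :: "nat \<Rightarrow> 'a"
  assumes integral: "val_ge v 0 c2" "val_ge v 0 c4" "val_ge v 0 c6" "val_ge v 0 c8"
    and c8: "4 * c8 = c2 * c6 - c4^2"
    and D: "D = - (c2^2 * c8) - 8 * c4^3 - 27 * c6^2 + 9 * c2 * c4 * c6" "D \<noteq> 0"
    and W_nonzero: "n \<ge> 1 \<Longrightarrow> W n \<noteq> 0"
    and W_rel: "n \<ge> 1 \<Longrightarrow> m > n \<Longrightarrow>
      W (m + n) * W (m - n) = (W m)^2 * (W n)^2 * (x n - x m)"
    and roots: "n \<ge> 1 \<Longrightarrow> m > n \<Longrightarrow>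
      sum_poly c2 c4 c6 c8 t (x m) (x n) = (x m - x n)^2 * ((t - x (m + n)) * (t - x (m - n)))"
    and x_double: "n \<ge> 1 \<Longrightarrow> (4 * x n ^ 3 + c2 * x n ^ 2 + 2 * c4 * x n + c6) * x (2 * n) =
      x n ^ 4 - c4 * x n ^ 2 - 2 * c6 * x n - c8"
    and W_double: "n \<ge> 1 \<Longrightarrow>
      W (2 * n) ^ 2 = W n ^ 8 * (4 * x n ^ 3 + c2 * x n ^ 2 + 2 * c4 * x n + c6)"
begin

lemma x_neq: "n \<ge> 1 \<Longrightarrow> m > n \<Longrightarrow> x m \<noteq> x n"
  using W_rel[of n m] W_nonzero[of "m + n"] W_nonzero[of "m - n"] by auto

lemma root_prod:
  assumes "n \<ge> 1" "m > n"
  shows "(x m - x n)^2 * (x (m + n) * x (m - n)) =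
    (x m * x n)^2 - c4 * x m * x n - c6 * (x m + x n) - c8"
  using roots[OF assms, of 0] unfolding sum_poly_def by simp

lemma root_sum:
  assumes "n \<ge> 1" "m > n"
  shows "(x m - x n)^2 * (x (m + n) + x (m - n)) =
    2 * x m * x n * (x m + x n) + c2 * x m * x n + c4 * (x m + x n) + c6"
proof -
  have *: "a * (r + s) = b" if "a - b + a * (r * s) = a * ((1 - r) * (1 - s))" for a b r s :: 'a
    using that by algebra
  have "sum_poly c2 c4 c6 c8 1 u w = (u - w)^2 - (2 * u * w * (u + w) + c2 * u * w + c4 * (u + w) + c6)
    + ((u * w)^2 - c4 * u * w - c6 * (u + w) - c8)" for u w
    by (simp add: sum_poly_def)
  from roots[OF assms, of 1, unfolded this, folded root_prod[OF assms]] show ?thesis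
    by (rule *)
qed

definition G :: "nat \<Rightarrow> int" where
  "G n = 2 * v (W n) + vmin (x n)"

text \<open>All coefficients of the quadratic with roots \<open>x (m + n)\<close>,
  \<open>x (m - n)\<close> have degree at most 2 in each of \<open>x m\<close> and
  \<open>x n\<close>, hence valuation at least \<open>\<mu>\<close>. Gauss's lemma turns this into a
  bound on its leading coefficient and roots, and \<open>W_rel\<close> supplies the valuations of
  \<open>W\<close>.\<close>

lemma G_parallelogram_ge:
  assumes "n \<ge> 1" "m > n"
  shows "G (m + n) + G (m - n) \<ge> 2 * G m + 2 * G n"
proof -
  define \<mu> where "\<mu> = 2 * vmin (x m) + 2 * vmin (x n)"
  have mon: "val_ge v \<mu> (c * (x m ^ i * x n ^ j))" if "val_ge v 0 c" "i \<le> 2" "j \<le> 2" for c i j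
    using val_ge_mult_left[OF that(1) val_ge_mult[OF val_ge_pow_vmin[OF that(2)] val_ge_pow_vmin[OF that(3)]]]
    by (simp add: \<mu>_def)
  note m1 = mon[OF val_ge_one] and mn = mon[OF val_ge_numeral]
  have d: "(x m - x n)^2 \<noteq> 0" using x_neq[OF assms] by simp
  have "v ((x m - x n)^2) + vmin (x (m + n)) + vmin (x (m - n)) \<ge> \<mu>"
  proof (rule gauss_quadratic[OF d])
    have "val_ge v \<mu> (1 * (x m ^ 2 * x n ^ 0) - 2 * (x m ^ 1 * x n ^ 1) + 1 * (x m ^ 0 * x n ^ 2))"
      by (intro val_ge_add val_ge_diff m1 mn) auto
    then show "val_ge v \<mu> ((x m - x n)^2)" by (simp add: power2_eq_square algebra_simps)
    have "val_ge v \<mu> (2 * (x m ^ 2 * x n ^ 1) + 2 * (x m ^ 1 * x n ^ 2) + c2 * (x m ^ 1 * x n ^ 1)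
      + c4 * (x m ^ 1 * x n ^ 0) + c4 * (x m ^ 0 * x n ^ 1) + c6 * (x m ^ 0 * x n ^ 0))"
      by (intro val_ge_add mn mon integral) auto
    then show "val_ge v \<mu> ((x m - x n)^2 * (x (m + n) + x (m - n)))"
      unfolding root_sum[OF assms] by (simp add: power2_eq_square algebra_simps)
    have "val_ge v \<mu> (1 * (x m ^ 2 * x n ^ 2) - c4 * (x m ^ 1 * x n ^ 1)
      - c6 * (x m ^ 1 * x n ^ 0) - c6 * (x m ^ 0 * x n ^ 1) - c8 * (x m ^ 0 * x n ^ 0))"
      by (intro val_ge_diff m1 mon integral) auto
    then show "val_ge v \<mu> ((x m - x n)^2 * (x (m + n) * x (m - n)))"
      unfolding root_prod[OF assms] by (simp add: power_mult_distrib algebra_simps)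
  qed
  moreover have "v ((x m - x n)^2) = 2 * v (x n - x m)"
    using x_neq[OF assms] v_minus[of "x m - x n"] by (simp add: v_power)
  moreover have "v (W (m + n)) + v (W (m - n)) = 2 * v (W m) + 2 * v (W n) + v (x n - x m)"
  proof -
    have "v (W (m + n) * W (m - n)) = v ((W m)^2 * (W n)^2 * (x n - x m))"
      using W_rel[OF assms] by simp
    then show ?thesis using W_nonzero assms x_neq[OF assms] by (simp add: v_mult v_power)
  qed
  ultimately show ?thesis by (simp add: G_def \<mu>_def)
qed

definition denom :: "nat \<Rightarrow> 'a" where
  "denom n = 4 * x n ^ 3 + c2 * x n ^ 2 + 2 * c4 * x n + c6"

definition numer :: "nat \<Rightarrow> 'a" where
  "numer n = x n ^ 4 - c4 * x n ^ 2 - 2 * c6 * x n - c8"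

lemma denom_nonzero: "n \<ge> 1 \<Longrightarrow> denom n \<noteq> 0"
  using W_double[of n] W_nonzero[of "2 * n"] by (auto simp: denom_def)

lemma x_double': "n \<ge> 1 \<Longrightarrow> x (2 * n) = numer n / denom n"
  using x_double[of n] denom_nonzero[of n] by (simp add: denom_def numer_def field_simps)

lemma v_D_nonneg: "v D \<ge> 0"
proof -
  have "val_ge v 0 D"
    unfolding D(1) by (intro val_ge_ring integral val_ge_numeral val_ge_minus[THEN iffD2])
  then show ?thesis using D(2) by (simp add: val_ge_def)
qed

lemma integral_2: "val_ge v 0 (2 * c4)" "val_ge v 0 (2 * c6)"
  by (simp_all add: val_ge_mult_left integral)

text \<open>v (denom n) + vmin (x (2n)) is the smaller of the valuations of \<open>denom n\<close>
  and \<open>numer n\<close>. Both have degree at most 4 in \<open>x n\<close>, which gives the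
  lower bound. If \<open>x n\<close> is integral, the discriminant identity gives the upper bound;
  if \<open>x n\<close> has a pole, x^4 dominates the numerator and nothing is lost.\<close>

lemma denom_numer_bound:
  assumes "n \<ge> 1"
  shows "4 * vmin (x n) \<le> v (denom n) + vmin (x (2 * n))"
    and "v (denom n) + vmin (x (2 * n)) \<le> 4 * vmin (x n) + v D"
proof -
  define \<mu> where "\<mu> = 4 * vmin (x n)"
  have mon: "val_ge v \<mu> (c * x n ^ i)" if "val_ge v 0 c" "i \<le> 4" for c i
    using val_ge_mult_left[OF that(1) val_ge_pow_vmin[OF that(2)]] by (simp add: \<mu>_def)
  have f0: "denom n \<noteq> 0" using denom_nonzero assms by simp
  have "val_ge v \<mu> (4 * x n ^ 3 + c2 * x n ^ 2 + (2 * c4) * x n ^ 1 + c6 * x n ^ 0)"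
    by (intro val_ge_add mon integral integral_2 val_ge_numeral) auto
  then have f: "val_ge v \<mu> (denom n)" by (simp add: denom_def)
  have "val_ge v \<mu> (1 * x n ^ 4 - c4 * x n ^ 2 - (2 * c6) * x n ^ 1 - c8 * x n ^ 0)"
    by (intro val_ge_diff mon integral integral_2 val_ge_one) auto
  then have g: "val_ge v \<mu> (numer n)" by (simp add: numer_def)
  have vm: "v (denom n) + vmin (x (2 * n)) = (if numer n = 0 then v (denom n) else min (v (denom n)) (v (numer n)))"
    using f0 by (auto simp: x_double'[OF assms] vmin_def v_divide min_def)
  show "4 * vmin (x n) \<le> v (denom n) + vmin (x (2 * n))"
    using f g f0 unfolding vm by (auto simp: val_ge_def \<mu>_def)
  show "v (denom n) + vmin (x (2 * n)) \<le> 4 * vmin (x n) + v D"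
  proof (cases "val_ge v 0 (x n)")
    case True
    have "\<not> (val_ge v (v D + 1) (denom n) \<and> val_ge v (v D + 1) (numer n))"
    proof
      assume *: "val_ge v (v D + 1) (denom n) \<and> val_ge v (v D + 1) (numer n)"
      have "val_ge v 0 (12 * x n ^ 3 - c2 * x n ^ 2 - 10 * c4 * x n + (c2 * c4 - 27 * c6))"
        "val_ge v 0 (48 * x n ^ 2 + 8 * c2 * x n + (32 * c4 - c2 ^ 2))"
        by (intro val_ge_ring integral val_ge_numeral True)+
      then have "val_ge v (v D + 1) ((12 * x n ^ 3 - c2 * x n ^ 2 - 10 * c4 * x n + (c2 * c4 - 27 * c6)) * denom n
        - (48 * x n ^ 2 + 8 * c2 * x n + (32 * c4 - c2 ^ 2)) * numer n)"
        using * by (intro val_ge_diff val_ge_mult_left[of _ "v D + 1"]) auto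
      then have "val_ge v (v D + 1) D"
        unfolding D(1) discriminant_resultant[OF c8, of "x n"] by (simp add: denom_def numer_def)
      then show False using D(2) by (simp add: val_ge_def)
    qed
    then have "v (denom n) + vmin (x (2 * n)) \<le> v D"
      unfolding vm by (auto simp: val_ge_def)
    then show ?thesis using True by (simp add: vmin_eq_0_iff[symmetric])
  next
    case False
    then have x: "x n \<noteq> 0" "v (x n) < 0" by (auto simp: val_ge_def)
    have mon2: "val_ge v (2 * v (x n)) (c * x n ^ i)" if "val_ge v 0 c" "i \<le> 2" for c i
      using val_ge_mult_left[OF that(1) val_ge_pow_vmin[OF that(2), of "x n"]] x by (simp add: vmin_def)
    have "val_ge v (2 * v (x n)) (c4 * x n ^ 2 + (2 * c6) * x n ^ 1 + c8 * x n ^ 0)"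
      by (intro val_ge_add mon2 integral integral_2) auto
    then have "val_ge v (2 * v (x n)) (numer n - x n ^ 4)"
      using val_ge_diff_commute[of "2 * v (x n)" "numer n" "x n ^ 4"] by (simp add: numer_def algebra_simps)
    moreover have "v (x n ^ 4) < 2 * v (x n)" "x n ^ 4 \<noteq> 0" using x by (simp_all add: v_power)
    ultimately have "numer n \<noteq> 0" "v (numer n) = v (x n ^ 4)"
      using v_eq_of_close[of "x n ^ 4" "2 * v (x n)" "numer n"] by simp_all
    then have "numer n \<noteq> 0" "v (numer n) = 4 * v (x n)"
      using x by (simp_all add: v_power)
    then show ?thesis using x v_D_nonneg unfolding vm by (simp add: vmin_def)
  qed
qed

lemma v_W_double:
  assumes "n \<ge> 1"
  shows "2 * v (W (2 * n)) = 8 * v (W n) + v (denom n)"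
proof -
  have "v (W (2 * n) ^ 2) = v (W n ^ 8 * denom n)" using W_double[OF assms] by (simp add: denom_def)
  then show ?thesis using W_nonzero assms denom_nonzero by (simp add: v_mult v_power)
qed

lemma G_double:
  assumes "n \<ge> 1"
  shows "4 * G n \<le> G (2 * n)" "G (2 * n) \<le> 4 * G n + v D"
  using denom_numer_bound[OF assms] v_W_double[OF assms] by (simp_all add: G_def)

lemma G_parallelogram:
  assumes "n \<ge> 1" "m > n"
  shows "\<bar>G (m + n) + G (m - n) - 2 * G m - 2 * G n\<bar> \<le> v D"
proof -
  have "G (2 * m) + G (2 * n) \<ge> 2 * G (m + n) + 2 * G (m - n)"
  proof -
    have "m + n + (m - n) = 2 * m" "m + n - (m - n) = 2 * n" using assms by auto
    from G_parallelogram_ge[of "m - n" "m + n", unfolded this] show ?thesis using assms by simp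
  qed
  then show ?thesis
    using G_parallelogram_ge[OF assms] G_double(2)[of m] G_double(2)[of n] assms by simp
qed

theorem G_quadratic:
  assumes "\<And>k. \<bar>real_of_int (G (2 ^ k)) - c * (2 ^ k)^2\<bar> \<le> A" "n \<ge> 1"
  shows "\<bar>real_of_int (G n) - c * (real n)^2\<bar> \<le> v D"
proof (rule quasi_quadratic_bound[where G = "\<lambda>n. real_of_int (G n)" and A = A])
  show "\<bar>real_of_int (G (m + n)) + real_of_int (G (m - n)) - 2 * real_of_int (G m) - 2 * real_of_int (G n)\<bar> \<le> real_of_int (v D)" if "n \<ge> 1" "m > n" for m n
    using G_parallelogram[OF that] by linarith
  show "\<bar>real_of_int (G (2 * n)) - 4 * real_of_int (G n)\<bar> \<le> real_of_int (v D)" if "n \<ge> 1" for n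
    using G_double[OF that] by linarith
qed (use assms in auto)

section \<open>Pole orders of the x-coordinates\<close>

definition depth :: "nat \<Rightarrow> int" where
  "depth n = - vmin (x n)"

lemma depth_ge_iff:
  assumes "\<mu> > 0"
  shows "depth n \<ge> \<mu> \<longleftrightarrow> x n \<noteq> 0 \<and> val_ge v \<mu> (1 / x n)"
  using assms v_divide[of 1 "x n"] by (auto simp: depth_def vmin_def val_ge_def)

lemma depth_eq_v:
  assumes "depth n > 0"
  shows "x n \<noteq> 0" "v (1 / x n) = depth n"
  using assms v_divide[of 1 "x n"] by (auto simp: depth_def vmin_def split: if_splits)

lemma unit_add_small:
  assumes "\<mu> > 0" "val_ge v \<mu> z"
  shows "1 + z \<noteq> 0" "v (1 + z) = 0"
  using v_add_eq[of 1 \<mu> z] assms by simp_all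

text \<open>In terms of the formal group parameter z, 1/x is z^2 to leading order, and the
  congruence is the parallelogram law for z^2. Multiplying \<open>root_sum\<close> and
  \<open>root_prod\<close> by a^2 b^2 gives 2(a + b) and 1 up to multiples of ab; the quotients are
  the sum and the product of the inverse roots, and these bound each inverse root.\<close>

lemma inverse_roots:
  assumes mn: "n \<ge> 1" "m > n" and \<mu>: "\<mu> > 0" and m: "depth m \<ge> \<mu>" and n: "depth n \<ge> \<mu>"
  shows "depth (m + n) \<ge> \<mu>" "depth (m - n) \<ge> \<mu>"
    and "val_ge v (2 * \<mu>) (1 / x (m + n) + 1 / x (m - n) - 2 * (1 / x m + 1 / x n))"
proof -
  define a where "a = 1 / x m"
  define b where "b = 1 / x n"
  define r where "r = x (m + n)"
  define s where "s = x (m - n)"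
  have a: "x m \<noteq> 0" "val_ge v \<mu> a" and b: "x n \<noteq> 0" "val_ge v \<mu> b"
    using m n \<mu> by (simp_all add: depth_ge_iff a_def b_def)
  have ab0: "a * x m = 1" "b * x n = 1" using a b by (simp_all add: a_def b_def)
  have "val_ge v (\<mu> + \<mu>) (a * b)" using a b by (intro val_ge_mult)
  then have ab: "val_ge v (2 * \<mu>) (a * b)" by simp
  have a': "val_ge v 0 a" "val_ge v 0 b" using a b \<mu> by (auto intro: val_ge_mono)
  define U' where "U' = (a * b) * (- c4 - c6 * (a + b) - c8 * (a * b))"
  define V' where "V' = (a * b) * (c2 + c4 * (a + b) + c6 * (a * b))"
  have U': "val_ge v (2 * \<mu>) U'"
    unfolding U'_def
    by (intro val_ge_mult_right[OF ab] val_ge_diff val_ge_minus[THEN iffD2] val_ge_mult_left val_ge_add integral a')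
  have V': "val_ge v (2 * \<mu>) V'"
    unfolding V'_def by (intro val_ge_mult_right[OF ab] val_ge_mult_left val_ge_add integral a')
  define U where "U = 1 + U'"
  have U: "U \<noteq> 0" "v U = 0" using unit_add_small[OF _ U'] \<mu> by (simp_all add: U_def)
  have prod: "(b - a)^2 * (r * s) = U"
  proof -
    have "(b - a)^2 * (r * s) = a^2 * b^2 * ((x m - x n)^2 * (r * s))"
      using ab0 by algebra
    also have "\<dots> = U"
      unfolding r_def s_def root_prod[OF mn] U_def U'_def using ab0 by algebra
    finally show ?thesis .
  qed
  have sum: "(b - a)^2 * (r + s) = 2 * (a + b) + V'"
  proof -
    have "(b - a)^2 * (r + s) = a^2 * b^2 * ((x m - x n)^2 * (r + s))"
      using ab0 by algebra
    also have "\<dots> = 2 * (a + b) + V'"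
      unfolding r_def s_def root_sum[OF mn] V'_def using ab0 by algebra
    finally show ?thesis .
  qed
  have rs: "r \<noteq> 0" "s \<noteq> 0" and ba: "(b - a)^2 \<noteq> 0" using prod U by auto
  have prod': "1 / r * (1 / s) = (b - a)^2 / U"
    using rs ba U by (simp add: prod[symmetric] field_simps)
  have "1 / r + 1 / s = (b - a)^2 * (r + s) / U"
    using rs ba by (simp add: prod[symmetric] field_simps)
  then have sum': "1 / r + 1 / s = (2 * (a + b) + V') / U" by (simp add: sum)
  have "val_ge v 0 (2 * (a + b))" by (intro val_ge_mult_left val_ge_add val_ge_numeral a')
  then have "val_ge v (2 * \<mu> - v U) ((V' - 2 * (a + b) * U') / U)"
    by (intro val_ge_divide U val_ge_diff V' val_ge_mult_left[OF _ U'])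
  moreover have "1 / r + 1 / s - 2 * (a + b) = (V' - 2 * (a + b) * U') / U"
    unfolding sum' using U(1) by (simp add: field_simps U_def)
  ultimately show cong: "val_ge v (2 * \<mu>) (1 / x (m + n) + 1 / x (m - n) - 2 * (1 / x m + 1 / x n))"
    using U(2) by (simp add: r_def s_def a_def b_def)
  have "val_ge v \<mu> (1 / r + 1 / s - 2 * (a + b) + 2 * (a + b))"
    using val_ge_mono[OF cong] \<mu>
    by (intro val_ge_add val_ge_mult_left a b val_ge_numeral) (auto simp: r_def s_def a_def b_def)
  then have s1: "val_ge v \<mu> (1 / r + 1 / s)" by simp
  have "val_ge v (int 2 * \<mu>) ((b - a)^2)" using a b by (intro val_ge_power val_ge_diff)
  then have "val_ge v (2 * \<mu> - v U) ((b - a)^2 / U)" using U(1) by (intro val_ge_divide) auto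
  then have p1: "val_ge v (2 * \<mu>) (1 / r * (1 / s))" using prod' U(2) by simp
  have "val_ge v \<mu> (1 / r)" using s1 p1 by (rule val_ge_of_sum_prod)
  moreover have "val_ge v \<mu> (1 / s)"
    using val_ge_of_sum_prod[of \<mu> "1 / s" "1 / r"] s1 p1 by (simp only: add.commute mult.commute)
  ultimately show "depth (m + n) \<ge> \<mu>" "depth (m - n) \<ge> \<mu>"
    using rs \<mu> by (simp_all add: depth_ge_iff r_def s_def)
qed

lemma inverse_double:
  assumes n: "n \<ge> 1" and pos: "depth n > 0"
  shows "depth (2 * n) \<ge> depth n"
    and "val_ge v (2 * depth n) (1 / x (2 * n) - 4 * (1 / x n))"
proof -
  define \<mu> where "\<mu> = depth n"
  define a where "a = 1 / x n"
  have a: "x n \<noteq> 0" "val_ge v \<mu> a" using pos depth_ge_iff[of \<mu> n] by (simp_all add: \<mu>_def a_def)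
  have ax: "a * x n = 1" using a by (simp add: a_def)
  have a': "val_ge v 0 a" using a pos by (auto intro: val_ge_mono simp: \<mu>_def)
  have "val_ge v (\<mu> + \<mu>) (a * a)" using a by (intro val_ge_mult)
  then have aa: "val_ge v (2 * \<mu>) (a * a)" by simp
  define U' where "U' = (a * a) * (- c4 - (2 * c6) * a - c8 * (a * a))"
  define V' where "V' = (a * a) * (c2 + (2 * c4) * a + c6 * (a * a))"
  have U': "val_ge v (2 * \<mu>) U'"
    unfolding U'_def
    by (intro val_ge_mult_right[OF aa] val_ge_diff val_ge_minus[THEN iffD2] integral)
      (use a' integral integral_2 in \<open>auto intro: val_ge_mult_left\<close>)
  have V': "val_ge v (2 * \<mu>) V'"
    unfolding V'_def by (intro val_ge_mult_right[OF aa] val_ge_add integral)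
      (use a' integral integral_2 in \<open>auto intro: val_ge_mult_left\<close>)
  define U where "U = 1 + U'"
  have U: "U \<noteq> 0" "v U = 0" using unit_add_small[OF _ U'] pos by (simp_all add: U_def \<mu>_def)
  have denom: "denom n * a ^ 4 = 4 * a + V'"
    unfolding denom_def V'_def using ax by algebra
  have numer: "numer n * a ^ 4 = U"
    unfolding numer_def U_def U'_def using ax by algebra
  have x2: "1 / x (2 * n) = (4 * a + V') / U" "x (2 * n) \<noteq> 0"
    using denom_nonzero[OF n] U(1) a ax by (auto simp: x_double'[OF n] denom[symmetric] numer[symmetric])
  have "1 / x (2 * n) - 4 * a = (V' - 4 * a * U') / U"
    unfolding x2 using U(1) by (simp add: field_simps U_def)
  moreover have "val_ge v (2 * \<mu> - v U) ((V' - 4 * a * U') / U)"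
    by (intro val_ge_divide U val_ge_diff V' val_ge_mult_left[OF _ U'])
      (use a' in \<open>auto intro: val_ge_mult_left\<close>)
  ultimately have cong: "val_ge v (2 * \<mu>) (1 / x (2 * n) - 4 * a)" using U(2) by simp
  then show "val_ge v (2 * depth n) (1 / x (2 * n) - 4 * (1 / x n))" by (simp add: a_def \<mu>_def)
  have "val_ge v \<mu> (1 / x (2 * n) - 4 * a + 4 * a)"
    using val_ge_mono[OF cong] pos by (intro val_ge_add val_ge_mult_left a val_ge_numeral) (simp add: \<mu>_def)
  then show "depth (2 * n) \<ge> depth n" using pos x2 by (simp add: depth_ge_iff \<mu>_def)
qed

text \<open>The squares satisfy the same three-term rule (j + 1)^2 + (j - 1)^2 = 2 j^2 + 2, and
  every index involved stays at least as deep as n, so the modulus does not deteriorate along the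
  induction.\<close>

lemma inverse_multiple:
  assumes n: "n \<ge> 1" and pos: "depth n > 0" and k: "k \<ge> 1"
  shows "depth (k * n) \<ge> depth n \<and>
    val_ge v (2 * depth n) (1 / x (k * n) - of_nat (k^2) * (1 / x n))"
  using k
proof (induction k rule: less_induct)
  case (less k)
  define P where "P k \<longleftrightarrow> depth (k * n) \<ge> depth n \<and>
    val_ge v (2 * depth n) (1 / x (k * n) - of_nat (k^2) * (1 / x n))" for k
  consider "k = 1" | "k = 2" | j where "k = j + 1" "j \<ge> 2"
    using less.prems that(3)[of "k - 1"] by (cases "k \<le> 2") (auto simp: le_Suc_eq numeral_eq_Suc)
  then have "P k"
  proof cases
    case 1
    then show ?thesis by (simp add: P_def)
  next
    case 2
    then show ?thesis using inverse_double[OF n pos] by (simp add: P_def)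
  next
    case (3 j)
    have IH: "P j" "P (j - 1)" using less.IH[of j] less.IH[of "j - 1"] 3 by (auto simp: P_def)
    have jn: "j * n > n" "j * n + n = k * n" "j * n - n = (j - 1) * n"
      using 3 n by (auto simp: algebra_simps)
    note R = inverse_roots[OF n jn(1) pos, unfolded jn]
    have d: "depth (j * n) \<ge> depth n" using IH by (simp add: P_def)
    define t where "t = 1 / x n"
    have c1: "val_ge v (2 * depth n) (1 / x (k * n) + 1 / x ((j - 1) * n) - 2 * (1 / x (j * n) + t))"
      using R(3)[OF d] by (simp add: t_def)
    have c2: "val_ge v (2 * depth n) (2 * (1 / x (j * n) - of_nat (j^2) * t))"
      using IH by (intro val_ge_mult_left) (simp_all add: P_def t_def)
    have c3: "val_ge v (2 * depth n) (1 / x ((j - 1) * n) - of_nat ((j - 1)^2) * t)"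
      using IH by (simp add: P_def t_def)
    obtain i where i: "j = Suc i" using 3 by (cases j) auto
    have "1 / x (k * n) - of_nat (k^2) * t =
      (1 / x (k * n) + 1 / x ((j - 1) * n) - 2 * (1 / x (j * n) + t))
      + 2 * (1 / x (j * n) - of_nat (j^2) * t)
      - (1 / x ((j - 1) * n) - of_nat ((j - 1)^2) * t)"
      unfolding 3(1) i by (simp add: power2_eq_square algebra_simps)
    also have "val_ge v (2 * depth n) \<dots>" by (rule val_ge_diff[OF val_ge_add[OF c1 c2] c3])
    finally show ?thesis using R(1)[OF d] by (simp add: P_def t_def)
  qed
  then show ?case by (simp add: P_def)
qed

lemma depth_multiple_small:
  assumes "n \<ge> 1" "k \<ge> 1" "depth n > 2 * v (of_nat k)"
  shows "depth (k * n) = depth n + 2 * v (of_nat k)"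
proof -
  have k0: "(of_nat k :: 'a) \<noteq> 0" using assms by simp
  have "v (of_nat k :: 'a) \<ge> 0" using val_ge_of_nat[of k] k0 by (simp add: val_ge_def)
  then have pos: "depth n > 0" using assms by linarith
  have *: "depth (k * n) \<ge> depth n"
    "val_ge v (2 * depth n) (1 / x (k * n) - of_nat (k^2) * (1 / x n))"
    using inverse_multiple[OF assms(1) pos assms(2)] by auto
  have nz: "of_nat (k^2) * (1 / x n) \<noteq> 0" using k0 depth_eq_v(1)[OF pos] by simp
  have "v (of_nat (k^2) * (1 / x n)) = 2 * v (of_nat k :: 'a) + depth n"
    using v_mult[of "of_nat (k^2)" "1 / x n"] nz k0 depth_eq_v[OF pos] by (simp add: v_power)
  moreover from this have "v (1 / x (k * n)) = v (of_nat (k^2) * (1 / x n))"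
    using v_eq_of_close(2)[OF nz *(2)] assms by simp
  moreover have "v (1 / x (k * n)) = depth (k * n)" using * pos by (intro depth_eq_v) simp
  ultimately show ?thesis by simp
qed

text \<open>The congruence alone handles only k with 2 v(k) below the depth. Splitting off one
  factor p at a time keeps within this range, since the depth grows at each step; what remains is
  prime to p and hence a unit.\<close>

lemma depth_multiple:
  assumes p: "prime p" and unit: "\<And>k. \<not> p dvd k \<Longrightarrow> v (of_nat k) = 0"
    and n: "n \<ge> 1" and deep: "depth n > 2 * v (of_nat p)" and k: "k \<ge> 1"
  shows "depth (k * n) = depth n + 2 * v (of_nat k)"
  using n deep k
proof (induction k arbitrary: n rule: less_induct)
  case (less k)
  have p0: "(of_nat p :: 'a) \<noteq> 0" "p \<ge> 1" using p by (simp_all add: prime_gt_0_nat Suc_leI)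
  have vp: "v (of_nat p :: 'a) \<ge> 0" using val_ge_of_nat[of p] p0 by (simp add: val_ge_def)
  show ?case
  proof (cases "p dvd k")
    case False
    then show ?thesis using depth_multiple_small[of n k] unit less.prems vp by simp
  next
    case True
    then obtain j where j: "k = p * j" by blast
    have jk: "j < k" "j \<ge> 1" using j less.prems p prime_gt_1_nat[OF p] by auto
    have pn: "depth (p * n) = depth n + 2 * v (of_nat p)"
      using depth_multiple_small less.prems p0 by blast
    have "depth (j * (p * n)) = depth (p * n) + 2 * v (of_nat j)"
      using less.IH[of j "p * n"] jk pn vp less.prems p0 by simp
    then show ?thesis using pn jk p0 by (simp add: j v_mult mult.assoc mult.left_commute)
  qed
qed

text \<open>By \<open>inverse_roots\<close> the indices of depth at least \<open>\<mu>\<close> are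
  closed under subtraction, so the Euclidean argument for subgroups of the integers applies.\<close>

lemma least_deep_dvd:
  assumes \<mu>: "\<mu> > 0" and n0: "n0 \<ge> 1" "depth n0 \<ge> \<mu>"
    and least: "\<And>i. 1 \<le> i \<Longrightarrow> i < n0 \<Longrightarrow> depth i < \<mu>"
    and n: "n \<ge> 1" "depth n \<ge> \<mu>"
  shows "n0 dvd n"
  using n
proof (induction n rule: less_induct)
  case (less n)
  consider "n < n0" | "n = n0" | "n > n0" by linarith
  then show ?case
  proof cases
    case 1
    then show ?thesis using least less.prems by force
  next
    case 3
    then have "n0 dvd n - n0"
      using less.IH[of "n - n0"] inverse_roots(2)[OF n0(1) 3 \<mu> less.prems(2) n0(2)] n0(1) by simp
    then show ?thesis using 3 by (simp add: dvd_minus_self)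
  qed simp
qed

end

section \<open>Division polynomials and the group law\<close>

lemma b8_relation: "4 * b8 E = b2 E * b6 E - (b4 E)^2"
  unfolding b2_def b4_def b6_def b8_def by algebra

lemma eds_0: "eds E (Affine x y) 0 = 0"
  by (subst eds.simps, subst divpoly.simps) simp

lemma eds_1: "eds E (Affine x y) 1 = 1"
  by (subst eds.simps, subst divpoly.simps) simp

lemma eds_2: "eds E (Affine x y) 2 = 2 * y + a1 E * x + a3 E"
  by (subst eds.simps, subst divpoly.simps) (simp add: Psi2_def)

lemma eds_3: "eds E (Affine x y) 3 = b8 E + 3 * b6 E * x + 3 * b4 E * x^2 + b2 E * x^3 + 3 * x^4"
  by (subst eds.simps, subst divpoly.simps) (simp add: eval_nat_numeral algebra_simps)

lemma eds_4: "eds E (Affine x y) 4 = (2 * y + a1 E * x + a3 E) *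
   (b4 E * b8 E - (b6 E)^2 + (b2 E * b8 E - b4 E * b6 E) * x + 10 * b8 E * x^2 + 10 * b6 E * x^3
      + 5 * b4 E * x^4 + b2 E * x^5 + 2 * x^6)"
proof -
  have "eds E (Affine x y) 4 = (2 * y + a1 E * x + a3 E) *
    poly [:b4 E * b8 E - (b6 E)^2, b2 E * b8 E - b4 E * b6 E,
                     10 * b8 E, 10 * b6 E, 5 * b4 E, b2 E, 2:] x"
    by (subst eds.simps, subst divpoly.simps) (simp add: Psi2_def del: mult_pCons_left mult_pCons_right)
  then show ?thesis by (simp add: eval_nat_numeral algebra_simps)
qed

lemma eds_odd:
  assumes "m \<ge> 2"
  shows "eds E (Affine x y) (2 * m + 1) =
    eds E (Affine x y) (m + 2) * eds E (Affine x y) m ^ 3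
    - eds E (Affine x y) (m - 1) * eds E (Affine x y) (m + 1) ^ 3"
  using divpoly_odd[OF assms, of E] by simp

lemma eds_even:
  fixes x :: "'k::field_char_0"
  assumes "m \<ge> 3"
  shows "eds E (Affine x y) (2 * m) * eds E (Affine x y) 2 =
    eds E (Affine x y) (m - 1) ^ 2 * eds E (Affine x y) m * eds E (Affine x y) (m + 2)
    - eds E (Affine x y) (m - 2) * eds E (Affine x y) m * eds E (Affine x y) (m + 1) ^ 2"
proof -
  have "poly (poly (divpoly E (2 * m) * Psi2 E) [:y:]) x = poly (poly (divpoly E (m - 1) ^ 2 * divpoly E m * divpoly E (m + 2)
      - divpoly E (m - 2) * divpoly E m * divpoly E (m + 1) ^ 2) [:y:]) x"
    by (simp only: divpoly_even[OF assms])
  moreover have "poly (poly (Psi2 E) [:y:]) x = eds E (Affine x y) 2"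
    by (subst eds_2) (simp add: Psi2_def)
  ultimately show ?thesis by simp
qed

declare eds.simps(1) [simp del]

locale curve_point =
  fixes E :: "'k::field_char_0 weierstrass" and x y :: 'k
  assumes on_curve: "on_curve E (Affine x y)"
begin

abbreviation W :: "nat \<Rightarrow> 'k" where
  "W \<equiv> eds E (Affine x y)"

text \<open>The coefficients of the equation after translating the point to \<open>x = 0\<close>.\<close>

definition c2 :: 'k where "c2 = b2 E + 12 * x"
definition c4 :: 'k where "c4 = b4 E + b2 E * x + 6 * x^2"
definition c6 :: 'k where "c6 = b6 E + 2 * b4 E * x + b2 E * x^2 + 4 * x^3"
definition c8 :: 'k where "c8 = b8 E + 3 * b6 E * x + 3 * b4 E * x^2 + b2 E * x^3 + 3 * x^4"

definition \<eta> :: 'k where "\<eta> = 2 * y + a1 E * x + a3 E"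

lemma eta_square: "\<eta>^2 = c6"
  using on_curve unfolding \<eta>_def c6_def b2_def b4_def b6_def on_curve.simps by algebra

sublocale division_sequence c2 c4 c6 c8 W
proof
  show "4 * c8 = c2 * c6 - c4^2"
    unfolding c2_def c4_def c6_def c8_def using b8_relation[of E] by algebra
  show "W 1 = 1" by (rule eds_1)
  show "(W 2)^2 = c6" using eta_square by (simp add: eds_2 \<eta>_def)
  show "W 3 = c8" by (simp add: eds_3 c8_def)
  show "W 4 = W 2 * (c4 * c8 - c6^2)"
  proof -
    have "4 * (b4 E * b8 E - (b6 E)^2 + (b2 E * b8 E - b4 E * b6 E) * x + 10 * b8 E * x^2 + 10 * b6 E * x^3
      + 5 * b4 E * x^4 + b2 E * x^5 + 2 * x^6) = 4 * (c4 * c8 - c6^2)"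
      unfolding c4_def c6_def c8_def using b8_relation[of E] by algebra
    then show ?thesis unfolding eds_4 eds_2 mult_cancel_left by simp
  qed
  show "W (2 * m + 1) = W (m + 2) * W m ^ 3 - W (m - 1) * W (m + 1) ^ 3" if "m \<ge> 2" for m
    using that by (rule eds_odd)
  show "W (2 * m) * W 2 = W (m - 1) ^ 2 * W m * W (m + 2) - W (m - 2) * W m * W (m + 1) ^ 2"
    if "m \<ge> 3" for m
    using that by (rule eds_even)
qed

lemma W_2_eta: "W 2 = \<eta>"
  by (simp add: eds_2 \<eta>_def)

lemma double_point:
  assumes "\<eta> \<noteq> 0"
  obtains x' y' where "ec_mult E 2 (Affine x y) = Affine x' y'" "on_curve E (Affine x' y')"
    "x' * c6 = x^4 - b4 E * x^2 - 2 * b6 E * x - b8 E"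
    "(2 * y' + a1 E * x' + a3 E) * \<eta> = - c4 * (x' - x) - c6"
proof -
  define l where "l = (3 * x^2 + 2 * a2 E * x + a4 E - a1 E * y) / (2 * y + a1 E * x + a3 E)"
  define x' where "x' = l^2 + a1 E * l - a2 E - x - x"
  define y' where "y' = - (l + a1 E) * x' - (y - l * x) - a3 E"
  have l: "l * \<eta> = 3 * x^2 + 2 * a2 E * x + a4 E - a1 E * y"
    using assms by (simp add: l_def \<eta>_def)
  have eq: "y^2 + a1 E * x * y + a3 E * y = x^3 + a2 E * x^2 + a4 E * x + a6 E"
    using on_curve by simp
  have "y + y + a1 E * x + a3 E \<noteq> 0" using assms by (simp add: \<eta>_def)
  then have "ec_mult E 2 (Affine x y) = Affine x' y'"
    by (simp add: numeral_2_eq_2 x'_def y'_def l_def Let_def)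
  moreover have "on_curve E (Affine x' y')"
    using eq l unfolding on_curve.simps \<eta>_def y'_def x'_def by algebra
  moreover have "x' * c6 = x^4 - b4 E * x^2 - 2 * b6 E * x - b8 E"
  proof -
    have "x' * \<eta>^2 = (l * \<eta>)^2 + a1 E * (l * \<eta>) * \<eta> - (a2 E + x + x) * \<eta>^2"
      unfolding x'_def by algebra
    also have "\<dots> = (3 * x^2 + 2 * a2 E * x + a4 E - a1 E * y)^2
        + a1 E * (3 * x^2 + 2 * a2 E * x + a4 E - a1 E * y) * \<eta> - (a2 E + x + x) * \<eta>^2"
      by (simp only: l)
    also have "\<dots> = x^4 - b4 E * x^2 - 2 * b6 E * x - b8 E"
      unfolding \<eta>_def b4_def b6_def b8_def using eq by algebra
    finally show ?thesis by (simp add: eta_square)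
  qed
  moreover have "(2 * y' + a1 E * x' + a3 E) * \<eta> = - c4 * (x' - x) - c6"
  proof -
    have "(2 * y' + a1 E * x' + a3 E) * \<eta> = - (2 * (l * \<eta>) + a1 E * \<eta>) * (x' - x) - \<eta>^2"
      unfolding y'_def \<eta>_def by algebra
    also have "2 * (l * \<eta>) + a1 E * \<eta> = 2 * (3 * x^2 + 2 * a2 E * x + a4 E - a1 E * y) + a1 E * \<eta>"
      by (simp only: l)
    also have "\<dots> = c4"
      unfolding \<eta>_def c4_def b2_def b4_def by algebra
    finally show ?thesis by (simp add: eta_square)
  qed
  ultimately show thesis by (rule that)
qed

lemma translated_cubic:
  "4 * (x + t)^3 + b2 E * (x + t)^2 + 2 * b4 E * (x + t) + b6 E = 4 * t^3 + c2 * t^2 + 2 * c4 * t + c6"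
  unfolding c2_def c4_def c6_def by algebra

lemma translated_quartic:
  "(x + t)^4 - b4 E * (x + t)^2 - 2 * b6 E * (x + t) - b8 E =
    (t^4 - c4 * t^2 - 2 * c6 * t - c8) + x * (4 * t^3 + c2 * t^2 + 2 * c4 * t + c6)"
  unfolding c2_def c4_def c6_def c8_def by algebra

text \<open>The \<open>x\<close>-coordinate of \<open>[n]P\<close> is \<open>x + X n\<close>, and its \<open>y\<close>-coordinate is encoded in the
  value of \<open>2y + a1 x + a3\<close>.\<close>

lemma ec_mult_eq:
  assumes nz: "\<And>i. 1 \<le> i \<Longrightarrow> i < N \<Longrightarrow> W i \<noteq> 0" and n: "n \<ge> 2" "n < N"
  shows "\<exists>y'. ec_mult E n (Affine x y) = Affine (x + X n) y' \<and>
    (2 * y' + a1 E * (x + X n) + a3 E) * \<eta> = 2 * (X n)^2 * X (n - 1) - c4 * X n - c6"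
proof -
  have V: "V i \<noteq> 0" if "1 \<le> i" "i < N" for i
    using V_eq_W[of i] nz that by simp
  have \<eta>: "\<eta> \<noteq> 0" using nz[of 2] n by (simp add: W_2_eta)
  have c6: "c6 \<noteq> 0" using \<eta> eta_square by auto
  show ?thesis using n
  proof (induction n rule: nat_induct_at_least)
    case base
    obtain x' y' where D: "ec_mult E 2 (Affine x y) = Affine x' y'"
      "x' * c6 = x^4 - b4 E * x^2 - 2 * b6 E * x - b8 E"
      "(2 * y' + a1 E * x' + a3 E) * \<eta> = - c4 * (x' - x) - c6"
      using double_point[OF \<eta>] by metis
    have "x' * c6 = - c8 + x * c6" using D(2) translated_quartic[of 0] by simp
    then have x': "x' = x + X 2" using c6 unfolding X_2 by (simp add: field_simps)
    have "X (2 - 1) = 0" using X_1 by simp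
    then show ?case using D x' by auto
  next
    case (Suc n)
    obtain y' where y': "ec_mult E n (Affine x y) = Affine (x + X n) y'"
      "(2 * y' + a1 E * (x + X n) + a3 E) * \<eta> = 2 * (X n)^2 * X (n - 1) - c4 * X n - c6"
      using Suc.IH Suc.prems by auto
    obtain k where k: "n = k + 2" using Suc.hyps by (metis add.commute le_Suc_ex)
    define u where "u = X (k + 2)"
    define u0 where "u0 = X (k + 1)"
    define u1 where "u1 = X (k + 3)"
    have Xnz: "X (i + 2) \<noteq> 0" if "i \<le> k" for i
      using X_nonzero[of N i] V Suc.prems that k by simp
    have u: "u \<noteq> 0" using Xnz[of k] by (simp add: u_def)
    have sum: "u^2 * (u1 + u0) = c4 * u + c6"
      using X_rec[of k] Xnz[of k] by (simp add: u_def u0_def u1_def)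
    have prod: "u^2 * (u1 * u0) = - (c6 * u + c8)"
      using X_prod[of k] c6 Xnz by (simp add: u_def u0_def u1_def)
    define \<eta>' where "\<eta>' = 2 * y' + a1 E * (x + u) + a3 E"
    have \<eta>': "\<eta>' * \<eta> = 2 * u^2 * u0 - c4 * u - c6"
      using y'(2) by (simp add: \<eta>'_def u_def u0_def k)
    have \<eta>'_square: "\<eta>'^2 = 4 * u^3 + c2 * u^2 + 2 * c4 * u + c6"
    proof -
      \<comment> \<open>The origin of the invariant: the product of the two values of 2y + a1 x + a3
        is u^2 (x(Q - P) - x(Q + P)), in coordinates with P at x = 0. It is stated through X(n - 1)
        alone because X(n + 1) is a junk value if X n = 0, which does occur just before the first
        zero.\<close>
      have h: "\<eta>' * \<eta> = u^2 * (u0 - u1)" unfolding \<eta>' using sum by algebra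
      have "\<eta>^2 * \<eta>'^2 = (\<eta>' * \<eta>)^2" by algebra
      also have "\<dots> = (u^2 * (u1 + u0))^2 - 4 * u^2 * (u^2 * (u1 * u0))"
        unfolding h by algebra
      also have "\<dots> = \<eta>^2 * (4 * u^3 + c2 * u^2 + 2 * c4 * u + c6)"
        unfolding sum prod eta_square using c8 by algebra
      finally show ?thesis using \<eta> by simp
    qed
    define l where "l = (y' - y) / u"
    define x3 where "x3 = l^2 + a1 E * l - a2 E - x - (x + u)"
    define y3 where "y3 = - (l + a1 E) * x3 - (y - l * x) - a3 E"
    have "ec_mult E n (Affine x y) = Affine (x + u) y'" using y'(1) by (simp add: u_def k)
    then have add: "ec_mult E (Suc n) (Affine x y) = Affine x3 y3"
      using u by (simp add: Let_def x3_def y3_def l_def)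
    have lu: "(2 * l + a1 E) * u = \<eta>' - \<eta>"
      using u by (simp add: l_def \<eta>'_def \<eta>_def field_simps)
    have "4 * u^2 * x3 = 4 * u^2 * (x + u1)"
    proof -
      have "4 * u^2 * x3 = ((2 * l + a1 E) * u)^2 - (b2 E + 8 * x + 4 * u) * u^2"
        unfolding x3_def b2_def by algebra
      also have "\<dots> = \<eta>'^2 + \<eta>^2 - 2 * (\<eta>' * \<eta>) - (b2 E + 8 * x + 4 * u) * u^2"
        unfolding lu by algebra
      also have "\<dots> = 4 * u^2 * (x + u1)"
        unfolding \<eta>'_square \<eta>' eta_square using sum unfolding c2_def by algebra
      finally show ?thesis .
    qed
    then have x3: "x3 = x + u1" using u by simp
    have "u * ((2 * y3 + a1 E * (x + u1) + a3 E) * \<eta>) = - ((2 * l + a1 E) * u) * \<eta> * u1 - u * \<eta>^2"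
      unfolding y3_def x3 \<eta>_def by algebra
    also have "\<dots> = - (\<eta>' * \<eta>) * u1 + \<eta>^2 * u1 - u * \<eta>^2"
      unfolding lu by algebra
    also have "\<dots> = u * (2 * u1^2 * u - c4 * u1 - c6)"
      unfolding \<eta>' eta_square using sum by algebra
    finally have "(2 * y3 + a1 E * (x + u1) + a3 E) * \<eta> = 2 * u1^2 * u - c4 * u1 - c6"
      using u by simp
    then show ?case using add x3 by (simp add: k u1_def u_def numeral_eq_Suc)
  qed
qed

text \<open>The step relation at the first zero N \<ge> 3 forces X(N - 1) = 0, so [N - 1]P has the
  x-coordinate of P; the invariant for y gives 2y + a1 x + a3 the opposite sign, so [N - 1]P = -P.
  For N = 2 the tangent at P is vertical.\<close>

lemma ec_mult_eq_Infinity: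
  assumes N: "N \<ge> 1" "W N = 0" and nz: "\<And>i. 1 \<le> i \<Longrightarrow> i < N \<Longrightarrow> W i \<noteq> 0"
  shows "ec_mult E N (Affine x y) = Infinity"
proof -
  have "N \<noteq> 1" using N eds_1[of E x y] by auto
  then consider "N = 2" | "N \<ge> 3" using N by linarith
  then show ?thesis
  proof cases
    case 1
    then have "\<eta> = 0" using N by (simp add: W_2_eta)
    then show ?thesis by (simp add: 1 numeral_2_eq_2 \<eta>_def)
  next
    case 2
    then obtain k where k: "N = k + 3" by (metis add.commute le_Suc_ex)
    have \<eta>: "\<eta> \<noteq> 0" using nz[of 2] 2 by (simp add: W_2_eta)
    have V: "V i \<noteq> 0" if "1 \<le> i" "i < N" for i
      using V_eq_W[of i] nz that by simp
    have "V N = 0" using V_eq_W[of N] nz N by simp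
    then have X: "X (k + 2) = 0"
      using V_step[of N k, OF V] V[of "k + 2"] by (simp add: k)
    have "2 \<le> k + 2" "k + 2 < N" by (simp_all add: k)
    from ec_mult_eq[OF nz this] obtain y' where "ec_mult E (k + 2) (Affine x y) = Affine (x + X (k + 2)) y'"
      "(2 * y' + a1 E * (x + X (k + 2)) + a3 E) * \<eta> =
        2 * (X (k + 2))^2 * X (k + 2 - 1) - c4 * X (k + 2) - c6" by blast
    then have y': "ec_mult E (k + 2) (Affine x y) = Affine x y'"
      "(2 * y' + a1 E * x + a3 E) * \<eta> = - c6" unfolding X by simp_all
    have "(2 * y' + a1 E * x + a3 E + \<eta>) * \<eta> = 0"
      using y'(2) eta_square by algebra
    then have "2 * y' + a1 E * x + a3 E + \<eta> = 0" using \<eta> by simp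
    then have "2 * (y + y' + a1 E * x + a3 E) = 0"
      unfolding \<eta>_def by algebra
    then have "y + y' + a1 E * x + a3 E = 0" unfolding mult_eq_0_iff by simp
    then show ?thesis using y'(1) by (simp add: k numeral_eq_Suc)
  qed
qed

end

lemma ec_mult_add_period:
  assumes "ec_mult E N P = Infinity"
  shows "ec_mult E (m + N) P = ec_mult E m P"
  using assms by (induction m) auto

lemma ec_mult_multiple_period:
  assumes "ec_mult E N P = Infinity"
  shows "ec_mult E (j * N) P = Infinity"
proof (induction j)
  case (Suc j)
  then show ?case using ec_mult_add_period[OF assms, of "j * N"] by (simp add: add.commute)
qed simp

locale generic_curve_point = curve_point +
  assumes generic: "n \<ge> 1 \<Longrightarrow> W n \<noteq> 0"
begin

sublocale nondegenerate_division_sequence c2 c4 c6 c8 W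
  by unfold_locales (rule generic)

definition xs :: "nat \<Rightarrow> 'a" where
  "xs n = x + X n"

lemma xs_1: "xs 1 = x"
  using X_1 by (simp add: xs_def)

text \<open>The recurrence for \<open>X\<close> is tied to generic points, whereas this expression
  depends continuously on the point and makes sense wherever \<open>W n\<close> is nonzero.\<close>

lemma xs_eq:
  assumes "n \<ge> 1"
  shows "xs n = x - W (n - 1) * W (n + 1) / (W n)^2"
proof (cases "n = 1")
  case True
  then show ?thesis using xs_1 by (simp add: eds_0)
next
  case False
  then obtain k where k: "n = k + 2" using assms by (metis add.commute le_Suc_ex le_neq_implies_less Suc_leI one_add_one plus_1_eq_Suc)
  have "X (k + 2) = - (W (k + 3) * W (k + 1)) / (W (k + 2))^2"
    unfolding W_step using generic[of "k + 2"] by simp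
  then show ?thesis by (simp add: xs_def k mult.commute numeral_eq_Suc)
qed

lemma xs_double:
  assumes "n \<ge> 1"
  shows "(4 * xs n ^ 3 + b2 E * xs n ^ 2 + 2 * b4 E * xs n + b6 E) * xs (2 * n) =
    xs n ^ 4 - b4 E * xs n ^ 2 - 2 * b6 E * xs n - b8 E"
  unfolding xs_def translated_cubic translated_quartic X_double[OF assms, symmetric]
  by (simp add: algebra_simps)

lemma height_sequence:
  assumes v: "normalized_valuation v"
    and integral: "val_ge v 0 (b2 E)" "val_ge v 0 (b4 E)" "val_ge v 0 (b6 E)" "val_ge v 0 (b8 E)"
    and disc: "disc E \<noteq> 0"
  shows "height_sequence v (b2 E) (b4 E) (b6 E) (b8 E) (disc E) W xs"
proof
  show "normalized_valuation v" by (rule v)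
  show "4 * b8 E = b2 E * b6 E - (b4 E)\<^sup>2" by (rule b8_relation)
  show "disc E = - ((b2 E)\<^sup>2 * b8 E) - 8 * b4 E ^ 3 - 27 * (b6 E)\<^sup>2 + 9 * b2 E * b4 E * b6 E"
    by (rule disc_def)
  show "W n \<noteq> 0" if "1 \<le> n" for n using that by (rule generic)
  show "W (m + n) * W (m - n) = (W m)\<^sup>2 * (W n)\<^sup>2 * (xs n - xs m)" if "1 \<le> n" "n < m" for m n
  proof -
    have "2 * n + (m - n) = m + n" "n + (m - n) = m" using that by auto
    from W_rel[of n "m - n", unfolded this] show ?thesis using that by (simp add: xs_def)
  qed
  show "sum_poly (b2 E) (b4 E) (b6 E) (b8 E) t (xs m) (xs n) =
       (xs m - xs n)\<^sup>2 * ((t - xs (m + n)) * (t - xs (m - n)))" if "1 \<le> n" "n < m" for m n t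
    using F_roots[OF that, of "t - x"] sum_poly_translate[of "b2 E" "b4 E" "b6 E" "b8 E" x "t - x" "X m" "X n"]
    by (simp add: xs_def c2_def c4_def c6_def c8_def diff_diff_eq)
  show "(4 * xs n ^ 3 + b2 E * (xs n)\<^sup>2 + 2 * b4 E * xs n + b6 E) * xs (2 * n) =
       xs n ^ 4 - b4 E * (xs n)\<^sup>2 - 2 * b6 E * xs n - b8 E" if "1 \<le> n" for n
    using that by (rule xs_double)
  show "(W (2 * n))\<^sup>2 = W n ^ 8 * (4 * xs n ^ 3 + b2 E * (xs n)\<^sup>2 + 2 * b4 E * xs n + b6 E)" if "1 \<le> n" for n
    unfolding xs_def translated_cubic using that by (rule W_double)
qed (use integral disc in auto)

end

section \<open>Non-vanishing of the division polynomials\<close>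

text \<open>The coefficient \<open>c\<close> may be 0, so that differences need no case distinction;
  whether leading terms cancel is then decided by the value of \<open>c\<close> alone.\<close>

definition leading :: "nat \<Rightarrow> 'a::idom \<Rightarrow> 'a poly \<Rightarrow> bool" where
  "leading d c p \<longleftrightarrow> degree p \<le> d \<and> coeff p d = c"

lemma leading_mult: "leading d c p \<Longrightarrow> leading d' c' q \<Longrightarrow> leading (d + d') (c * c') (p * q)"
proof -
  assume *: "leading d c p" "leading d' c' q"
  then have "degree (p * q) \<le> d + d'"
    using degree_mult_le[of p q] by (auto simp: leading_def)
  moreover have "coeff (p * q) (d + d') = c * c'"
  proof (cases "degree p = d \<and> degree q = d'")
    case True
    then show ?thesis using * coeff_mult_degree_sum[of p q] by (simp add: leading_def)
  next
    case False
    then have "degree (p * q) < d + d'"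
      using * degree_mult_le[of p q] by (auto simp: leading_def)
    moreover have "c * c' = 0" using * False by (auto simp: leading_def coeff_eq_0 le_less)
    ultimately show ?thesis by (simp add: coeff_eq_0)
  qed
  ultimately show ?thesis by (simp add: leading_def)
qed

lemma leading_power: "leading d c p \<Longrightarrow> leading (n * d) (c ^ n) (p ^ n)"
proof (induction n)
  case (Suc n)
  then show ?case using leading_mult[of d c p "n * d" "c ^ n" "p ^ n"] by simp
qed (simp add: leading_def)

lemma leading_diff: "leading d c p \<Longrightarrow> leading d c' q \<Longrightarrow> leading d (c - c') (p - q)"
  by (auto simp: leading_def intro: degree_diff_le)

text \<open>(n^2 - 1)/2 for odd n and (n^2 - 4)/2 for even n > 0, the latter after removal of the
  factor Psi_2.\<close>

definition dp_degree :: "nat \<Rightarrow> nat" where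
  "dp_degree n = (if odd n then 2 * (n div 2)^2 + 2 * (n div 2)
     else 2 * (n div 2 - 1)^2 + 4 * (n div 2 - 1))"

definition dp_lead :: "nat \<Rightarrow> 'a::field_char_0" where
  "dp_lead n = (if odd n then of_nat n else of_nat n / 2)"

text \<open>On the curve, \<open>\<Psi>\<^sub>n\<close> for odd \<open>n\<close> and \<open>\<Psi>\<^sub>n / \<Psi>\<^sub>2\<close> for even \<open>n\<close> are polynomials in \<open>x\<close>.\<close>

definition represents :: "'k::field_char_0 weierstrass \<Rightarrow> nat \<Rightarrow> 'k poly \<Rightarrow> bool" where
  "represents E n A \<longleftrightarrow> (\<forall>x y. on_curve E (Affine x y) \<longrightarrow> 2 * y + a1 E * x + a3 E \<noteq> 0 \<longrightarrow>
     eds E (Affine x y) n = (if even n then 2 * y + a1 E * x + a3 E else 1) * poly A x)"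

lemma dp_values:
  "dp_degree (2 * i + 1) = 2 * i^2 + 2 * i" "dp_degree (2 * i + 2) = 2 * i^2 + 4 * i"
  "dp_lead (2 * i + 1) = 2 * of_nat i + 1" "dp_lead (2 * i + 2) = of_nat i + 1"
  by (simp_all add: dp_degree_def dp_lead_def field_simps)

text \<open>The parity of m in n = 2m + 1 or n = 2m decides which factors carry 2y + a1 x + a3. In
  the odd recursion its fourth power becomes f^2; in the even one exactly two factors appear, one of
  which is cancelled. The leading coefficients n or n/2 are nonzero in characteristic 0, which is
  the purpose of tracking them.\<close>

lemma division_polynomial_exists:
  fixes E :: "'k::field_char_0 weierstrass"
  assumes "n \<ge> 1"
  shows "\<exists>A. leading (dp_degree n) (dp_lead n) A \<and> represents E n A"
  using assms
proof (induction n rule: less_induct)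
  case (less n)
  define f where "f = [:b6 E, 2 * b4 E, b2 E, 4:]"
  have f: "leading 3 4 f" by (simp add: leading_def f_def numeral_eq_Suc)
  have f_eta: "poly f x = (2 * y + a1 E * x + a3 E)^2" if "on_curve E (Affine x y)" for x y
    using curve_point.eta_square[of E x y] that
    by (simp add: curve_point_def curve_point.\<eta>_def curve_point.c6_def f_def algebra_simps eval_nat_numeral)
  consider "n = 1" | "n = 2" | "n = 3" | "n = 4" | i where "n = 2 * (2 * i + 2) + 1" | i where "n = 2 * (2 * i + 3) + 1"
    | i where "n = 2 * (2 * i + 3)" | i where "n = 2 * (2 * i + 4)"
  proof -
    assume a: "n = 1 \<Longrightarrow> thesis" "n = 2 \<Longrightarrow> thesis" "n = 3 \<Longrightarrow> thesis" "n = 4 \<Longrightarrow> thesis"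
      "\<And>i. n = 2 * (2 * i + 2) + 1 \<Longrightarrow> thesis" "\<And>i. n = 2 * (2 * i + 3) + 1 \<Longrightarrow> thesis"
      "\<And>i. n = 2 * (2 * i + 3) \<Longrightarrow> thesis" "\<And>i. n = 2 * (2 * i + 4) \<Longrightarrow> thesis"
    show thesis
      using less.prems
    proof (cases n rule: small_or_parity)
      case (5 k)
      show thesis
      proof (cases "even k")
        case True
        then obtain i where "k = 2 * i" by (rule evenE)
        then show thesis using a(5)[of i] 5 by simp
      next
        case False
        then obtain i where "k = 2 * i + 1" by (rule oddE)
        then show thesis using a(6)[of i] 5 by simp
      qed
    next
      case (6 k)
      show thesis
      proof (cases "even k")
        case True
        then obtain i where "k = 2 * i" by (rule evenE)
        then show thesis using a(7)[of i] 6 by simp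
      next
        case False
        then obtain i where "k = 2 * i + 1" by (rule oddE)
        then show thesis using a(8)[of i] 6 by simp
      qed
    qed (use a(1-4) in blast)+
  qed
  then show ?case
  proof cases
    case 1
    have "leading (dp_degree n) (dp_lead n) (1 :: 'k poly)" by (simp add: 1 leading_def dp_degree_def dp_lead_def)
    moreover have "represents E n 1" using eds_1[of E] by (simp add: 1 represents_def)
    ultimately show ?thesis by blast
  next
    case 2
    have "leading (dp_degree n) (dp_lead n) (1 :: 'k poly)" by (simp add: 2 leading_def dp_degree_def dp_lead_def)
    moreover have "represents E n 1" using eds_2[of E] by (simp add: 2 represents_def)
    ultimately show ?thesis by blast
  next
    case 3
    have "dp_degree 3 = 4" "dp_lead 3 = (3 :: 'k)" by (simp_all add: dp_degree_def dp_lead_def)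
    then have "leading (dp_degree n) (dp_lead n) [:b8 E, 3 * b6 E, 3 * b4 E, b2 E, 3:]"
      by (simp add: 3 leading_def numeral_eq_Suc)
    moreover have "represents E n [:b8 E, 3 * b6 E, 3 * b4 E, b2 E, 3:]"
    proof -
      have "poly [:b8 E, 3 * b6 E, 3 * b4 E, b2 E, 3:] x = eds E (Affine x y) 3" for x y
        unfolding eds_3 by (simp add: algebra_simps eval_nat_numeral)
      then show ?thesis by (simp add: 3 represents_def)
    qed
    ultimately show ?thesis by blast
  next
    case 4
    define A where "A = [:b4 E * b8 E - (b6 E)^2, b2 E * b8 E - b4 E * b6 E,
                     10 * b8 E, 10 * b6 E, 5 * b4 E, b2 E, 2:]"
    have "dp_degree 4 = 6" "dp_lead 4 = (2 :: 'k)" by (simp_all add: dp_degree_def dp_lead_def)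
    then have "leading (dp_degree n) (dp_lead n) A"
      by (simp add: 4 A_def leading_def numeral_eq_Suc)
    moreover have "represents E n A"
      unfolding represents_def 4
    proof (intro allI impI)
      fix x y
      have "poly A x = b4 E * b8 E - (b6 E)^2 + (b2 E * b8 E - b4 E * b6 E) * x + 10 * b8 E * x^2 + 10 * b6 E * x^3
      + 5 * b4 E * x^4 + b2 E * x^5 + 2 * x^6"
        by (simp add: A_def algebra_simps eval_nat_numeral)
      then show "eds E (Affine x y) 4 = (if even (4::nat) then 2 * y + a1 E * x + a3 E else 1) * poly A x"
        using eds_4[of E x y] by simp
    qed
    ultimately show ?thesis by blast
  next
    case (5 i)
    obtain A B C D where
      A: "leading (2 * (i+1)^2 + 4 * (i+1)) (of_nat (i+1) + 1) A" "represents E (2 * i + 4) A" and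
      B: "leading (2 * i^2 + 4 * i) (of_nat i + 1) B" "represents E (2 * i + 2) B" and
      C: "leading (2 * i^2 + 2 * i) (2 * of_nat i + 1) C" "represents E (2 * i + 1) C" and
      D: "leading (2 * (i+1)^2 + 2 * (i+1)) (2 * of_nat (i+1) + 1) D" "represents E (2 * i + 3) D"
      using less.IH[of "2 * (i+1) + 2"] less.IH[of "2 * i + 2"] less.IH[of "2 * i + 1"] less.IH[of "2 * (i+1) + 1"] 5
      unfolding dp_values by (auto simp: numeral_eq_Suc)
    have L1: "leading (2 * 3 + ((2 * (i+1)^2 + 4 * (i+1)) + 3 * (2 * i^2 + 4 * i)))
      (4^2 * ((of_nat (i+1) + 1) * (of_nat i + 1)^3)) (f^2 * (A * B^3))"
      by (intro leading_mult leading_power f A B)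
    have L2: "leading ((2 * i^2 + 2 * i) + 3 * (2 * (i+1)^2 + 2 * (i+1)))
      ((2 * of_nat i + 1) * (2 * of_nat (i+1) + 1)^3) (C * D^3)"
      by (intro leading_mult leading_power C D)
    have e: "2 * 3 + ((2 * (i+1)^2 + 4 * (i+1)) + 3 * (2 * i^2 + 4 * i)) = 2 * (2 * i + 2)^2 + 2 * (2 * i + 2)"
      "(2 * i^2 + 2 * i) + 3 * (2 * (i+1)^2 + 2 * (i+1)) = 2 * (2 * i + 2)^2 + 2 * (2 * i + 2)"
      by (simp_all add: power2_eq_square algebra_simps)
    have L3: "leading (2 * (2 * i + 2)^2 + 2 * (2 * i + 2))
       (4^2 * ((of_nat (i+1) + 1) * (of_nat i + 1)^3) - (2 * of_nat i + 1) * (2 * of_nat (i+1) + 1)^3)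
       (f^2 * (A * B^3) - C * D^3)"
      by (rule leading_diff[OF L1[unfolded e(1)] L2[unfolded e(2)]])
    \<comment> \<open>With m = 2i + 2 this is (m + 2) m^3 - (m - 1) (m + 1)^3 = 2m + 1: the powers
      of 4 compensate the halves in the even leading coefficients.\<close>
    have e3: "4^2 * ((of_nat (i+1) + 1) * (of_nat i + 1)^3) - (2 * of_nat i + 1) * (2 * of_nat (i+1) + 1)^3
      = (2 * of_nat (2 * i + 2) + 1 :: 'k)" by (simp add: eval_nat_numeral algebra_simps)
    have "leading (dp_degree n) (dp_lead n) (f^2 * (A * B^3) - C * D^3)"
      unfolding 5 dp_values using L3[unfolded e3] .
    moreover have "represents E n (f^2 * (A * B^3) - C * D^3)"
      unfolding represents_def
    proof (intro allI impI)
      fix x y assume on: "on_curve E (Affine x y)" and nz: "2 * y + a1 E * x + a3 E \<noteq> 0"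
      let ?W = "eds E (Affine x y)"
      define h where "h = 2 * y + a1 E * x + a3 E"
      have f: "poly f x = h^2" using f_eta[OF on] by (simp add: h_def)
      have eA: "?W (2 * i + 4) = h * poly A x"
        using A(2) on nz by (simp add: represents_def h_def)
      have eB: "?W (2 * i + 2) = h * poly B x"
        using B(2) on nz by (simp add: represents_def h_def)
      have eC: "?W (2 * i + 1) = poly C x"
        using C(2) on nz by (simp add: represents_def h_def)
      have eD: "?W (2 * i + 3) = poly D x"
        using D(2) on nz by (simp add: represents_def h_def)
      have "?W n = ?W (2 * i + 4) * ?W (2 * i + 2) ^ 3
          - ?W (2 * i + 1) * ?W (2 * i + 3) ^ 3"
        using eds_odd[of "2 * i + 2" E x y] by (simp add: 5 numeral_eq_Suc)
      also have "\<dots> = poly (f^2 * (A * B^3) - C * D^3) x"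
        unfolding eA eB eC eD by (simp add: f power_mult_distrib eval_nat_numeral algebra_simps)
      finally show "?W n = (if even n then 2 * y + a1 E * x + a3 E else 1) * poly (f^2 * (A * B^3) - C * D^3) x"
        using nz by (simp add: 5 h_def)
    qed
    ultimately show ?thesis by blast
  next
    case (6 i)
    obtain A B C D where
      A: "leading (2 * (i+2)^2 + 2 * (i+2)) (2 * of_nat (i+2) + 1) A" "represents E (2 * i + 5) A" and
      B: "leading (2 * (i+1)^2 + 2 * (i+1)) (2 * of_nat (i+1) + 1) B" "represents E (2 * i + 3) B" and
      C: "leading (2 * i^2 + 4 * i) (of_nat i + 1) C" "represents E (2 * i + 2) C" and
      D: "leading (2 * (i+1)^2 + 4 * (i+1)) (of_nat (i+1) + 1) D" "represents E (2 * i + 4) D"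
      using less.IH[of "2 * (i+2) + 1"] less.IH[of "2 * (i+1) + 1"] less.IH[of "2 * i + 2"] less.IH[of "2 * (i+1) + 2"] 6
      unfolding dp_values by (auto simp: numeral_eq_Suc)
    have L1: "leading ((2 * (i+2)^2 + 2 * (i+2)) + 3 * (2 * (i+1)^2 + 2 * (i+1)))
      ((2 * of_nat (i+2) + 1) * (2 * of_nat (i+1) + 1)^3) (A * B^3)"
      by (intro leading_mult leading_power A B)
    have L2: "leading (2 * 3 + ((2 * i^2 + 4 * i) + 3 * (2 * (i+1)^2 + 4 * (i+1))))
      (4^2 * ((of_nat i + 1) * (of_nat (i+1) + 1)^3)) (f^2 * (C * D^3))"
      by (intro leading_mult leading_power f C D)
    have e: "(2 * (i+2)^2 + 2 * (i+2)) + 3 * (2 * (i+1)^2 + 2 * (i+1)) = 2 * (2 * i + 3)^2 + 2 * (2 * i + 3)"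
      "2 * 3 + ((2 * i^2 + 4 * i) + 3 * (2 * (i+1)^2 + 4 * (i+1))) = 2 * (2 * i + 3)^2 + 2 * (2 * i + 3)"
      by (simp_all add: power2_eq_square algebra_simps)
    have L3: "leading (2 * (2 * i + 3)^2 + 2 * (2 * i + 3))
       ((2 * of_nat (i+2) + 1) * (2 * of_nat (i+1) + 1)^3 - 4^2 * ((of_nat i + 1) * (of_nat (i+1) + 1)^3))
       (A * B^3 - f^2 * (C * D^3))"
      by (rule leading_diff[OF L1[unfolded e(1)] L2[unfolded e(2)]])
    have e3: "(2 * of_nat (i+2) + 1) * (2 * of_nat (i+1) + 1)^3 - 4^2 * ((of_nat i + 1) * (of_nat (i+1) + 1)^3)
      = (2 * of_nat (2 * i + 3) + 1 :: 'k)" by (simp add: eval_nat_numeral algebra_simps)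
    have "leading (dp_degree n) (dp_lead n) (A * B^3 - f^2 * (C * D^3))"
      unfolding 6 dp_values using L3[unfolded e3] .
    moreover have "represents E n (A * B^3 - f^2 * (C * D^3))"
      unfolding represents_def
    proof (intro allI impI)
      fix x y assume on: "on_curve E (Affine x y)" and nz: "2 * y + a1 E * x + a3 E \<noteq> 0"
      let ?W = "eds E (Affine x y)"
      define h where "h = 2 * y + a1 E * x + a3 E"
      have f: "poly f x = h^2" using f_eta[OF on] by (simp add: h_def)
      have eA: "?W (2 * i + 5) = poly A x"
        using A(2) on nz by (simp add: represents_def h_def)
      have eB: "?W (2 * i + 3) = poly B x"
        using B(2) on nz by (simp add: represents_def h_def)
      have eC: "?W (2 * i + 2) = h * poly C x"
        using C(2) on nz by (simp add: represents_def h_def)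
      have eD: "?W (2 * i + 4) = h * poly D x"
        using D(2) on nz by (simp add: represents_def h_def)
      have "?W n = ?W (2 * i + 5) * ?W (2 * i + 3) ^ 3
          - ?W (2 * i + 2) * ?W (2 * i + 4) ^ 3"
        using eds_odd[of "2 * i + 3" E x y] by (simp add: 6 numeral_eq_Suc)
      also have "\<dots> = poly (A * B^3 - f^2 * (C * D^3)) x"
        unfolding eA eB eC eD by (simp add: f power_mult_distrib eval_nat_numeral algebra_simps)
      finally show "?W n = (if even n then 2 * y + a1 E * x + a3 E else 1) * poly (A * B^3 - f^2 * (C * D^3)) x"
        using nz by (simp add: 6 h_def)
    qed
    ultimately show ?thesis by blast
  next
    case (7 i)
    obtain A B C D F where
      A: "leading (2 * (i+1)^2 + 2 * (i+1)) (2 * of_nat (i+1) + 1) A" "represents E (2 * i + 3) A" and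
      B: "leading (2 * (i+2)^2 + 2 * (i+2)) (2 * of_nat (i+2) + 1) B" "represents E (2 * i + 5) B" and
      C: "leading (2 * i^2 + 4 * i) (of_nat i + 1) C" "represents E (2 * i + 2) C" and
      D: "leading (2 * i^2 + 2 * i) (2 * of_nat i + 1) D" "represents E (2 * i + 1) D" and
      F: "leading (2 * (i+1)^2 + 4 * (i+1)) (of_nat (i+1) + 1) F" "represents E (2 * i + 4) F"
      using less.IH[of "2 * (i+1) + 1"] less.IH[of "2 * (i+2) + 1"] less.IH[of "2 * i + 2"]
        less.IH[of "2 * i + 1"] less.IH[of "2 * (i+1) + 2"] 7
      unfolding dp_values by (auto simp: numeral_eq_Suc)
    define d where "d = (2 * (i+2)^2 + 2 * (i+2)) + 2 * (2 * i^2 + 4 * i)"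
    have L1: "leading d ((2 * of_nat (i+2) + 1) * (of_nat i + 1)^2) (B * C^2)"
      unfolding d_def by (intro leading_mult leading_power B C)
    have "d = (2 * i^2 + 2 * i) + 2 * (2 * (i+1)^2 + 4 * (i+1))"
      by (simp add: d_def power2_eq_square algebra_simps)
    then have L2: "leading d ((2 * of_nat i + 1) * (of_nat (i+1) + 1)^2) (D * F^2)"
      by (simp only:) (intro leading_mult leading_power D F)
    have L3: "leading ((2 * (i+1)^2 + 2 * (i+1)) + d)
        ((2 * of_nat (i+1) + 1) * ((2 * of_nat (i+2) + 1) * (of_nat i + 1)^2 - (2 * of_nat i + 1) * (of_nat (i+1) + 1)^2))
        (A * (B * C^2 - D * F^2))"
      by (rule leading_mult[OF A(1) leading_diff[OF L1 L2]])
    have e1: "(2 * (i+1)^2 + 2 * (i+1)) + d = 2 * (2 * i + 2)^2 + 4 * (2 * i + 2)"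
      by (simp add: d_def power2_eq_square algebra_simps)
    have e2: "(2 * of_nat (i+1) + 1) * ((2 * of_nat (i+2) + 1) * (of_nat i + 1)^2 - (2 * of_nat i + 1) * (of_nat (i+1) + 1)^2)
      = (of_nat (2 * i + 2) + 1 :: 'k)" by (simp add: eval_nat_numeral algebra_simps)
    have n: "n = 2 * (2 * i + 2) + 2" using 7 by simp
    have "leading (dp_degree n) (dp_lead n) (A * (B * C^2 - D * F^2))"
      unfolding n dp_values using L3[unfolded e1 e2] .
    moreover have "represents E n (A * (B * C^2 - D * F^2))"
      unfolding represents_def
    proof (intro allI impI)
      fix x y assume on: "on_curve E (Affine x y)" and nz: "2 * y + a1 E * x + a3 E \<noteq> 0"
      let ?W = "eds E (Affine x y)"
      define h where "h = 2 * y + a1 E * x + a3 E"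
      have f: "poly f x = h^2" using f_eta[OF on] by (simp add: h_def)
      have eA: "?W (2 * i + 3) = poly A x"
        using A(2) on nz by (simp add: represents_def h_def)
      have eB: "?W (2 * i + 5) = poly B x"
        using B(2) on nz by (simp add: represents_def h_def)
      have eC: "?W (2 * i + 2) = h * poly C x"
        using C(2) on nz by (simp add: represents_def h_def)
      have eD: "?W (2 * i + 1) = poly D x"
        using D(2) on nz by (simp add: represents_def h_def)
      have eF: "?W (2 * i + 4) = h * poly F x"
        using F(2) on nz by (simp add: represents_def h_def)
      have "?W n * h =
          ?W (2 * i + 2) ^ 2 * ?W (2 * i + 3) * ?W (2 * i + 5)
          - ?W (2 * i + 1) * ?W (2 * i + 3) * ?W (2 * i + 4) ^ 2"
        using eds_even[of "2 * i + 3" E x y, unfolded eds_2] by (simp add: 7 h_def numeral_eq_Suc)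
      also have "\<dots> = h * poly (A * (B * C^2 - D * F^2)) x * h"
        unfolding eA eB eC eD eF by (simp add: eval_nat_numeral algebra_simps)
      finally show "?W n = (if even n then 2 * y + a1 E * x + a3 E else 1) * poly (A * (B * C^2 - D * F^2)) x"
        using nz by (simp add: 7 h_def)
    qed
    ultimately show ?thesis by blast
  next
    case (8 i)
    obtain A B C D F where
      A: "leading (2 * (i+1)^2 + 4 * (i+1)) (of_nat (i+1) + 1) A" "represents E (2 * i + 4) A" and
      B: "leading (2 * (i+2)^2 + 4 * (i+2)) (of_nat (i+2) + 1) B" "represents E (2 * i + 6) B" and
      C: "leading (2 * (i+1)^2 + 2 * (i+1)) (2 * of_nat (i+1) + 1) C" "represents E (2 * i + 3) C" and
      D: "leading (2 * i^2 + 4 * i) (of_nat i + 1) D" "represents E (2 * i + 2) D" and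
      F: "leading (2 * (i+2)^2 + 2 * (i+2)) (2 * of_nat (i+2) + 1) F" "represents E (2 * i + 5) F"
      using less.IH[of "2 * (i+1) + 2"] less.IH[of "2 * (i+2) + 2"] less.IH[of "2 * (i+1) + 1"]
        less.IH[of "2 * i + 2"] less.IH[of "2 * (i+2) + 1"] 8
      unfolding dp_values by (auto simp: numeral_eq_Suc)
    define d where "d = (2 * (i+2)^2 + 4 * (i+2)) + 2 * (2 * (i+1)^2 + 2 * (i+1))"
    have L1: "leading d ((of_nat (i+2) + 1) * (2 * of_nat (i+1) + 1)^2) (B * C^2)"
      unfolding d_def by (intro leading_mult leading_power B C)
    have "d = (2 * i^2 + 4 * i) + 2 * (2 * (i+2)^2 + 2 * (i+2))"
      by (simp add: d_def power2_eq_square algebra_simps)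
    then have L2: "leading d ((of_nat i + 1) * (2 * of_nat (i+2) + 1)^2) (D * F^2)"
      by (simp only:) (intro leading_mult leading_power D F)
    have L3: "leading ((2 * (i+1)^2 + 4 * (i+1)) + d)
        ((of_nat (i+1) + 1) * ((of_nat (i+2) + 1) * (2 * of_nat (i+1) + 1)^2 - (of_nat i + 1) * (2 * of_nat (i+2) + 1)^2))
        (A * (B * C^2 - D * F^2))"
      by (rule leading_mult[OF A(1) leading_diff[OF L1 L2]])
    have e1: "(2 * (i+1)^2 + 4 * (i+1)) + d = 2 * (2 * i + 3)^2 + 4 * (2 * i + 3)"
      by (simp add: d_def power2_eq_square algebra_simps)
    have e2: "(of_nat (i+1) + 1) * ((of_nat (i+2) + 1) * (2 * of_nat (i+1) + 1)^2 - (of_nat i + 1) * (2 * of_nat (i+2) + 1)^2)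
      = (of_nat (2 * i + 3) + 1 :: 'k)" by (simp add: eval_nat_numeral algebra_simps)
    have n: "n = 2 * (2 * i + 3) + 2" using 8 by simp
    have "leading (dp_degree n) (dp_lead n) (A * (B * C^2 - D * F^2))"
      unfolding n dp_values using L3[unfolded e1 e2] .
    moreover have "represents E n (A * (B * C^2 - D * F^2))"
      unfolding represents_def
    proof (intro allI impI)
      fix x y assume on: "on_curve E (Affine x y)" and nz: "2 * y + a1 E * x + a3 E \<noteq> 0"
      let ?W = "eds E (Affine x y)"
      define h where "h = 2 * y + a1 E * x + a3 E"
      have f: "poly f x = h^2" using f_eta[OF on] by (simp add: h_def)
      have eA: "?W (2 * i + 4) = h * poly A x"
        using A(2) on nz by (simp add: represents_def h_def)
      have eB: "?W (2 * i + 6) = h * poly B x"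
        using B(2) on nz by (simp add: represents_def h_def)
      have eC: "?W (2 * i + 3) = poly C x"
        using C(2) on nz by (simp add: represents_def h_def)
      have eD: "?W (2 * i + 2) = h * poly D x"
        using D(2) on nz by (simp add: represents_def h_def)
      have eF: "?W (2 * i + 5) = poly F x"
        using F(2) on nz by (simp add: represents_def h_def)
      have "?W n * h =
          ?W (2 * i + 3) ^ 2 * ?W (2 * i + 4) * ?W (2 * i + 6)
          - ?W (2 * i + 2) * ?W (2 * i + 4) * ?W (2 * i + 5) ^ 2"
        using eds_even[of "2 * i + 4" E x y, unfolded eds_2] by (simp add: 8 h_def numeral_eq_Suc)
      also have "\<dots> = h * poly (A * (B * C^2 - D * F^2)) x * h"
        unfolding eA eB eC eD eF by (simp add: eval_nat_numeral algebra_simps)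
      finally show "?W n = (if even n then 2 * y + a1 E * x + a3 E else 1) * poly (A * (B * C^2 - D * F^2)) x"
        using nz by (simp add: 8 h_def)
    qed
    ultimately show ?thesis by blast
  qed
qed

lemma countable_degenerate:
  fixes E :: "'k::field_char_0 weierstrass"
  shows "countable {x. \<exists>y n. on_curve E (Affine x y) \<and> n \<ge> 1 \<and> eds E (Affine x y) n = 0}"
proof -
  have "\<forall>n. \<exists>A. n \<ge> 1 \<longrightarrow> leading (dp_degree n) (dp_lead n) A \<and> represents E n A"
    using division_polynomial_exists by blast
  from choice[OF this] obtain A where
    A: "\<And>n. n \<ge> 1 \<Longrightarrow> leading (dp_degree n) (dp_lead n) (A n) \<and> represents E n (A n)" by blast
  have nz: "A n \<noteq> 0" if "n \<ge> 1" for n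
    using A[OF that] that by (auto simp: leading_def dp_lead_def split: if_splits)
  define f where "f = [:b6 E, 2 * b4 E, b2 E, 4:]"
  have f_eta: "poly f x = (2 * y + a1 E * x + a3 E)^2" if "on_curve E (Affine x y)" for x y
    using curve_point.eta_square[of E x y] that
    by (simp add: curve_point_def curve_point.\<eta>_def curve_point.c6_def f_def algebra_simps eval_nat_numeral)
  have "{x. \<exists>y n. on_curve E (Affine x y) \<and> n \<ge> 1 \<and> eds E (Affine x y) n = 0}
    \<subseteq> {x. poly f x = 0} \<union> (\<Union>n\<in>{1..}. {x. poly (A n) x = 0})"
  proof
    fix x assume "x \<in> {x. \<exists>y n. on_curve E (Affine x y) \<and> n \<ge> 1 \<and> eds E (Affine x y) n = 0}"
    then obtain y n where xy: "on_curve E (Affine x y)" "n \<ge> 1" "eds E (Affine x y) n = 0" by blast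
    show "x \<in> {x. poly f x = 0} \<union> (\<Union>n\<in>{1..}. {x. poly (A n) x = 0})"
    proof (cases "2 * y + a1 E * x + a3 E = 0")
      case True
      then show ?thesis using f_eta[OF xy(1)] by simp
    next
      case False
      then have "poly (A n) x = 0" using A[OF xy(2)] xy by (auto simp: represents_def split: if_splits)
      then show ?thesis using xy(2) by auto
    qed
  qed
  moreover have "countable ({x. poly f x = 0} \<union> (\<Union>n\<in>{1..}. {x. poly (A n) x = 0}))"
    by (intro countable_Un countable_UN countable_finite poly_roots_finite countableI_type) (use nz in \<open>auto simp: f_def\<close>)
  ultimately show ?thesis by (rule countable_subset)
qed

section \<open>Density of generic points\<close>

locale local_curve = padic_extension v w p \<iota> e B
  for v :: "'k::field_char_0 \<Rightarrow> int" and w :: "'q::field_char_0 \<Rightarrow> int"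
    and p :: nat and \<iota> :: "'q \<Rightarrow> 'k" and e :: int and B :: "'k set" +
  fixes E :: "'k weierstrass"
  assumes weierstrass: "integral_weierstrass v E" and disc: "disc E \<noteq> 0"
begin

lemma a_integral: "val_ge v 0 (a1 E)" "val_ge v 0 (a2 E)" "val_ge v 0 (a3 E)"
    "val_ge v 0 (a4 E)" "val_ge v 0 (a6 E)"
  using weierstrass by (simp_all add: integral_weierstrass_def valuation_ring_def)

lemma b_integral: "val_ge v 0 (b2 E)" "val_ge v 0 (b4 E)" "val_ge v 0 (b6 E)" "val_ge v 0 (b8 E)"
  unfolding b2_def b4_def b6_def b8_def
  by (intro val_ge_ring a_integral val_ge_numeral)+

lemma ln_card_pos: "ln (real (residue_card v)) > 0"
  using residue_card_ge_2 by (intro ln_gt_zero) simp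

lemma ln_vabs: "x \<noteq> 0 \<Longrightarrow> ln (vabs v x) = - real_of_int (v x) * ln (real (residue_card v))"
  using residue_card_ge_2 by (simp add: vabs_nonzero ln_powr)

text \<open>If both partial derivatives vanished, c4, c6 and then c8 would be 0. Numerator and
  denominator of the duplication formula would have a common zero, against the Bezout identity for
  the discriminant.\<close>

lemma nonsingular:
  assumes on: "on_curve E (Affine x y)" and \<eta>: "2 * y + a1 E * x + a3 E = 0"
  shows "3 * x^2 + 2 * a2 E * x + a4 E - a1 E * y \<noteq> 0"
proof
  assume *: "3 * x^2 + 2 * a2 E * x + a4 E - a1 E * y = 0"
  have eq: "y^2 + a1 E * x * y + a3 E * y = x^3 + a2 E * x^2 + a4 E * x + a6 E"
    using on by simp
  interpret curve_point E x y by unfold_locales (rule on)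
  have c6: "c6 = 0" using \<eta> by (simp add: eta_square[symmetric] \<eta>_def)
  have c4: "c4 = 0"
    using * \<eta> unfolding c4_def b4_def b2_def by algebra
  have "4 * c8 = 0" using c8 c6 c4 by simp
  then have "c8 = 0" by simp
  have "disc E = (12 * x ^ 3 - b2 E * x ^ 2 - 10 * b4 E * x + (b2 E * b4 E - 27 * b6 E)) * c6
    - (48 * x ^ 2 + 8 * b2 E * x + (32 * b4 E - b2 E ^ 2)) * (x * c6 - c8)"
    unfolding disc_def discriminant_resultant[OF b8_relation, of E x]
    using translated_cubic[of 0] translated_quartic[of 0] by simp
  then show False using disc c6 \<open>c8 = 0\<close> by simp
qed

text \<open>An implicit function argument: one coordinate is chosen off a countable set, the other
  is found by Hensel's lemma, in the direction of a nonzero partial derivative. When x is solved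
  for, y has to avoid the second coordinates of all bad points, finitely many above each bad x. In
  \<open>K\<close>, 2 v(c) + 1 meets Hensel's condition and |M| keeps the root close.\<close>

lemma dense:
  assumes on: "on_curve E (Affine x0 y0)" and int: "val_ge v 0 x0" "val_ge v 0 y0"
  obtains x y where "generic_curve_point E x y" "val_ge v M (x - x0)" "val_ge v M (y - y0)"
proof -
  define S where "S = {x. \<exists>y n. on_curve E (Affine x y) \<and> n \<ge> 1 \<and> eds E (Affine x y) n = 0}"
  have S: "countable S" unfolding S_def by (rule countable_degenerate)
  define F where "F x y = x^3 + a2 E * x^2 + a4 E * x + a6 E - (y^2 + a1 E * x * y + a3 E * y)" for x y
  have F: "on_curve E (Affine x y) \<longleftrightarrow> F x y = 0" for x y by (auto simp: F_def)
  have "\<exists>x y. on_curve E (Affine x y) \<and> x \<notin> S \<and> val_ge v M (x - x0) \<and> val_ge v M (y - y0)"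
  proof (cases "2 * y0 + a1 E * x0 + a3 E = 0")
    case False
    define c where "c = 2 * y0 + a1 E * x0 + a3 E"
    have c: "c \<noteq> 0" "val_ge v 0 c"
      using False a_integral int by (auto simp: c_def intro!: val_ge_add val_ge_mult_left)
    then have vc: "v c \<ge> 0" by (simp add: val_ge_def)
    define K where "K = \<bar>M\<bar> + 2 * v c + 1"
    have K: "K > 2 * v c" "K > v c" "K \<ge> M" "K - v c \<ge> M" "K \<ge> 0" using vc by (auto simp: K_def)
    obtain x where x: "x \<notin> S" "val_ge v K (x - x0)" using avoid_countable[OF S] by blast
    have x': "val_ge v K (x0 - x)" using x(2) by (subst val_ge_diff_commute)
    have xint: "val_ge v 0 x" using val_ge_add[OF val_ge_mono[OF x(2) K(5)] int(1)] by simp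
    define c' where "c' = 2 * y0 + a1 E * x + a3 E"
    have "c' - c = a1 E * (x - x0)" by (simp add: c_def c'_def algebra_simps)
    then have "val_ge v K (c' - c)" using x a_integral by (simp add: val_ge_mult_left)
    then have c': "c' \<noteq> 0" "v c' = v c" by (rule v_eq_of_close[OF c(1) _ K(2)])+
    have "- F x y0 = F x0 y0 - F x y0" using on F by simp
    also have "\<dots> = (x0 - x) * ((x * x + x * x0 + x0 * x0) + a2 E * (x + x0) + a4 E - a1 E * y0)"
      by (simp add: F_def power2_eq_square power3_eq_cube algebra_simps)
    also have "val_ge v K \<dots>"
      using x' xint int a_integral
      by (intro val_ge_mult_right[OF x'] val_ge_add val_ge_diff val_ge_mult_left) auto
    finally have Fx: "val_ge v K (- F x y0)" .
    obtain z where z: "0 * z^3 + 1 * z^2 + c' * z + - F x y0 = 0" "val_ge v (K - v c') z"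
      by (rule hensel_cubic[of 0 1 c' K "- F x y0"]) (use c' Fx K vc in simp_all)
    have "F x (y0 + z) = F x y0 - z^2 - c' * z"
      by (simp add: F_def c'_def power2_eq_square algebra_simps)
    also have "\<dots> = 0" using z(1) by algebra
    finally have "on_curve E (Affine x (y0 + z))" by (simp only: F)
    moreover have "val_ge v M (y0 + z - y0)" using val_ge_mono[OF z(2)] c' K by simp
    moreover have "val_ge v M (x - x0)" using val_ge_mono[OF x(2)] K by simp
    ultimately show ?thesis using x(1) by blast
  next
    case True
    define c where "c = 3 * x0^2 + 2 * a2 E * x0 + a4 E - a1 E * y0"
    have c: "c \<noteq> 0" using nonsingular[OF on True] by (simp add: c_def)
    moreover have "val_ge v 0 c"
      unfolding c_def by (intro val_ge_ring a_integral int val_ge_numeral)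
    ultimately have vc: "v c \<ge> 0" by (simp add: val_ge_def)
    define S' where "S' = (\<Union>x\<in>S. {y. on_curve E (Affine x y)})"
    have fin: "finite {y. on_curve E (Affine x y)}" for x
    proof -
      define q where "q = [:- (x^3 + a2 E * x^2 + a4 E * x + a6 E), a1 E * x + a3 E, 1:]"
      have "poly q y = - F x y" for y
        by (simp add: q_def F_def power2_eq_square algebra_simps)
      then have "{y. on_curve E (Affine x y)} = {y. poly q y = 0}" by (simp only: F neg_equal_0_iff_equal)
      moreover have "q \<noteq> 0" by (simp add: q_def)
      ultimately show ?thesis using poly_roots_finite by simp
    qed
    have S': "countable S'"
      unfolding S'_def by (rule countable_UN[OF S countable_finite[OF fin]])
    define K where "K = \<bar>M\<bar> + 2 * v c + 1"
    have K: "K > 2 * v c" "K > v c" "K \<ge> M" "K - v c \<ge> M" "K \<ge> 0" using vc by (auto simp: K_def)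
    obtain y where y: "y \<notin> S'" "val_ge v K (y - y0)" using avoid_countable[OF S'] by blast
    have y': "val_ge v K (y0 - y)" using y(2) by (subst val_ge_diff_commute)
    have yint: "val_ge v 0 y" using val_ge_add[OF val_ge_mono[OF y(2) K(5)] int(2)] by simp
    define c' where "c' = 3 * x0^2 + 2 * a2 E * x0 + a4 E - a1 E * y"
    have "c' - c = a1 E * (y0 - y)" by (simp add: c_def c'_def algebra_simps)
    then have "val_ge v K (c' - c)" using y' a_integral by (simp add: val_ge_mult_left)
    then have c': "c' \<noteq> 0" "v c' = v c" by (rule v_eq_of_close[OF c(1) _ K(2)])+
    have "F x0 y = F x0 y - F x0 y0" using on F by simp
    also have "\<dots> = (y0 - y) * (y + y0 + a1 E * x0 + a3 E)"
      by (simp add: F_def power2_eq_square algebra_simps)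
    also have "val_ge v K \<dots>"
      using y' yint int a_integral
      by (intro val_ge_mult_right[OF y'] val_ge_add val_ge_mult_left) auto
    finally have Fy: "val_ge v K (F x0 y)" .
    have b: "val_ge v 0 (3 * x0 + a2 E)" using int a_integral by (intro val_ge_add val_ge_mult_left) auto
    obtain z where z: "1 * z^3 + (3 * x0 + a2 E) * z^2 + c' * z + F x0 y = 0" "val_ge v (K - v c') z"
      by (rule hensel_cubic[of 1 "3 * x0 + a2 E" c' K "F x0 y"]) (use b c' Fy K vc in simp_all)
    have "F (x0 + z) y = z^3 + (3 * x0 + a2 E) * z^2 + c' * z + F x0 y"
      by (simp add: F_def c'_def power2_eq_square power3_eq_cube algebra_simps)
    then have "F (x0 + z) y = 0" using z(1) by simp
    then have on': "on_curve E (Affine (x0 + z) y)" by (simp only: F)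
    then have "x0 + z \<notin> S" using y(1) by (auto simp: S'_def)
    moreover have "val_ge v M (x0 + z - x0)" using val_ge_mono[OF z(2)] c' K by simp
    moreover have "val_ge v M (y - y0)" using val_ge_mono[OF y(2)] K by simp
    ultimately show ?thesis using on' by blast
  qed
  then obtain x y where "on_curve E (Affine x y)" "x \<notin> S" "val_ge v M (x - x0)" "val_ge v M (y - y0)"
    by blast
  then show thesis
    by (intro that[of x y] generic_curve_point.intro curve_point.intro generic_curve_point_axioms.intro)
      (auto simp only: S_def mem_Collect_eq)
qed

lemma approximation:
  assumes "on_curve E (Affine x0 y0)" "val_ge v 0 x0" "val_ge v 0 y0"
  obtains s t where "\<And>j. generic_curve_point E (s j) (t j)" "tends s x0" "tends t y0"
proof -
  have "\<forall>j. \<exists>z. generic_curve_point E (fst z) (snd z) \<and>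
    val_ge v (int j) (fst z - x0) \<and> val_ge v (int j) (snd z - y0)"
  proof
    fix j
    obtain x y where "generic_curve_point E x y" "val_ge v (int j) (x - x0)" "val_ge v (int j) (y - y0)"
      using dense[OF assms] by blast
    then show "\<exists>z. generic_curve_point E (fst z) (snd z) \<and>
      val_ge v (int j) (fst z - x0) \<and> val_ge v (int j) (snd z - y0)"
      by (intro exI[of _ "(x, y)"]) simp
  qed
  from choice[OF this] obtain z where z: "\<And>j. generic_curve_point E (fst (z j)) (snd (z j)) \<and>
    val_ge v (int j) (fst (z j) - x0) \<and> val_ge v (int j) (snd (z j) - y0)" by blast
  have lim: "tends s l" if "\<And>j. val_ge v (int j) (s j - l)" for s l
    unfolding tends_def
  proof
    fix M
    have "val_ge v M (s n - l)" if "n \<ge> nat M" for n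
      using \<open>\<And>j. val_ge v (int j) (s j - l)\<close>[of n] by (rule val_ge_mono) (use that in simp)
    then show "\<exists>k. \<forall>n\<ge>k. val_ge v M (s n - l)" by blast
  qed
  show thesis
  proof (rule that)
    show "generic_curve_point E (fst (z j)) (snd (z j))" for j using z by blast
    show "tends (\<lambda>j. fst (z j)) x0" by (rule lim) (use z in blast)
    show "tends (\<lambda>j. snd (z j)) y0" by (rule lim) (use z in blast)
  qed
qed

section \<open>Comparison with the Neron height\<close>

lemma pole_orders:
  assumes on: "on_curve E (Affine x y)" and x: "x \<noteq> 0" "v x < 0"
  shows "y \<noteq> 0" "2 * v y = 3 * v x"
proof -
  have eq: "y^2 + a1 E * x * y + a3 E * y = x^3 + a2 E * x^2 + a4 E * x + a6 E"
    using on by simp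
  have xm: "val_ge v (v x) x" "val_ge v (2 * v x) (x^2)"
    using val_ge_v[of x] val_ge_power[OF val_ge_v[of x], of 2] by simp_all
  have "val_ge v (2 * v x) (a2 E * x^2 + a4 E * x + a6 E)"
    using a_integral xm x
    by (intro val_ge_add val_ge_mult_left) (auto intro: val_ge_mono)
  then have rhs: "x^3 + (a2 E * x^2 + a4 E * x + a6 E) \<noteq> 0"
    "v (x^3 + (a2 E * x^2 + a4 E * x + a6 E)) = 3 * v x"
    using v_add_eq[of "x^3" "2 * v x"] x by (simp_all add: v_power)
  have not: "\<not> val_ge v (v x) y"
  proof
    assume y: "val_ge v (v x) y"
    have "val_ge v (v x + v x) (y * y + a1 E * x * y)"
      using y xm a_integral by (intro val_ge_add val_ge_mult val_ge_mult_left)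
    moreover have "val_ge v (v x + v x) (a3 E * y)"
      using y a_integral x by (intro val_ge_mult_left) (auto intro: val_ge_mono)
    ultimately have "val_ge v (v x + v x) (y * y + a1 E * x * y + a3 E * y)" by (rule val_ge_add)
    then have "val_ge v (v x + v x) (x^3 + (a2 E * x^2 + a4 E * x + a6 E))"
      using eq by (simp add: power2_eq_square add.assoc)
    then show False using rhs x by (simp add: val_ge_def)
  qed
  then show y: "y \<noteq> 0" by (auto simp: val_ge_def)
  have vy: "v y < v x" using not y by (auto simp: val_ge_def)
  have "val_ge v (v x) (a1 E * x + a3 E)"
    using a_integral xm x by (intro val_ge_add val_ge_mult_left) (auto intro: val_ge_mono)
  then have "val_ge v (v x + v y) ((a1 E * x + a3 E) * y)" using val_ge_v by (rule val_ge_mult)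
  then have "v (y^2 + (a1 E * x + a3 E) * y) = 2 * v y"
    using v_add_eq(2)[of "y^2" "v x + v y" "(a1 E * x + a3 E) * y"] y vy by (simp add: v_power)
  then show "2 * v y = 3 * v x" using rhs(2) eq by (simp add: algebra_simps)
qed

lemma pole_of_y_pole:
  assumes on: "on_curve E (Affine x y)" and y: "y \<noteq> 0" "v y < 0"
  shows "x \<noteq> 0" "v x < 0"
proof -
  have "\<not> val_ge v 0 x"
  proof
    assume x: "val_ge v 0 x"
    have "y^2 + (a1 E * x + a3 E) * y = x^3 + a2 E * x^2 + a4 E * x + a6 E"
      using on by (simp add: algebra_simps)
    moreover have "val_ge v 0 (x^3 + a2 E * x^2 + a4 E * x + a6 E)"
      by (intro val_ge_ring a_integral x)
    ultimately have int: "val_ge v 0 (y^2 + (a1 E * x + a3 E) * y)" by simp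
    have "val_ge v (v y) ((a1 E * x + a3 E) * y)"
      by (intro val_ge_mult_left val_ge_add a_integral x val_ge_v)
    then have "y^2 + (a1 E * x + a3 E) * y \<noteq> 0" "v (y^2 + (a1 E * x + a3 E) * y) = 2 * v y"
      using v_add_eq[of "y^2" "v y" "(a1 E * x + a3 E) * y"] y by (simp_all add: v_power)
    then show False using int y by (simp add: val_ge_def)
  qed
  then show "x \<noteq> 0" "v x < 0" by (auto simp: val_ge_def)
qed

text \<open>If X and Z were both in the maximal ideal, the third partial derivative would reduce to
  Y^2, a unit for primitive coordinates. So P does not reduce to infinity, and since x and y have
  poles only together, both are integral.\<close>

lemma singular_reduction_integral:
  assumes P: "P \<in> points E" and sing: "singular_reduction v E P"
  obtains x y where "P = Affine x y" "val_ge v 0 x" "val_ge v 0 y"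
proof -
  obtain X Y Z where h: "homogeneous P X Y Z" and int: "val_ge v 0 X" "val_ge v 0 Y" "val_ge v 0 Z"
    and prim: "\<not> (val_ge v 1 X \<and> val_ge v 1 Y \<and> val_ge v 1 Z)"
    and d: "val_ge v 1 (Y^2 + a1 E * X * Y + 2 * a3 E * Y * Z - a2 E * X^2 - 2 * a4 E * X * Z - 3 * a6 E * Z^2)"
    using sing unfolding singular_reduction_def valuation_ring_def maximal_ideal_def by auto
  have *: False if X: "val_ge v 1 X" and Z: "val_ge v 1 Z"
  proof -
    have "val_ge v 1 (Z * (2 * a3 E * Y - 2 * a4 E * X - 3 * a6 E * Z) + X * (a1 E * Y - a2 E * X))"
      using X Z a_integral int by (intro val_ge_add val_ge_mult_right val_ge_diff val_ge_mult_left val_ge_numeral) auto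
    from val_ge_diff[OF d this] have "val_ge v 1 (Y^2 + a1 E * X * Y + 2 * a3 E * Y * Z - a2 E * X^2 - 2 * a4 E * X * Z - 3 * a6 E * Z^2
       - (Z * (2 * a3 E * Y - 2 * a4 E * X - 3 * a6 E * Z) + X * (a1 E * Y - a2 E * X)))" .
    then have "val_ge v 1 (Y^2)" by (simp add: power2_eq_square algebra_simps)
    then have "val_ge v 1 Y" by (cases "Y = 0") (auto simp: val_ge_def v_power)
    then show False using prim X Z by blast
  qed
  show thesis
  proof (cases P)
    case Infinity
    then show thesis using * h by simp
  next
    case (Affine x y)
    then have Z: "Z \<noteq> 0" "X = x * Z" "Y = y * Z" using h by auto
    have on: "on_curve E (Affine x y)" using P Affine by (simp add: points_def)
    have xint: "val_ge v 0 x"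
    proof (rule ccontr)
      assume "\<not> val_ge v 0 x"
      then have x: "x \<noteq> 0" "v x < 0" by (auto simp: val_ge_def)
      have y: "y \<noteq> 0" "2 * v y = 3 * v x" using pole_orders[OF on x] by auto
      have "v y + v Z \<ge> 0" using int(2) y Z by (simp add: val_ge_def v_mult)
      then have "val_ge v 1 X" "val_ge v 1 Z" using x y Z by (simp_all add: val_ge_def v_mult)
      then show False by (rule *)
    qed
    have yint: "val_ge v 0 y"
    proof (rule ccontr)
      assume "\<not> val_ge v 0 y"
      then have "y \<noteq> 0" "v y < 0" by (auto simp: val_ge_def)
      then have "x \<noteq> 0" "v x < 0" by (rule pole_of_y_pole[OF on])+
      then show False using xint by (simp add: val_ge_def)
    qed
    show thesis by (rule that[OF Affine xint yint])
  qed
qed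

definition pole_set :: "int \<Rightarrow> 'k point set" where
  "pole_set K = insert Infinity {Affine x y | x y. on_curve E (Affine x y) \<and> x \<noteq> 0 \<and> v x \<le> - K}"

lemma openin_pole_set:
  assumes "K \<ge> 1"
  shows "openin (points_topology v E) (pole_set K)"
  unfolding openin_points_topology
proof (intro conjI ballI)
  show "pole_set K \<subseteq> points E" by (auto simp: pole_set_def points_def)
  fix P assume "P \<in> pole_set K"
  then consider "P = Infinity" | x y where "P = Affine x y" "x \<noteq> 0" "v x \<le> - K"
    by (auto simp: pole_set_def)
  then show "\<exists>M. point_nbhd v E M P \<subseteq> pole_set K"
  proof cases
    case 1
    have "Affine x y \<in> pole_set K"
      if *: "on_curve E (Affine x y)" "y \<noteq> 0" "val_ge v K (x / y)" "val_ge v K (1 / y)" for x y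
    proof -
      have "v y < 0" using *(2,4) assms v_divide[of 1 y] by (simp add: val_ge_def)
      then have x: "x \<noteq> 0" "v x < 0" by (rule pole_of_y_pole[OF *(1,2)])+
      then have "v x - v y \<ge> K" using *(2,3) by (simp add: val_ge_def v_divide)
      then have "v x \<le> - K" using pole_orders[OF *(1) x] x assms by linarith
      then show ?thesis using * x by (simp add: pole_set_def)
    qed
    then show ?thesis unfolding 1 by (intro exI[of _ K]) (auto simp: pole_set_def)
  next
    case (2 x y)
    have "v x < 0" using 2(3) assms by simp
    have "Affine x' y' \<in> pole_set K"
      if "on_curve E (Affine x' y')" "val_ge v 0 (x' - x)" for x' y'
      using v_eq_of_close[OF 2(2) that(2) \<open>v x < 0\<close>] that(1) 2(3) by (simp add: pole_set_def)
    then show ?thesis unfolding 2 by (intro exI[of _ 0]) auto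
  qed
qed

lemma pole_set_subset_nbhd: "\<exists>K\<ge>1. pole_set K \<subseteq> point_nbhd v E M Infinity"
proof (intro exI conjI)
  \<comment> \<open>At a pole 2 v(y) = 3 v(x), so x/y has valuation -v(x)/2; hence the factor
    2.\<close>
  show "2 * max M 1 \<ge> 1" by simp
  show "pole_set (2 * max M 1) \<subseteq> point_nbhd v E M Infinity"
  proof
    fix P assume "P \<in> pole_set (2 * max M 1)"
    then consider "P = Infinity" | x y where "P = Affine x y" "on_curve E P" "x \<noteq> 0" "v x \<le> - (2 * max M 1)"
      by (auto simp: pole_set_def)
    then show "P \<in> point_nbhd v E M Infinity"
    proof cases
      case (2 x y)
      then have y: "y \<noteq> 0" "2 * v y = 3 * v x" using pole_orders[of x y] by auto
      have "val_ge v M (x / y)" "val_ge v M (1 / y)"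
        using 2 y v_divide[of 1 y] by (auto simp: val_ge_def v_divide)
      then show ?thesis using 2 y by auto
    qed simp
  qed
qed

context
  fixes lam :: "'k point \<Rightarrow> real"
  assumes lam: "neron_local_height v E lam"
begin

text \<open>Near infinity the limit condition controls the height minus (1/2) log |x|; elsewhere
  both the height and \<open>vmin\<close> are bounded. This converts heights along powers of two
  into values of G.\<close>

lemma height_bounded:
  "\<exists>A. \<forall>x y. on_curve E (Affine x y) \<longrightarrow>
     \<bar>lam (Affine x y) / ln (real (residue_card v)) + real_of_int (vmin x) / 2\<bar> \<le> A"
proof -
  define q where "q = ln (real (residue_card v))"
  have q: "q > 0" using ln_card_pos by (simp add: q_def)
  obtain L where L: "((\<lambda>Q. lam Q - 1/2 * ln (vabs v (xcoord Q))) \<longlongrightarrow> L) (atin (points_topology v E) Infinity)"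
    using lam unfolding neron_local_height_def by blast
  then have "eventually (\<lambda>Q. dist (lam Q - 1/2 * ln (vabs v (xcoord Q))) L < 1) (atin (points_topology v E) Infinity)"
    by (rule tendstoD) simp
  moreover have "Infinity \<in> topspace (points_topology v E)"
    by (simp add: topspace_points_topology points_def)
  ultimately obtain U where U: "openin (points_topology v E) U" "Infinity \<in> U"
    "\<And>Q. Q \<in> U - {Infinity} \<Longrightarrow> dist (lam Q - 1/2 * ln (vabs v (xcoord Q))) L < 1"
    unfolding eventually_atin by blast
  obtain M where M: "point_nbhd v E M Infinity \<subseteq> U" using U unfolding openin_points_topology by blast
  obtain K where K: "K \<ge> 1" "pole_set K \<subseteq> point_nbhd v E M Infinity" using pole_set_subset_nbhd by blast
  have "bounded (lam ` (points E - pole_set K))"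
    using lam openin_pole_set[OF K(1)] unfolding neron_local_height_def by (simp add: pole_set_def)
  then obtain A where A: "\<And>P. P \<in> points E - pole_set K \<Longrightarrow> \<bar>lam P\<bar> \<le> A"
    unfolding bounded_iff by auto
  have "\<bar>lam (Affine x y) / q + real_of_int (vmin x) / 2\<bar> \<le> max ((\<bar>L\<bar> + 1) / q) (A / q + real_of_int K)"
    if on: "on_curve E (Affine x y)" for x y
  proof (cases "Affine x y \<in> pole_set K")
    case True
    then have x: "x \<noteq> 0" "v x \<le> - K" by (auto simp: pole_set_def)
    have "Affine x y \<in> U - {Infinity}" using True K M by auto
    from U(3)[OF this] have "\<bar>lam (Affine x y) - 1/2 * ln (vabs v x)\<bar> \<le> \<bar>L\<bar> + 1"
      by (simp add: dist_real_def)
    moreover have "lam (Affine x y) - 1/2 * ln (vabs v x) = q * (lam (Affine x y) / q + real_of_int (vmin x) / 2)"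
      using x K(1) q ln_vabs[OF x(1)] by (simp add: vmin_def q_def[symmetric] field_simps)
    ultimately have "q * \<bar>lam (Affine x y) / q + real_of_int (vmin x) / 2\<bar> \<le> \<bar>L\<bar> + 1"
      using q by (simp add: abs_mult)
    then have "\<bar>lam (Affine x y) / q + real_of_int (vmin x) / 2\<bar> \<le> (\<bar>L\<bar> + 1) / q"
      using q by (simp add: field_simps)
    then show ?thesis by linarith
  next
    case False
    then have "\<bar>lam (Affine x y)\<bar> \<le> A" using A on by (auto simp: points_def)
    then have "\<bar>lam (Affine x y) / q\<bar> \<le> A / q" using q by (simp add: divide_right_mono)
    moreover have "x = 0 \<or> v x > - K" using False on by (auto simp: pole_set_def)
    then have "- K \<le> vmin x" "vmin x \<le> 0" using K by (auto simp: vmin_def)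
    then have "\<bar>real_of_int (vmin x) / 2\<bar> \<le> real_of_int K" by linarith
    ultimately have "\<bar>lam (Affine x y) / q + real_of_int (vmin x) / 2\<bar> \<le> A / q + real_of_int K" by linarith
    then show ?thesis by linarith
  qed
  then show ?thesis unfolding q_def by blast
qed

lemma height_continuous:
  assumes on: "on_curve E (Affine x0 y0)" and int: "val_ge v 0 x0" and \<epsilon>: "\<epsilon> > 0"
  shows "\<exists>M. \<forall>x y. on_curve E (Affine x y) \<longrightarrow> val_ge v M (x - x0) \<longrightarrow> val_ge v M (y - y0) \<longrightarrow>
    \<bar>lam (Affine x y) - lam (Affine x0 y0)\<bar> < \<epsilon>"
proof -
  define Y where "Y = points E - pole_set 1"
  have mem: "Affine x y \<in> Y \<longleftrightarrow> on_curve E (Affine x y) \<and> val_ge v 0 x" for x y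
    by (auto simp: Y_def points_def pole_set_def val_ge_def)
  have cont: "continuous_map (subtopology (points_topology v E) Y) euclideanreal lam"
    using lam openin_pole_set[of 1] unfolding neron_local_height_def Y_def by (simp add: pole_set_def)
  have "openin (subtopology (points_topology v E) Y)
      {Q \<in> topspace (subtopology (points_topology v E) Y). lam Q \<in> ball (lam (Affine x0 y0)) \<epsilon>}"
    by (rule openin_continuous_map_preimage[OF cont]) simp
  then obtain T where T: "openin (points_topology v E) T"
    "{Q \<in> topspace (subtopology (points_topology v E) Y). lam Q \<in> ball (lam (Affine x0 y0)) \<epsilon>} = T \<inter> Y"
    unfolding openin_subtopology by blast
  have top: "topspace (subtopology (points_topology v E) Y) = Y"
    by (auto simp: topspace_points_topology Y_def)
  have "Affine x0 y0 \<in> T \<inter> Y" unfolding T(2)[symmetric] top using mem on int \<epsilon> by simp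
  then obtain M where M: "point_nbhd v E M (Affine x0 y0) \<subseteq> T"
    using T(1) unfolding openin_points_topology by blast
  have "\<bar>lam (Affine x y) - lam (Affine x0 y0)\<bar> < \<epsilon>"
    if "on_curve E (Affine x y)" "val_ge v (max M 0) (x - x0)" "val_ge v (max M 0) (y - y0)" for x y
  proof -
    have "val_ge v M (x - x0)" "val_ge v M (y - y0)" "val_ge v 0 (x - x0)"
      using that by (auto intro: val_ge_mono)
    then have "Affine x y \<in> T" "Affine x y \<in> Y"
      using M that val_ge_add[of 0 "x - x0" x0] int by (auto simp: mem)
    then have "lam (Affine x y) \<in> ball (lam (Affine x0 y0)) \<epsilon>" using T(2) by blast
    then show ?thesis by (simp add: dist_real_def abs_minus_commute)
  qed
  then show ?thesis by blast
qed

definition quad_coeff :: "'k \<Rightarrow> 'k \<Rightarrow> real" where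
  "quad_coeff x y = - lam (Affine x y) / ln (real (residue_card v)) + real_of_int (v (disc E)) / 12"

definition x_multiple :: "'k \<Rightarrow> 'k \<Rightarrow> nat \<Rightarrow> 'k" where
  "x_multiple x y n = x - eds E (Affine x y) (n - 1) * eds E (Affine x y) (n + 1) / (eds E (Affine x y) n)^2"

definition pole_depth :: "'k \<Rightarrow> 'k \<Rightarrow> nat \<Rightarrow> int" where
  "pole_depth x y n = - vmin (x_multiple x y n)"

lemma pole_depth_nonneg: "pole_depth x y n \<ge> 0"
  using vmin_le_0 by (simp add: pole_depth_def)

lemma v_of_nat_p: "v (of_nat p) = e"
  using v_of_nat[of p] p by (simp add: prime_gt_0_nat)

section \<open>Uniform estimate at generic points\<close>

context
  fixes x y assumes gen: "generic_curve_point E x y"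
begin

interpretation generic_curve_point E x y
  by (rule gen)

interpretation H: height_sequence v "b2 E" "b4 E" "b6 E" "b8 E" "disc E" W xs
  by (rule height_sequence[OF normalized b_integral disc])

lemma pole_depth_eq: "n \<ge> 1 \<Longrightarrow> pole_depth x y n = H.depth n"
  by (simp add: pole_depth_def H.depth_def x_multiple_def xs_eq)

text \<open>The combination on the left is multiplied by exactly 4 when n is doubled: v(W_2n) - 4
  v(W_n) is the valuation of 2y + a1 x + a3 at [n]Q, which the functional equation of the height
  cancels. The constant 1/12 is the c with 4c = c + 1/4, absorbing the discriminant term.\<close>

lemma doubling_chain:
  "\<exists>y'. on_curve E (Affine (xs (2 ^ k)) y') \<and>
    real_of_int (v (W (2 ^ k))) - lam (Affine (xs (2 ^ k)) y') / ln (real (residue_card v))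
      + real_of_int (v (disc E)) / 12 = 4 ^ k * quad_coeff x y"
proof (induction k)
  case 0
  have "xs (2 ^ 0) = x" "v (W (2 ^ 0)) = 0" using xs_1 W_1 by simp_all
  then show ?case using on_curve by (intro exI[of _ y]) (simp add: quad_coeff_def del: on_curve.simps)
next
  case (Suc k)
  have arith: "w' - a + d / 12 = 4 * (w - b + d / 12)"
    if "a = 4 * b + h - d / 4" "w' = 4 * w + h" for a b d h w w' :: real
    using that by simp
  define n where "n = (2::nat) ^ k"
  have n: "n \<ge> 1" by (simp add: n_def)
  define q where "q = ln (real (residue_card v))"
  have q: "q > 0" using ln_card_pos by (simp add: q_def)
  obtain y' where y': "on_curve E (Affine (xs n) y')"
    "real_of_int (v (W n)) - lam (Affine (xs n) y') / q + real_of_int (v (disc E)) / 12 = 4 ^ k * quad_coeff x y"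
    using Suc unfolding n_def q_def by blast
  interpret Q: curve_point E "xs n" y' by unfold_locales (rule y')
  have c6: "Q.c6 = H.denom n" by (simp add: Q.c6_def H.denom_def algebra_simps)
  have \<eta>: "Q.\<eta> \<noteq> 0" using H.denom_nonzero[OF n] Q.eta_square c6 by auto
  obtain x'' y'' where D: "ec_mult E 2 (Affine (xs n) y') = Affine x'' y''" "on_curve E (Affine x'' y'')"
    "x'' * Q.c6 = xs n ^ 4 - b4 E * (xs n)^2 - 2 * b6 E * xs n - b8 E"
    using Q.double_point[OF \<eta>] by metis
  have "x'' * H.denom n = H.numer n" using D(3) by (simp add: c6 H.numer_def)
  then have x'': "x'' = xs (2 * n)"
    using H.denom_nonzero[OF n] by (simp add: H.x_double'[OF n] eq_divide_eq)
  have "lam (Affine x'' y'') = 4 * lam (Affine (xs n) y') - ln (vabs v Q.\<eta>) + 1/4 * ln (vabs v (disc E))"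
    using lam y'(1) D(1) unfolding neron_local_height_def points_def Q.\<eta>_def by force
  also have "\<dots> = 4 * lam (Affine (xs n) y') + real_of_int (v Q.\<eta>) * q - real_of_int (v (disc E)) * q / 4"
    using ln_vabs[OF \<eta>] ln_vabs[OF disc] by (simp add: q_def)
  finally have "lam (Affine x'' y'') / q = 4 * (lam (Affine (xs n) y') / q) + v Q.\<eta> - v (disc E) / 4"
    using q by (simp add: add_divide_distrib diff_divide_distrib)
  moreover have "real_of_int (v (W (2 * n))) = 4 * real_of_int (v (W n)) + real_of_int (v Q.\<eta>)"
  proof -
    have "2 * v Q.\<eta> = v (H.denom n)"
      using Q.eta_square v_power[OF \<eta>, of 2] by (simp add: c6)
    then show ?thesis using H.v_W_double[OF n] by simp
  qed
  ultimately have "real_of_int (v (W (2 * n))) - lam (Affine x'' y'') / q + real_of_int (v (disc E)) / 12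
      = 4 * (real_of_int (v (W n)) - lam (Affine (xs n) y') / q + real_of_int (v (disc E)) / 12)"
    by (rule arith)
  also have "\<dots> = 4 ^ Suc k * quad_coeff x y" by (simp only: y'(2)) simp
  finally have "real_of_int (v (W (2 * n))) - lam (Affine x'' y'') / q + real_of_int (v (disc E)) / 12
      = 4 ^ Suc k * quad_coeff x y" .
  moreover have "2 * n = 2 ^ Suc k" by (simp add: n_def)
  ultimately show ?case using D(2) unfolding x'' q_def by (metis (no_types))
qed

lemma generic_bound:
  assumes "n \<ge> 1"
  shows "\<bar>2 * real_of_int (v (W n)) - real_of_int (pole_depth x y n) - 2 * quad_coeff x y * (real n)^2\<bar> \<le> real_of_int (v (disc E))"
proof -
  obtain A where A: "\<And>x y. on_curve E (Affine x y) \<Longrightarrow>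
     \<bar>lam (Affine x y) / ln (real (residue_card v)) + real_of_int (vmin x) / 2\<bar> \<le> A"
    using height_bounded by blast
  have "\<bar>real_of_int (H.G (2 ^ k)) - 2 * quad_coeff x y * (2 ^ k)^2\<bar> \<le> 2 * A + \<bar>real_of_int (v (disc E))\<bar> / 6" for k
  proof -
    obtain y' where y': "on_curve E (Affine (xs (2 ^ k)) y')"
      "real_of_int (v (W (2 ^ k))) - lam (Affine (xs (2 ^ k)) y') / ln (real (residue_card v))
      + real_of_int (v (disc E)) / 12 = 4 ^ k * quad_coeff x y"
      using doubling_chain by blast
    have arith: "2 * w + m - 2 * c * r = 2 * (a + m / 2) - d / 6" if "w - a + d / 12 = r * c"
      for a c d m r w :: real
    proof -
      have "2 * c * r = 2 * (w - a + d / 12)" unfolding that by simp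
      then show ?thesis by simp
    qed
    have pow: "((2::real) ^ k)^2 = 4 ^ k" by (simp add: power2_eq_square power_mult_distrib[symmetric])
    have "real_of_int (H.G (2 ^ k)) - 2 * quad_coeff x y * (2 ^ k)^2 =
      2 * (lam (Affine (xs (2 ^ k)) y') / ln (real (residue_card v)) + real_of_int (vmin (xs (2 ^ k))) / 2)
        - real_of_int (v (disc E)) / 6"
      unfolding H.G_def pow using arith[OF y'(2)] by simp
    moreover have "\<bar>2 * u - d / 6\<bar> \<le> 2 * A + \<bar>d\<bar> / 6" if "\<bar>u\<bar> \<le> A" for u d :: real
      using that by linarith
    ultimately show ?thesis using A[OF y'(1)] by simp
  qed
  from H.G_quadratic[OF this assms] show ?thesis
    using pole_depth_eq[OF assms] by (simp add: H.G_def H.depth_def)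
qed

lemma pole_depth_diff:
  assumes "n \<ge> 1" "m > n" "\<mu> > 0" "pole_depth x y m \<ge> \<mu>" "pole_depth x y n \<ge> \<mu>"
  shows "pole_depth x y (m - n) \<ge> \<mu>"
  using H.inverse_roots(2)[of n m \<mu>] assms by (simp add: pole_depth_eq)

lemma pole_depth_dvd:
  assumes "\<mu> > 0" "n0 \<ge> 1" "pole_depth x y n0 \<ge> \<mu>" "\<And>i. 1 \<le> i \<Longrightarrow> i < n0 \<Longrightarrow> pole_depth x y i < \<mu>"
    "n \<ge> 1" "pole_depth x y n \<ge> \<mu>"
  shows "n0 dvd n"
  by (rule H.least_deep_dvd[OF assms(1,2)]) (use assms in \<open>simp_all add: pole_depth_eq\<close>)

lemma pole_depth_multiple:
  assumes "n \<ge> 1" "k \<ge> 1" "pole_depth x y n > 2 * e"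
  shows "pole_depth x y (k * n) = pole_depth x y n + 2 * v (of_nat k)"
proof -
  have unit: "v (of_nat k) = 0" if "\<not> p dvd k" for k
  proof -
    have "k > 0" using that by (cases k) auto
    then show ?thesis using v_of_nat[of k] that by (simp add: not_dvd_imp_multiplicity_0)
  qed
  have "k * n \<ge> 1" using assms by simp
  then show ?thesis
    using H.depth_multiple[OF p unit assms(1) _ assms(2)] assms by (simp add: pole_depth_eq v_of_nat_p)
qed

end

section \<open>Approximation by generic points\<close>

context
  fixes x0 y0 s t
  assumes on: "on_curve E (Affine x0 y0)" and int: "val_ge v 0 x0" "val_ge v 0 y0"
    and gen: "\<And>j. generic_curve_point E (s j) (t j)" and s: "tends s x0" and t: "tends t y0"
begin

abbreviation W0 :: "nat \<Rightarrow> 'k" where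
  "W0 \<equiv> eds E (Affine x0 y0)"

abbreviation Ws :: "nat \<Rightarrow> nat \<Rightarrow> 'k" where
  "Ws j \<equiv> eds E (Affine (s j) (t j))"

lemma tends_eds: "tends (\<lambda>j. Ws j n) (W0 n)"
  unfolding eds.simps by (rule tends_poly_poly[OF s t])

lemma eventually_v_eds:
  "W0 n \<noteq> 0 \<Longrightarrow> eventually (\<lambda>j. v (Ws j n) = v (W0 n)) sequentially"
  using tends_eventually_v[OF tends_eds] by (rule eventually_mono) auto

lemma eventually_pole_depth:
  assumes "W0 n \<noteq> 0"
  shows "eventually (\<lambda>j. pole_depth (s j) (t j) n = pole_depth x0 y0 n) sequentially"
proof -
  have "tends (\<lambda>j. x_multiple (s j) (t j) n) (x_multiple x0 y0 n)"
    unfolding x_multiple_def divide_inverse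
    by (intro tends_diff s tends_mult tends_eds tends_inverse tends_power) (use assms in simp)
  then have "eventually (\<lambda>j. val_ge v 0 (x_multiple (s j) (t j) n - x_multiple x0 y0 n)) sequentially"
    by (simp add: tends_iff_eventually)
  then show ?thesis by (rule eventually_mono) (simp add: pole_depth_def vmin_close)
qed

lemma eventually_quad_coeff:
  assumes "\<epsilon> > 0"
  shows "eventually (\<lambda>j. \<bar>quad_coeff (s j) (t j) - quad_coeff x0 y0\<bar> < \<epsilon>) sequentially"
proof -
  define q where "q = ln (real (residue_card v))"
  have q: "q > 0" using ln_card_pos by (simp add: q_def)
  obtain M where M: "\<And>x y. on_curve E (Affine x y) \<Longrightarrow> val_ge v M (x - x0) \<Longrightarrow> val_ge v M (y - y0) \<Longrightarrow>
    \<bar>lam (Affine x y) - lam (Affine x0 y0)\<bar> < \<epsilon> * q"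
    using height_continuous[OF on int(1), of "\<epsilon> * q"] assms q by auto
  have "eventually (\<lambda>j. val_ge v M (s j - x0)) sequentially" "eventually (\<lambda>j. val_ge v M (t j - y0)) sequentially"
    using s t by (simp_all add: tends_iff_eventually)
  then show ?thesis
  proof eventually_elim
    case (elim j)
    have "on_curve E (Affine (s j) (t j))"
      using gen[of j] by (simp add: generic_curve_point_def curve_point_def del: on_curve.simps)
    then have "\<bar>lam (Affine (s j) (t j)) - lam (Affine x0 y0)\<bar> < \<epsilon> * q" using M elim by blast
    moreover have "quad_coeff (s j) (t j) - quad_coeff x0 y0 = - ((lam (Affine (s j) (t j)) - lam (Affine x0 y0)) / q)"
      by (simp add: quad_coeff_def q_def diff_divide_distrib)
    ultimately show ?case using q by (simp add: abs_divide divide_less_eq)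
  qed
qed

text \<open>Along the approximating points \<open>v (Ws j n)\<close> tends to infinity, while the
  quadratic term stays bounded; the uniform estimate leaves only the pole order to
  compensate.\<close>

lemma eventually_pole_depth_ge:
  assumes "n \<ge> 1" "W0 n = 0"
  shows "eventually (\<lambda>j. pole_depth (s j) (t j) n \<ge> K) sequentially"
proof -
  define d where "d = real_of_int (v (disc E))"
  obtain N :: int where N: "2 * real_of_int N \<ge> real_of_int K + d + 2 * (quad_coeff x0 y0 + 1) * (real n)^2"
  proof -
    obtain N :: int where "(real_of_int K + d + 2 * (quad_coeff x0 y0 + 1) * (real n)^2) / 2 \<le> real_of_int N"
      using ex_le_of_int by blast
    then show thesis by (intro that[of N]) (simp add: field_simps)
  qed
  have "eventually (\<lambda>j. val_ge v N (Ws j n)) sequentially"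
    using tends_eds[of n] assms(2) by (simp add: tends_iff_eventually)
  moreover have "eventually (\<lambda>j. \<bar>quad_coeff (s j) (t j) - quad_coeff x0 y0\<bar> < 1) sequentially"
    by (rule eventually_quad_coeff) simp
  ultimately show ?thesis
  proof eventually_elim
    case (elim j)
    have "Ws j n \<noteq> 0"
      using gen[of j] assms(1) generic_curve_point.generic by blast
    then have vN: "v (Ws j n) \<ge> N" using elim(1) by (simp add: val_ge_def)
    have "quad_coeff (s j) (t j) * (real n)^2 \<le> (quad_coeff x0 y0 + 1) * (real n)^2"
      using elim(2) by (intro mult_right_mono) auto
    then have "real_of_int (pole_depth (s j) (t j) n) \<ge> real_of_int K"
      using generic_bound[OF gen[of j] assms(1)] N vN unfolding d_def by linarith
    then show ?case by simp
  qed
qed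

text \<open>A zero of \<open>W0\<close> is an index at which the approximating points become
  arbitrarily deep. Depth passes to differences, but at n - N it is eventually constant unless
  \<open>W0\<close> vanishes there too.\<close>

lemma zeros_dvd:
  assumes N: "N \<ge> 1" "W0 N = 0" and least: "\<And>i. 1 \<le> i \<Longrightarrow> i < N \<Longrightarrow> W0 i \<noteq> 0"
    and n: "n \<ge> 1" "W0 n = 0"
  shows "N dvd n"
  using n
proof (induction n rule: less_induct)
  case (less n)
  consider "n < N" | "n = N" | "n > N" by linarith
  then show ?case
  proof cases
    case 1
    then show ?thesis using least less.prems by blast
  next
    case 3
    have "W0 (n - N) = 0"
    proof (rule ccontr)
      assume "W0 (n - N) \<noteq> 0"
      define K where "K = pole_depth x0 y0 (n - N) + 1"
      have K: "K > 0" using pole_depth_nonneg[of x0 y0 "n - N"] by (simp add: K_def)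
      have "eventually (\<lambda>j. False) sequentially"
        using eventually_pole_depth[OF \<open>W0 (n - N) \<noteq> 0\<close>] eventually_pole_depth_ge[OF N, of K] eventually_pole_depth_ge[OF less.prems, of K]
      proof eventually_elim
        case (elim j)
        then show ?case using pole_depth_diff[OF gen[of j] N(1) 3 K] by (simp add: K_def)
      qed
      then show False by simp
    qed
    then have "N dvd n - N" using less.IH[of "n - N"] 3 N(1) by simp
    then show ?thesis using 3 by (simp add: dvd_minus_self)
  qed simp
qed

text \<open>This matches the index set of the theorem with the indices where valuations are
  meaningful: the first zero is a period of the multiples of P, and every other zero is a multiple
  of it.\<close>

lemma eds_nonzero:
  assumes "n \<ge> 1" "ec_mult E n (Affine x0 y0) \<noteq> Infinity"
  shows "W0 n \<noteq> 0"
proof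
  assume n: "W0 n = 0"
  define N where "N = (LEAST N. N \<ge> 1 \<and> W0 N = 0)"
  have N: "N \<ge> 1" "W0 N = 0" and least: "\<And>i. 1 \<le> i \<Longrightarrow> i < N \<Longrightarrow> W0 i \<noteq> 0"
    using LeastI[of "\<lambda>N. N \<ge> 1 \<and> W0 N = 0" n] not_less_Least[of _ "\<lambda>N. N \<ge> 1 \<and> W0 N = 0"] n assms(1)
    unfolding N_def by blast+
  interpret curve_point E x0 y0 by unfold_locales (rule on)
  have "ec_mult E N (Affine x0 y0) = Infinity" using ec_mult_eq_Infinity[OF N] least by blast
  moreover obtain j where "n = j * N" using zeros_dvd[OF N least assms(1) n] by (metis dvdE mult.commute)
  ultimately show False using ec_mult_multiple_period assms(2) by blast
qed

lemma v_of_nat_le_ln: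
  assumes "k \<ge> 1"
  shows "real_of_int (v (of_nat k)) \<le> real_of_int e * (ln (real k) / ln 2)"
proof -
  have "2 ^ multiplicity p k \<le> p ^ multiplicity p k"
    using p prime_ge_2_nat by (intro power_mono) auto
  also have "\<dots> \<le> k" using assms by (intro dvd_imp_le multiplicity_dvd) simp
  finally have "real (2 ^ multiplicity p k) \<le> real k" by (simp only: of_nat_le_iff)
  then have "ln (real (2 ^ multiplicity p k)) \<le> ln (real k)" using assms by (intro ln_mono) auto
  then have "real (multiplicity p k) \<le> ln (real k) / ln 2"
    by (simp add: ln_realpow field_simps)
  then have "real_of_int e * real (multiplicity p k) \<le> real_of_int e * (ln (real k) / ln 2)"
    using e by (intro mult_left_mono) simp_all
  then show ?thesis using assms by (simp add: v_of_nat)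
qed

text \<open>The least index N that is deep or a zero is the least deep index of all close generic
  points. Any deep n is therefore k N, and its depth exceeds that of N by 2 v(k), which is at most
  logarithmic in n.\<close>

lemma pole_depth_logarithmic:
  "\<exists>C. \<forall>n\<ge>1. W0 n \<noteq> 0 \<longrightarrow> real_of_int (pole_depth x0 y0 n) \<le> C + 2 * real_of_int e / ln 2 * ln (real n)"
proof -
  \<comment> \<open>The exact multiplication rule starts at depths above 2 v(p) = 2e.\<close>
  define \<mu> where "\<mu> = 2 * e + 1"
  have \<mu>: "\<mu> > 0" using e by (simp add: \<mu>_def)
  define S where "S = {n. n \<ge> 1 \<and> (W0 n = 0 \<or> pole_depth x0 y0 n \<ge> \<mu>)}"
  have "\<exists>C\<ge>real_of_int \<mu>. \<forall>n\<ge>1. W0 n \<noteq> 0 \<longrightarrow> pole_depth x0 y0 n \<ge> \<mu> \<longrightarrow>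
    real_of_int (pole_depth x0 y0 n) \<le> C + 2 * real_of_int e / ln 2 * ln (real n)"
  proof (cases "S = {}")
    case True
    then show ?thesis by (intro exI[of _ "real_of_int \<mu>"]) (auto simp: S_def)
  next
    case False
    define N where "N = (LEAST N. N \<in> S)"
    have "N \<in> S" and least: "\<And>i. i < N \<Longrightarrow> i \<notin> S"
      using LeastI_ex[of "\<lambda>N. N \<in> S"] False not_less_Least[of _ "\<lambda>N. N \<in> S"]
      unfolding N_def by blast+
    then have N: "N \<ge> 1" "W0 N = 0 \<or> pole_depth x0 y0 N \<ge> \<mu>" by (auto simp: S_def)
    have below: "eventually (\<lambda>j. \<forall>i\<in>{1..<N}. pole_depth (s j) (t j) i < \<mu>) sequentially"
    proof (intro eventually_ball_finite ballI)
      fix i assume i: "i \<in> {1..<N}"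
      then have "W0 i \<noteq> 0" "pole_depth x0 y0 i < \<mu>" using least[of i] by (auto simp: S_def)
      from eventually_pole_depth[OF this(1)] show "eventually (\<lambda>j. pole_depth (s j) (t j) i < \<mu>) sequentially"
        by (rule eventually_mono) (use \<open>pole_depth x0 y0 i < \<mu>\<close> in simp)
    qed simp
    have "real_of_int (pole_depth x0 y0 n) \<le> max (real_of_int \<mu>) (real_of_int (pole_depth x0 y0 N)) + 2 * real_of_int e / ln 2 * ln (real n)"
      if n: "n \<ge> 1" "W0 n \<noteq> 0" "pole_depth x0 y0 n \<ge> \<mu>" for n
    proof -
      \<comment> \<open>If \<open>W0 N\<close> = 0, the approximating points can be made deeper at N
        than P is at n. As N divides n and depth does not decrease under multiples, this is absurd;
        so in the presence of such n, N is not a zero and its depth is that of P.\<close>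
      define D where "D = (if W0 N = 0 then pole_depth x0 y0 n + 1 else pole_depth x0 y0 N)"
      have "eventually (\<lambda>j. pole_depth (s j) (t j) N \<ge> \<mu> \<and>
          (if W0 N = 0 then pole_depth (s j) (t j) N \<ge> D else pole_depth (s j) (t j) N = D)) sequentially"
      proof (cases "W0 N = 0")
        case True
        show ?thesis
          using eventually_pole_depth_ge[OF N(1) True, of \<mu>] eventually_pole_depth_ge[OF N(1) True, of D]
          by eventually_elim (simp add: True)
      next
        case False
        then show ?thesis using eventually_pole_depth[OF False] N(2) by (auto simp: D_def elim: eventually_mono)
      qed
      then have "eventually (\<lambda>j. pole_depth x0 y0 N = D \<and> real_of_int (pole_depth x0 y0 n) \<le> real_of_int (pole_depth x0 y0 N) + 2 * real_of_int e / ln 2 * ln (real n)) sequentially"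
        using below eventually_pole_depth[OF n(2)]
      proof eventually_elim
        case (elim j)
        have "N dvd n"
          by (rule pole_depth_dvd[OF gen[of j] \<mu> N(1)]) (use elim n in auto)
        then obtain k where k: "n = k * N" by (metis dvdE mult.commute)
        have k1: "k \<ge> 1" using k n(1) by (cases k) auto
        have mult: "pole_depth x0 y0 n = pole_depth (s j) (t j) N + 2 * v (of_nat k)"
          using pole_depth_multiple[OF gen[of j] N(1) k1] elim k by (simp add: \<mu>_def)
        have "v (of_nat k :: 'k) \<ge> 0" using v_of_nat[of k] k1 e by simp
        then have "W0 N \<noteq> 0" using mult elim(1) by (auto simp: D_def)
        then have "pole_depth (s j) (t j) N = pole_depth x0 y0 N" "D = pole_depth x0 y0 N" using elim(1) by (simp_all add: D_def)
        moreover have "ln (real k) \<le> ln (real n)"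
          using k k1 N(1) n(1) by (intro ln_mono) auto
        then have "real_of_int e * (ln (real k) / ln 2) \<le> real_of_int e * (ln (real n) / ln 2)"
          using e by (intro mult_left_mono divide_right_mono) auto
        then have "real_of_int (v (of_nat k :: 'k)) \<le> real_of_int e * (ln (real n) / ln 2)"
          using v_of_nat_le_ln[OF k1] by linarith
        ultimately show ?case using mult by simp
      qed
      then obtain j :: nat where "real_of_int (pole_depth x0 y0 n) \<le> real_of_int (pole_depth x0 y0 N) + 2 * real_of_int e / ln 2 * ln (real n)"
        using eventually_happens'[OF sequentially_bot] by blast
      then show ?thesis by simp
    qed
    then show ?thesis by (intro exI[of _ "max (real_of_int \<mu>) (real_of_int (pole_depth x0 y0 N))"]) auto
  qed
  then obtain C where C: "C \<ge> real_of_int \<mu>" "\<And>n. n \<ge> 1 \<Longrightarrow> W0 n \<noteq> 0 \<Longrightarrow> pole_depth x0 y0 n \<ge> \<mu> \<Longrightarrow>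
    real_of_int (pole_depth x0 y0 n) \<le> C + 2 * real_of_int e / ln 2 * ln (real n)" by blast
  have "real_of_int (pole_depth x0 y0 n) \<le> C + 2 * real_of_int e / ln 2 * ln (real n)" if n: "n \<ge> 1" "W0 n \<noteq> 0" for n
  proof (cases "pole_depth x0 y0 n \<ge> \<mu>")
    case False
    then have "real_of_int (pole_depth x0 y0 n) \<le> C" using C(1) by linarith
    moreover have "0 \<le> 2 * real_of_int e / ln 2 * ln (real n)" using e n(1) by simp
    ultimately show ?thesis by linarith
  qed (use C n in auto)
  then show ?thesis by blast
qed

lemma eds_valuation_bound:
  assumes n: "n \<ge> 1" "W0 n \<noteq> 0"
  shows "\<bar>2 * real_of_int (v (W0 n)) - real_of_int (pole_depth x0 y0 n) - 2 * quad_coeff x0 y0 * (real n)^2\<bar>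
    \<le> real_of_int (v (disc E)) + 1"
proof -
  \<comment> \<open>The index n is fixed before the approximating point is chosen, so the error in
    the coefficient can be made small against n^2; it contributes at most 1.\<close>
  define \<epsilon> where "\<epsilon> = 1 / (2 * (real n)^2)"
  have \<epsilon>: "\<epsilon> > 0" "2 * \<epsilon> * (real n)^2 = 1" using n(1) by (simp_all add: \<epsilon>_def)
  have "eventually (\<lambda>j. \<bar>2 * real_of_int (v (W0 n)) - real_of_int (pole_depth x0 y0 n) - 2 * quad_coeff x0 y0 * (real n)^2\<bar>
    \<le> real_of_int (v (disc E)) + 1) sequentially"
    using eventually_v_eds[OF n(2)] eventually_pole_depth[OF n(2)] eventually_quad_coeff[OF \<epsilon>(1)]
  proof eventually_elim
    case (elim j)
    have "\<bar>quad_coeff (s j) (t j) - quad_coeff x0 y0\<bar> * (2 * (real n)^2) \<le> \<epsilon> * (2 * (real n)^2)"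
      using elim(3) by (intro mult_right_mono) auto
    then have "\<bar>(quad_coeff (s j) (t j) - quad_coeff x0 y0) * (2 * (real n)^2)\<bar> \<le> 1"
      using \<epsilon>(2) by (simp add: abs_mult mult.commute mult.left_commute)
    moreover have "(quad_coeff (s j) (t j) - quad_coeff x0 y0) * (2 * (real n)^2) = 2 * quad_coeff (s j) (t j) * (real n)^2 - 2 * quad_coeff x0 y0 * (real n)^2"
      by (simp add: algebra_simps)
    ultimately show ?case using generic_bound[OF gen[of j] n(1)] elim(1,2) by linarith
  qed
  then show ?thesis using eventually_happens'[OF sequentially_bot] by blast
qed

lemma eds_valuation_asymptotics:
  "(\<lambda>n. real_of_int (v (W0 n)) - quad_coeff x0 y0 * (real n)^2)
    \<in> O[inf at_top (principal {n. n > 0 \<and> ec_mult E n (Affine x0 y0) \<noteq> Infinity})](\<lambda>n. ln (real n))"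
proof -
  define d where "d = real_of_int (v (disc E)) + 1"
  define a where "a = 2 * real_of_int e / ln 2"
  obtain C where C: "\<And>n. n \<ge> 1 \<Longrightarrow> W0 n \<noteq> 0 \<Longrightarrow> real_of_int (pole_depth x0 y0 n) \<le> C + a * ln (real n)"
    using pole_depth_logarithmic unfolding a_def by blast
  have "norm (real_of_int (v (W0 n)) - quad_coeff x0 y0 * (real n)^2) \<le> (\<bar>d\<bar> + \<bar>C\<bar> + \<bar>a\<bar>) * norm (ln (real n))"
    if n: "n \<ge> 3" "ec_mult E n (Affine x0 y0) \<noteq> Infinity" for n
  proof -
    have n1: "n \<ge> 1" using n by simp
    have nz: "W0 n \<noteq> 0" using eds_nonzero[OF n1 n(2)] .
    \<comment> \<open>From n = 3 on the logarithm is at least 1, so the additive constants can be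
      absorbed into it.\<close>
    have "exp 1 \<le> real n" using exp_le n(1) by linarith
    then have ln: "ln (real n) \<ge> 1" using n(1) by (subst ln_ge_iff) auto
    have "\<bar>2 * real_of_int (v (W0 n)) - real_of_int (pole_depth x0 y0 n) - 2 * (quad_coeff x0 y0 * (real n)^2)\<bar> \<le> d"
      using eds_valuation_bound[OF n1 nz] by (simp add: d_def mult.assoc)
    moreover have "0 \<le> real_of_int (pole_depth x0 y0 n)" using pole_depth_nonneg by simp
    ultimately have "\<bar>real_of_int (v (W0 n)) - quad_coeff x0 y0 * (real n)^2\<bar> \<le> \<bar>d\<bar> + real_of_int (pole_depth x0 y0 n)"
      by linarith
    also have "\<dots> \<le> \<bar>d\<bar> + (\<bar>C\<bar> + \<bar>a\<bar> * ln (real n))"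
    proof -
      have "a * ln (real n) \<le> \<bar>a\<bar> * ln (real n)" using ln by (intro mult_right_mono) auto
      then show ?thesis using C[OF n1 nz] by linarith
    qed
    also have "\<dots> \<le> \<bar>d\<bar> * ln (real n) + (\<bar>C\<bar> * ln (real n) + \<bar>a\<bar> * ln (real n))"
      using ln by (intro add_mono) (simp_all add: mult_le_cancel_left1)
    finally show ?thesis using ln by (simp add: algebra_simps)
  qed
  then have "eventually (\<lambda>n. n \<in> {n. n > 0 \<and> ec_mult E n (Affine x0 y0) \<noteq> Infinity} \<longrightarrow>
      norm (real_of_int (v (W0 n)) - quad_coeff x0 y0 * (real n)^2) \<le> (\<bar>d\<bar> + \<bar>C\<bar> + \<bar>a\<bar>) * norm (ln (real n))) at_top"
    by (intro eventually_mono[OF eventually_ge_at_top[of 3]]) simp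
  then show ?thesis by (intro bigoI) (simp add: eventually_inf_principal)
qed

end

end

end

theorem theorem48:
  fixes p :: nat
    and w :: "'q::field_char_0 \<Rightarrow> int"
    and \<iota> :: "'q \<Rightarrow> 'k::field_char_0"
    and v :: "'k \<Rightarrow> int"
    and E :: "'k weierstrass"
    and lam :: "'k point \<Rightarrow> real"
    and P :: "'k point"
  assumes "prime p"
    and "is_Qp p w"
    and "finite_extension \<iota>"
    and "normalized_valuation v"
    and "extends_valuation w \<iota> v"
    and "elliptic_curve E"
    and "minimal_weierstrass v E"
    and "neron_local_height v E lam"
    and "P \<in> points E"
    and "singular_reduction v E P"
  shows "(\<lambda>n. real_of_int (v (eds E P n))
            - (- lam P / ln (real (residue_card v)) + real_of_int (v (disc E)) / 12) * (real n)^2)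
         \<in> O[inf at_top (principal {n::nat. n > 0 \<and> ec_mult E n P \<noteq> Infinity})](\<lambda>n. ln (real n))"
proof -
  obtain B where B: "finite_dimensional_vector_space (\<lambda>c x. \<iota> c * x) B"
    using \<open>finite_extension \<iota>\<close> unfolding finite_extension_def by blast
  obtain e where e: "e > 0" "\<And>c. c \<noteq> 0 \<Longrightarrow> v (\<iota> c) = e * w c"
    using \<open>extends_valuation w \<iota> v\<close> unfolding extends_valuation_def by blast
  have E: "integral_weierstrass v E" using \<open>minimal_weierstrass v E\<close> by (simp add: minimal_weierstrass_def)
  have w: "normalized_valuation w" using \<open>is_Qp p w\<close> by (simp add: is_Qp_def)
  interpret local_curve v w p \<iota> e B E
    by (intro local_curve.intro padic_extension.intro valued_field.intro padic_extension_axioms.intro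
        local_curve_axioms.intro assms(1,2,4) B e E w assms(6)[unfolded elliptic_curve_def])
  obtain x y where P: "P = Affine x y" "val_ge v 0 x" "val_ge v 0 y"
    using singular_reduction_integral assms(9,10) by blast
  have on: "on_curve E (Affine x y)" using \<open>P \<in> points E\<close> P by (simp add: points_def)
  obtain s t where st: "\<And>j. generic_curve_point E (s j) (t j)" "tends s x" "tends t y"
    using approximation[OF on P(2,3)] by blast
  show ?thesis
    using eds_valuation_asymptotics[OF \<open>neron_local_height v E lam\<close> on P(2,3) st]
    unfolding P quad_coeff_def[OF \<open>neron_local_height v E lam\<close>] .
qed

end
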